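(* Let $M=\mathbb{P}(\mathcal{O}\oplus\mathcal{L})\to\Sigma$ be the admissible manifold over a compact Riemann surface $\Sigma$ of genus $g(\Sigma)>1$. There is a point $x_s\in(0,1)$ such that for the admissible K\"ahler class $\Omega(x,1)$ with $x\in(0,1)$: (1) if $x\in(0,x_s)$, then $M$ admits a smooth admissible extremal metric in $\Omega(x,1)$; (2) if $x=x_s$, then the modified $K$-energy is bounded from below but not proper on $\Omega(x,1)$; moreover $M$ splits into two parts $z^{-1}((-1,z_s))$ and $z^{-1}((z_s,1))$ for some $z_s\in(-1,1)$, and each part admits an admissible extremal metric with a cusp singularity on the fibre (at $z=z_s$); (3) if $x\in(x_s,1)$, then $M$ splits into three parts $z^{-1}((-1,z_1))$, $z^{-1}((z_1,z_2))$, $z^{-1}((z_2,1))$ for some $-1<z_1<z_2<1$: on two of them (the outer ones) the extremal polynomial $F_\Omega$ is positive and the part admits an admissible extremal metric with conical singularities on the fibre, while on the remaining (middle) one $F_\Omega$ is negative, so that it determines no admissible extremal metric with singularities there.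
   Context: $\Sigma$ is a compact Riemann surface with constant curvature K\"ahler metric $(g_\Sigma,\omega_\Sigma)$ of scalar curvature $2s$, and $\mathcal{L}$ is a holomorphic line bundle over $\Sigma$ with $c_1(\mathcal{L})=\frac1{2\pi}[\omega_\Sigma]$, so $s=\frac{2(1-g(\Sigma))}{\deg\mathcal{L}}$. Let $z:M\to[-1,1]$ be the Morse--Bott function with critical set $z^{-1}(\{-1,1\})$ such that $M^0=z^{-1}((-1,1))$ is a principal $\mathbb{C}^*$-bundle over $\Sigma$. Admissible metrics are the K\"ahler metrics $$g=\frac{1+xz}{x}g_\Sigma+\frac{dz^2}{\Theta(z)}+\Theta(z)\theta^2,\qquad \omega_g=\frac{1+xz}{x}\omega_\Sigma+dz\wedge\theta,\qquad x\in(0,1),\qquad( * )$$ with $\theta$ a connection $1$-form, $\theta(K)=1$, $d\theta=\omega_\Sigma$, $K=J\nabla_gz$ generating the $S^1$-action, and fibre complex structure $Jdz=\Theta\theta$. Let $\mathcal{A}(1)=\{\Theta\in C^\infty[-1,1]: \Theta>0\text{ on }(-1,1),\ \Theta(\pm1)=0,\ \Theta'(\pm1)=\mp2\}$; metrics $( * )$ with $\Theta\in\mathcal{A}(1)$ extend smoothly to $M$, and for fixed $x$, after fibre-preserving diffeomorphisms, they are regarded as one K\"ahler class $\Omega(x,1)$. An admissible metric is extremal iff its scalar curvature is affine in $z$. On a part $z^{-1}((a,b))$, an admissible extremal metric is a metric $( * )$ with $\Theta$ smooth and positive on $(a,b)$ and scalar curvature affine in $z$. Extremal polynomial of $\Omega(x,1)$: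 with $p_c(z)=1+xz$, $F_\Omega$ is the unique polynomial with $F_\Omega(\pm1)=0$, $F_\Omega'(-1)=2(1-x)$, $F_\Omega'(1)=-2(1+x)$ and $F_\Omega''(z)=(1+xz)\big(\frac{2sx}{1+xz}+Az+B\big)$ for some constants $A,B$. It determines an admissible extremal metric on $z^{-1}((a,b))$ through $\Theta=F_\Omega/p_c$ when this is positive on $(a,b)$. Potentials: let $u_c(z)=\frac12\big((1-z)\log(1-z)+(1+z)\log(1+z)\big)$ and let $\mathcal{C}_1$ be the set of $u\in C^0([-1,1])$ with $u''>0$ on $(-1,1)$, $u-u_c\in C^\infty([-1,1])$, $u(0)=u'(0)=0$; $\Omega(x,1)$ is identified with $\mathcal{C}_1$ via $\Theta=1/u''$. Let $g_c,\omega_c,J_c$ correspond to $u_c$, and $y_c=u_c'(z)$. With $\varphi_u(y)=-u(z)+yz$, $y=u'(z)$ (Legendre transform), and $\varphi_c$ that of $u_c$, the metric of $u$ in the fixed complex structure $J_c$ has K\"ahler form $\omega_c+dJ_cd\tilde\varphi_u$, $\tilde\varphi_u=\varphi_u(y_c)-\varphi_c(y_c)$. Modified $K$-energy: for a path $\varphi_t$ of such potentials from $0$ to $\varphi$ with metrics $g_t$, and $n=\dim_{\mathbb{C}}M=2$, $\mu_{g_c}(\varphi)=-\int_0^1\int_M\frac{\partial\varphi_t}{\partial t}\,pr^\perp_{g_t}S_{g_t}\,\omega_{g_t}^n\,dt$ (independent of the path), where $pr_g^\perp S_g$ is the part of the scalar curvature $L^2$-orthogonal to the Killing potentials, equal to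 $\frac{F_\Omega''-F''}{p_c}$ with $F=\Theta p_c$. Also $J_{\omega_{g_c}}(\varphi)=\frac1V\int_0^1\int_M\frac{\partial\varphi_t}{\partial t}(\omega_{g_c}^n-\omega_{g_t}^n)\,dt$, $V$ the volume. The modified $K$-energy is bounded below on $\Omega(x,1)$ if $\mu_{g_c}(\tilde\varphi_u)$ is bounded below over $u\in\mathcal{C}_1$; it is proper if there is an increasing $\rho:\mathbb{R}\to\mathbb{R}$ with $\rho(t)\to+\infty$ as $t\to+\infty$ and $\mu_{g_c}(\tilde\varphi_u)\ge\rho(J_{\omega_{g_c}}(\tilde\varphi_u))$ for all $u\in\mathcal{C}_1$. Singularities refer to the fibre metric $g_f=\frac{dz^2}{\Theta}+\Theta\theta^2$. A metric on a Riemann surface has a cusp at $p$ if near $p$ it can be written as $\rho_1(s)ds^2+\rho_2(s)e^{-2s}\theta^2$, $s\in[s_0,\infty)$, with $\rho_1,\rho_2$ positive and smooth at $p$. It is conical with angle $2\pi\kappa$ of order $\gamma$ at $p$ if near $p$ it can be written in polar coordinates as $ds^2+(\kappa^2s^2+O(s^{2+\gamma}))\theta^2$ for some $\kappa,\gamma>0$. *)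

theory Defs
  imports "HOL-Analysis.Analysis" "HOL-Library.Landau_Symbols"
begin

(* The geometric data enter through gen = genus of Sigma and deg = degree of L.
   For gen > 1 the metric g_Sigma has negative curvature, so the universal cover of M^0 with its
   admissible structure is the explicit model on {q > 0} x (-1,1) x R used below for curvature
   computations; integrals over M are reduced by S^1-invariance and constancy along Sigma, using
   "integral of omega_Sigma over Sigma" = 2 pi deg and S^1-orbits of length 2 pi. *)

section \<open>Smooth functions on an interval, up to the endpoints it contains\<close>

definition smooth_on_set :: "real set \<Rightarrow> (real \<Rightarrow> real) \<Rightarrow> bool" where
  "smooth_on_set S f \<longleftrightarrow>
     (\<exists>D :: nat \<Rightarrow> real \<Rightarrow> real. (\<forall>x\<in>S. D 0 x = f x) \<and>
        (\<forall>n. \<forall>x\<in>S. (D n has_real_derivative D (Suc n) x) (at x within S)))"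

section \<open>Scalar curvature of a Riemannian metric in coordinates\<close>

type_synonym pt = "real ^ 4"

definition partial :: "4 \<Rightarrow> (pt \<Rightarrow> real) \<Rightarrow> pt \<Rightarrow> real" where
  "partial i f p = deriv (\<lambda>h. f (p + h *\<^sub>R axis i 1)) 0"

definition christoffel :: "(pt \<Rightarrow> real ^ 4 ^ 4) \<Rightarrow> 4 \<Rightarrow> 4 \<Rightarrow> 4 \<Rightarrow> pt \<Rightarrow> real" where
  "christoffel G k i j p =
     (\<Sum>l\<in>UNIV. matrix_inv (G p) $ k $ l *
        (partial i (\<lambda>r. G r $ j $ l) p + partial j (\<lambda>r. G r $ i $ l) p
         - partial l (\<lambda>r. G r $ i $ j) p)) / 2"

definition ricci :: "(pt \<Rightarrow> real ^ 4 ^ 4) \<Rightarrow> 4 \<Rightarrow> 4 \<Rightarrow> pt \<Rightarrow> real" where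
  "ricci G i j p =
     (\<Sum>k\<in>UNIV. partial k (christoffel G k i j) p - partial j (christoffel G k i k) p
        + (\<Sum>l\<in>UNIV. christoffel G k k l p * christoffel G l i j p
                    - christoffel G k j l p * christoffel G l i k p))"

definition scalar_curvature :: "(pt \<Rightarrow> real ^ 4 ^ 4) \<Rightarrow> pt \<Rightarrow> real" where
  "scalar_curvature G p =
     (\<Sum>i\<in>UNIV. \<Sum>j\<in>UNIV. matrix_inv (G p) $ i $ j * ricci G i j p)"

section \<open>Admissible metrics\<close>

definition base_curv :: "nat \<Rightarrow> nat \<Rightarrow> real" where
  "base_curv gen deg = 2 * (1 - real gen) / real deg"

(* Coordinates (p,q,z,t) with q > 0.  For s < 0,
   g_Sigma = (dp^2 + dq^2) / (-s q^2) has scalar curvature 2s,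
   omega_Sigma = (dp /\ dq) / (-s q^2), and theta = dt + dp / (-s q) satisfies
   d theta = omega_Sigma and theta(K) = 1 for K = d/dt. *)

definition base_metric :: "real \<Rightarrow> pt \<Rightarrow> pt \<Rightarrow> pt \<Rightarrow> real" where
  "base_metric s p v w = (v $ 1 * w $ 1 + v $ 2 * w $ 2) / (- s * (p $ 2)\<^sup>2)"

definition connection_form :: "real \<Rightarrow> pt \<Rightarrow> pt \<Rightarrow> real" where
  "connection_form s p v = v $ 4 + v $ 1 / (- s * p $ 2)"

definition admissible_metric :: "real \<Rightarrow> real \<Rightarrow> (real \<Rightarrow> real) \<Rightarrow> pt \<Rightarrow> pt \<Rightarrow> pt \<Rightarrow> real" where
  "admissible_metric s x \<Theta> p v w =
     (1 + x * p $ 3) / x * base_metric s p v w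
     + v $ 3 * w $ 3 / \<Theta> (p $ 3)
     + \<Theta> (p $ 3) * connection_form s p v * connection_form s p w"

definition admissible_scal :: "real \<Rightarrow> real \<Rightarrow> (real \<Rightarrow> real) \<Rightarrow> pt \<Rightarrow> real" where
  "admissible_scal s x \<Theta> =
     scalar_curvature (\<lambda>p. \<chi> i j. admissible_metric s x \<Theta> p (axis i 1) (axis j 1))"

definition admissible_extremal_on ::
    "real \<Rightarrow> real \<Rightarrow> (real \<Rightarrow> real) \<Rightarrow> real \<Rightarrow> real \<Rightarrow> bool" where
  "admissible_extremal_on s x \<Theta> a b \<longleftrightarrow>
     smooth_on_set {a<..<b} \<Theta> \<and> (\<forall>z\<in>{a<..<b}. \<Theta> z > 0) \<and>
     (\<exists>A B. \<forall>p :: pt. p $ 2 > 0 \<and> p $ 3 \<in> {a<..<b} \<longrightarrow>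
        admissible_scal s x \<Theta> p = A * p $ 3 + B)"

(* The set A(1) of profiles of the smooth admissible metrics on M. *)
definition profiles :: "(real \<Rightarrow> real) set" where
  "profiles = {\<Theta>. smooth_on_set {-1..1} \<Theta> \<and> (\<forall>z\<in>{-1<..<1}. \<Theta> z > 0) \<and>
     \<Theta> (-1) = 0 \<and> \<Theta> 1 = 0 \<and>
     (\<Theta> has_real_derivative 2) (at (-1) within {-1..1}) \<and>
     (\<Theta> has_real_derivative -2) (at 1 within {-1..1})}"

section \<open>The extremal polynomial\<close>

(* In the last clause 1 + x z > 0, so dividing by it is legitimate. *)
definition is_extremal_poly :: "real \<Rightarrow> real \<Rightarrow> real poly \<Rightarrow> bool" where
  "is_extremal_poly s x F \<longleftrightarrow>
     poly F (-1) = 0 \<and> poly F 1 = 0 \<and>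
     poly (pderiv F) (-1) = 2 * (1 - x) \<and> poly (pderiv F) 1 = - 2 * (1 + x) \<and>
     (\<exists>A B. \<forall>z\<in>{-1..1}. poly (pderiv (pderiv F)) z =
        (1 + x * z) * (2 * s * x / (1 + x * z) + A * z + B))"

definition extremal_poly :: "real \<Rightarrow> real \<Rightarrow> real poly" where
  "extremal_poly s x = (THE F. is_extremal_poly s x F)"

definition extremal_profile :: "real \<Rightarrow> real \<Rightarrow> real \<Rightarrow> real" where
  "extremal_profile s x z = poly (extremal_poly s x) z / (1 + x * z)"

section \<open>Potentials\<close>

definition u_c :: "real \<Rightarrow> real" where
  "u_c z = ((1 - z) * ln (1 - z) + (1 + z) * ln (1 + z)) / 2"

definition potentials :: "(real \<Rightarrow> real) set" where
  "potentials = {u. continuous_on {-1..1} u \<and> (\<forall>z\<in>{-1<..<1}. deriv (deriv u) z > 0) \<and>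
     smooth_on_set {-1..1} (\<lambda>z. u z - u_c z) \<and> u 0 = 0 \<and> deriv u 0 = 0}"

definition profile_of :: "(real \<Rightarrow> real) \<Rightarrow> real \<Rightarrow> real" where
  "profile_of u z = 1 / deriv (deriv u) z"

(* The point z in (-1,1) with u'(z) = y. *)
definition moment :: "(real \<Rightarrow> real) \<Rightarrow> real \<Rightarrow> real" where
  "moment u y = the_inv_into {-1<..<1} (deriv u) y"

definition legendre :: "(real \<Rightarrow> real) \<Rightarrow> real \<Rightarrow> real" where
  "legendre u y = - u (moment u y) + y * moment u y"

(* The Kaehler potential of u relative to omega_c, as a function of y = y_c on M^0. *)
definition kpot :: "(real \<Rightarrow> real) \<Rightarrow> real \<Rightarrow> real" where
  "kpot u y = legendre u y - legendre u_c y"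

(* Since J_c dy = theta, a function f of y satisfies
     d J_c d f = f''(y) dy /\ theta + f'(y) omega_Sigma,
   hence omega_c + d J_c d f = base_coeff omega_Sigma + fibre_coeff dy /\ theta. *)

definition base_coeff :: "real \<Rightarrow> (real \<Rightarrow> real) \<Rightarrow> real \<Rightarrow> real" where
  "base_coeff x f y = (1 + x * moment u_c y) / x + deriv f y"

definition fibre_coeff :: "(real \<Rightarrow> real) \<Rightarrow> real \<Rightarrow> real" where
  "fibre_coeff f y = deriv (moment u_c) y + deriv (deriv f) y"

(* Integral over M of h(y) omega^2, where omega = omega_c + d J_c d f. *)
definition int_M :: "nat \<Rightarrow> real \<Rightarrow> (real \<Rightarrow> real) \<Rightarrow> (real \<Rightarrow> real) \<Rightarrow> real" where
  "int_M deg x f h =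
     2 * (2 * pi * real deg) * (2 * pi) *
     (LINT y|lborel. h y * base_coeff x f y * fibre_coeff f y)"

section \<open>The modified K-energy and the functional J\<close>

(* For gen > 1 the Killing potentials are the affine functions of z. *)
definition killing_potentials :: "(real \<Rightarrow> real) set" where
  "killing_potentials = {k. \<exists>a b. k = (\<lambda>z. a * z + b)}"

(* The push-forward of omega_g^2 under z is a multiple of (1 + x z) / x dz. *)
definition killing_part :: "real \<Rightarrow> (real \<Rightarrow> real) \<Rightarrow> real \<Rightarrow> real" where
  "killing_part x S = (THE k. k \<in> killing_potentials \<and>
     (\<forall>h\<in>killing_potentials.
        (LINT z:{-1<..<1}|lborel. (S z - k z) * h z * ((1 + x * z) / x)) = 0))"

(* The scalar curvature depends on z only, so it may be read off along p = 0, q = 1, t = 0. *)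
definition scal_at :: "real \<Rightarrow> real \<Rightarrow> (real \<Rightarrow> real) \<Rightarrow> real \<Rightarrow> real" where
  "scal_at s x \<Theta> z = admissible_scal s x \<Theta> (vector [0, 1, z, 0])"

definition scal_perp :: "real \<Rightarrow> real \<Rightarrow> (real \<Rightarrow> real) \<Rightarrow> real \<Rightarrow> real" where
  "scal_perp s x \<Theta> z = scal_at s x \<Theta> z - killing_part x (scal_at s x \<Theta>) z"

(* U t is the potential in C_1 at time t of a path in Omega(x,1) starting at u_c. *)

definition kenergy_along :: "nat \<Rightarrow> nat \<Rightarrow> real \<Rightarrow> (real \<Rightarrow> real \<Rightarrow> real) \<Rightarrow> real" where
  "kenergy_along gen deg x U =
     - (LINT t:{0..1}|lborel. int_M deg x (kpot (U t))
          (\<lambda>y. deriv (\<lambda>\<tau>. kpot (U \<tau>) y) t *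
               scal_perp (base_curv gen deg) x (profile_of (U t)) (moment (U t) y)))"

definition J_along :: "nat \<Rightarrow> real \<Rightarrow> (real \<Rightarrow> real \<Rightarrow> real) \<Rightarrow> real" where
  "J_along deg x U =
     (LINT t:{0..1}|lborel.
        int_M deg x (\<lambda>_. 0) (\<lambda>y. deriv (\<lambda>\<tau>. kpot (U \<tau>) y) t)
        - int_M deg x (kpot (U t)) (\<lambda>y. deriv (\<lambda>\<tau>. kpot (U \<tau>) y) t))
     / int_M deg x (\<lambda>_. 0) (\<lambda>_. 1)"

(* Both functionals are independent of the path; C_1 is convex, so the segment is a path in C_1. *)
definition segment_path :: "(real \<Rightarrow> real) \<Rightarrow> real \<Rightarrow> real \<Rightarrow> real" where
  "segment_path u t z = (1 - t) * u_c z + t * u z"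

definition modified_K_energy :: "nat \<Rightarrow> nat \<Rightarrow> real \<Rightarrow> (real \<Rightarrow> real) \<Rightarrow> real" where
  "modified_K_energy gen deg x u = kenergy_along gen deg x (segment_path u)"

definition J_functional :: "nat \<Rightarrow> real \<Rightarrow> (real \<Rightarrow> real) \<Rightarrow> real" where
  "J_functional deg x u = J_along deg x (segment_path u)"

definition K_energy_bounded_below :: "nat \<Rightarrow> nat \<Rightarrow> real \<Rightarrow> bool" where
  "K_energy_bounded_below gen deg x \<longleftrightarrow>
     (\<exists>C. \<forall>u\<in>potentials. modified_K_energy gen deg x u \<ge> C)"

definition K_energy_proper :: "nat \<Rightarrow> nat \<Rightarrow> real \<Rightarrow> bool" where
  "K_energy_proper gen deg x \<longleftrightarrow>
     (\<exists>\<rho> :: real \<Rightarrow> real. mono \<rho> \<and> filterlim \<rho> at_top at_top \<and>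
        (\<forall>u\<in>potentials. modified_K_energy gen deg x u \<ge> \<rho> (J_functional deg x u)))"

section \<open>Singularities of the fibre metric\<close>

(* Here p is an endpoint of (a,b), and the fibre metric is pulled back along z = \<zeta>(\<sigma>), with
   \<sigma> the radial coordinate: it becomes \<zeta>'^2/\<Theta>(\<zeta>) d\<sigma>^2 + \<Theta>(\<zeta>) theta^2. *)

(* The point p is \<sigma> = \<infinity>, that is w = 0 for w = exp (-\<sigma>); the coefficients \<rho>_i(\<sigma>) = r_i(w) are
   required to be positive and smooth up to and including w = 0. *)
definition cusp_at :: "(real \<Rightarrow> real) \<Rightarrow> real \<Rightarrow> real \<Rightarrow> real \<Rightarrow> bool" where
  "cusp_at \<Theta> a b p \<longleftrightarrow>
     (\<exists>\<zeta> \<zeta>' r1 r2 :: real \<Rightarrow> real. \<exists>\<sigma>0 :: real.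
        smooth_on_set {\<sigma>0..} \<zeta> \<and> (\<forall>\<sigma>\<ge>\<sigma>0. \<zeta> \<sigma> \<in> {a<..<b}) \<and> (\<zeta> \<longlongrightarrow> p) at_top \<and>
        smooth_on_set {0..exp (- \<sigma>0)} r1 \<and> smooth_on_set {0..exp (- \<sigma>0)} r2 \<and>
        (\<forall>w\<in>{0..exp (- \<sigma>0)}. r1 w > 0 \<and> r2 w > 0) \<and>
        (\<forall>\<sigma>\<ge>\<sigma>0. (\<zeta> has_real_derivative \<zeta>' \<sigma>) (at \<sigma> within {\<sigma>0..}) \<and>
           (\<zeta>' \<sigma>)\<^sup>2 / \<Theta> (\<zeta> \<sigma>) = r1 (exp (- \<sigma>)) \<and>
           \<Theta> (\<zeta> \<sigma>) = r2 (exp (- \<sigma>)) * exp (- 2 * \<sigma>)))"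

(* Cone angle 2 pi \<kappa>, order \<gamma>. *)
definition conical_at :: "real \<Rightarrow> real \<Rightarrow> (real \<Rightarrow> real) \<Rightarrow> real \<Rightarrow> real \<Rightarrow> real \<Rightarrow> bool" where
  "conical_at \<kappa> \<gamma> \<Theta> a b p \<longleftrightarrow>
     (\<exists>\<zeta> \<zeta>' :: real \<Rightarrow> real. \<exists>\<epsilon>>0.
        smooth_on_set {0<..<\<epsilon>} \<zeta> \<and> (\<forall>\<sigma>\<in>{0<..<\<epsilon>}. \<zeta> \<sigma> \<in> {a<..<b}) \<and>
        (\<zeta> \<longlongrightarrow> p) (at_right 0) \<and>
        (\<forall>\<sigma>\<in>{0<..<\<epsilon>}. (\<zeta> has_real_derivative \<zeta>' \<sigma>) (at \<sigma>) \<and>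
           (\<zeta>' \<sigma>)\<^sup>2 / \<Theta> (\<zeta> \<sigma>) = 1) \<and>
        (\<lambda>\<sigma>. \<Theta> (\<zeta> \<sigma>) - \<kappa>\<^sup>2 * \<sigma>\<^sup>2) \<in> O[at_right 0](\<lambda>\<sigma>. \<sigma> powr (2 + \<gamma>)))"

definition has_conical_singularity :: "(real \<Rightarrow> real) \<Rightarrow> real \<Rightarrow> real \<Rightarrow> real \<Rightarrow> bool" where
  "has_conical_singularity \<Theta> a b p \<longleftrightarrow> (\<exists>\<kappa>>0. \<exists>\<gamma>>0. conical_at \<kappa> \<gamma> \<Theta> a b p)"

end

theory Submission
  imports Defs
begin

text \<open>
  Write \<open>c = x\<^sup>2 (2 - s x) / (2 (3 - x\<^sup>2))\<close>.  The four boundary conditions leave a quartic one free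
  coefficient, and divisibility of \<open>F'' - 2 s x\<close> by \<open>1 + x z\<close> fixes it, so the extremal polynomial is
  \<open>F(z) = (1 - z\<^sup>2) G(z)\<close> with \<open>G(z) = 1 + x z - c (1 - z\<^sup>2)\<close> (\<open>extremal_poly_eq\<close>).  With
  \<open>\<tau> = (1 + sqrt (1 - x\<^sup>2)) / 2\<close>, for which \<open>4 \<tau> (1 - \<tau>) = x\<^sup>2\<close>, completing the square gives
  \<open>G(z) = (\<tau> - c) (1 - z\<^sup>2) + \<tau> (z + x / (2 \<tau>))\<^sup>2\<close> (\<open>ext_factor_decomp\<close>).  For \<open>s < 0\<close> the coefficient \<open>c\<close>
  increases in \<open>x\<close> while \<open>\<tau>\<close> decreases, so the sign of \<open>\<tau> - c\<close> changes at exactly one point \<open>x\<^sub>s\<close>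
  (\<open>critical_point\<close>).  Below it \<open>F\<close> is positive on \<open>(-1,1)\<close>, at it \<open>F\<close> has one interior double zero,
  beyond it two simple ones.

  That a positive profile \<open>F / (1 + x z)\<close> is extremal follows from the coordinate computation of the scalar
  curvature, \<open>(2 s x - F'') / (1 + x z)\<close> (\<open>admissible_scal_quotient\<close>).  At a double zero \<open>p\<close> the substitution
  \<open>z = p \<plusminus> exp (-\<sigma>)\<close> exhibits the cusp; at a simple zero \<open>z = p \<plusminus> r\<^sup>2\<close> turns the arc-length equation into
  a regular autonomous equation for \<open>r\<close>, whose solution exhibits the cone.

  For the modified K-energy put \<open>v = u - u_c\<close> and \<open>q = (1 - z\<^sup>2) v''\<close>, so that \<open>1 + q\<close> is the quotient of
  \<open>u''\<close> by \<open>u_c''\<close>.  The variation of the potential along the segment from \<open>u_c\<close> to \<open>u\<close> is \<open>- v\<close> in the moment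
  coordinate \<open>z\<close> (envelope theorem), and two integrations by parts and the time integral give
  \<open>K(u) = C \<integral> (q G - (1 + x z) ln (1 + q)) dz\<close> with \<open>C > 0\<close> (\<open>modified_K_energy_eq\<close>).  In the critical class
  \<open>G = \<tau> (z - p)\<^sup>2\<close> with \<open>p = - x / (2 \<tau>)\<close> in \<open>(-1, 0)\<close>.  Minimising the integrand over \<open>q\<close> leaves only the integrable singularity \<open>ln \<bar>z - p\<bar>\<close>,
  whence the lower bound.  Potentials for which \<open>v'' \<ge> 0\<close> concentrates at \<open>p\<close>, but stays below
  \<open>1 / (z - p)\<^sup>2\<close>, keep the integrand bounded above, while \<open>u\<close> blows up on \<open>(-1, p)\<close>;
  the functional \<open>J\<close> then tends to infinity (\<open>J_functional_lower\<close>), so the K-energy is not proper.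
\<close>

section \<open>Functions that are smooth up to the boundary\<close>

text \<open>Smoothness is a coinductive notion: a family of functions that is closed under taking some derivative consists
of smooth functions, the derivative sequence arising by iterating the choice.  All closure properties below are
obtained by exhibiting such a family, which avoids any formula for higher derivatives.\<close>

lemma smooth_on_set_coinduct:
  assumes C: "\<And>g. g \<in> C \<Longrightarrow> \<exists>g'\<in>C. \<forall>x\<in>S. (g has_real_derivative g' x) (at x within S)"
    and f: "f \<in> C"
  shows "smooth_on_set S f"
proof -
  obtain d where d: "\<And>g. g \<in> C \<Longrightarrow> d g \<in> C \<and> (\<forall>x\<in>S. (g has_real_derivative d g x) (at x within S))"
    using C by metis
  have "(d ^^ n) f \<in> C" for n by (induction n) (use d f in auto)
  then show ?thesis
    unfolding smooth_on_set_def
    by (intro exI[of _ "\<lambda>n. (d ^^ n) f"]) (use d in auto)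
qed

lemma smooth_on_set_derivE:
  assumes "smooth_on_set S f"
  obtains f' where "smooth_on_set S f'" "\<And>x. x \<in> S \<Longrightarrow> (f has_real_derivative f' x) (at x within S)"
proof -
  from assms obtain D where D0: "\<And>x. x \<in> S \<Longrightarrow> D 0 x = f x"
    and D: "\<And>n x. x \<in> S \<Longrightarrow> (D n has_real_derivative D (Suc n) x) (at x within S)"
    unfolding smooth_on_set_def by blast
  have "smooth_on_set S (D 1)"
    unfolding smooth_on_set_def by (rule exI[of _ "\<lambda>n. D (Suc n)"]) (use D in auto)
  moreover have "(f has_real_derivative D 1 x) (at x within S)" if "x \<in> S" for x
    using has_field_derivative_transform_within[OF D[OF that, of 0] zero_less_one that, of f] D0
    by simp
  ultimately show thesis using that by blast
qed

lemma smooth_on_set_continuous: "smooth_on_set S f \<Longrightarrow> continuous_on S f"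
  by (meson DERIV_continuous_on smooth_on_set_derivE)

lemma smooth_on_set_subset:
  assumes "smooth_on_set S f" "T \<subseteq> S" shows "smooth_on_set T f"
proof -
  from assms(1) obtain D where "\<forall>x\<in>S. D 0 x = f x"
    "\<forall>n. \<forall>x\<in>S. (D n has_real_derivative D (Suc n) x) (at x within S)"
    unfolding smooth_on_set_def by blast
  then show ?thesis
    unfolding smooth_on_set_def using assms(2) by (intro exI[of _ D]) (blast intro: DERIV_subset)
qed

lemma smooth_on_set_cong:
  assumes "smooth_on_set S f" "\<And>x. x \<in> S \<Longrightarrow> g x = f x"
  shows "smooth_on_set S g"
proof -
  from assms(1) obtain D where "\<forall>x\<in>S. D 0 x = f x"
    "\<forall>n. \<forall>x\<in>S. (D n has_real_derivative D (Suc n) x) (at x within S)"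
    unfolding smooth_on_set_def by blast
  then show ?thesis
    unfolding smooth_on_set_def using assms(2) by (intro exI[of _ D]) auto
qed

text \<open>A family as demanded by the coinduction principle: closing the smooth functions under sums, products and outer
composition makes the product and chain rules available inside the family.\<close>

inductive_set smooth_closure :: "real set \<Rightarrow> (real \<Rightarrow> real) set" for S where
  base: "smooth_on_set S f \<Longrightarrow> f \<in> smooth_closure S"
| add: "f \<in> smooth_closure S \<Longrightarrow> g \<in> smooth_closure S \<Longrightarrow> (\<lambda>x. f x + g x) \<in> smooth_closure S"
| mult: "f \<in> smooth_closure S \<Longrightarrow> g \<in> smooth_closure S \<Longrightarrow> (\<lambda>x. f x * g x) \<in> smooth_closure S"
| compose: "smooth_on_set T g \<Longrightarrow> f ` S \<subseteq> T \<Longrightarrow> f \<in> smooth_closure S \<Longrightarrow> (\<lambda>x. g (f x)) \<in> smooth_closure S"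

text \<open>By induction on the generation of the function, its derivative is again generated, by the sum, product and
chain rules; only the factor \<open>g'\<close> in the chain rule is fresh, and it is smooth by itself.\<close>

lemma smooth_closure_smooth:
  assumes "f \<in> smooth_closure S" shows "smooth_on_set S f"
proof (rule smooth_on_set_coinduct[OF _ assms])
  fix g assume "g \<in> smooth_closure S"
  then show "\<exists>g'\<in>smooth_closure S. \<forall>x\<in>S. (g has_real_derivative g' x) (at x within S)"
  proof induction
    case (base f)
    then show ?case by (meson smooth_on_set_derivE smooth_closure.base)
  next
    case (add f g)
    then obtain f' g' where "f' \<in> smooth_closure S" "g' \<in> smooth_closure S"
      "\<forall>x\<in>S. (f has_real_derivative f' x) (at x within S)"
      "\<forall>x\<in>S. (g has_real_derivative g' x) (at x within S)" by blast
    then show ?case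
      by (intro bexI[of _ "\<lambda>x. f' x + g' x"]) (auto intro!: DERIV_add smooth_closure.add)
  next
    case (mult f g)
    then obtain f' g' where "f' \<in> smooth_closure S" "g' \<in> smooth_closure S"
      "\<forall>x\<in>S. (f has_real_derivative f' x) (at x within S)"
      "\<forall>x\<in>S. (g has_real_derivative g' x) (at x within S)" by blast
    then show ?case using mult.hyps
      by (intro bexI[of _ "\<lambda>x. f' x * g x + g' x * f x"])
        (auto intro!: DERIV_mult smooth_closure.add smooth_closure.mult)
  next
    case (compose T g f)
    then obtain f' where f': "f' \<in> smooth_closure S"
      "\<forall>x\<in>S. (f has_real_derivative f' x) (at x within S)" by blast
    obtain g' where g': "smooth_on_set T g'" "\<And>x. x \<in> T \<Longrightarrow> (g has_real_derivative g' x) (at x within T)"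
      using compose.hyps(1) by (rule smooth_on_set_derivE) blast
    have "((\<lambda>x. g (f x)) has_real_derivative g' (f x) * f' x) (at x within S)" if "x \<in> S" for x
    proof -
      have "(g has_real_derivative g' (f x)) (at (f x) within f ` S)"
        using g'(2)[of "f x"] compose.hyps(2) that DERIV_subset by blast
      from DERIV_image_chain[OF this f'(2)[rule_format, OF that]] show ?thesis by (simp add: o_def)
    qed
    moreover have "(\<lambda>x. g' (f x) * f' x) \<in> smooth_closure S"
      by (rule smooth_closure.mult[OF smooth_closure.compose[OF g'(1) compose.hyps(2,3)] f'(1)])
    ultimately show ?case by (intro bexI[of _ "\<lambda>x. g' (f x) * f' x"] ballI)
  qed
qed

lemma smooth_on_set_add:
  assumes "smooth_on_set S f" "smooth_on_set S g" shows "smooth_on_set S (\<lambda>x. f x + g x)"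
  by (rule smooth_closure_smooth[OF smooth_closure.add[OF assms[THEN smooth_closure.base]]])

lemma smooth_on_set_mult:
  assumes "smooth_on_set S f" "smooth_on_set S g" shows "smooth_on_set S (\<lambda>x. f x * g x)"
  by (rule smooth_closure_smooth[OF smooth_closure.mult[OF assms[THEN smooth_closure.base]]])

lemma smooth_on_set_compose:
  assumes "smooth_on_set T g" "smooth_on_set S f" "f ` S \<subseteq> T"
  shows "smooth_on_set S (\<lambda>x. g (f x))"
  by (rule smooth_closure_smooth[OF smooth_closure.compose[OF assms(1,3) smooth_closure.base[OF assms(2)]]])

lemma smooth_on_set_poly: "smooth_on_set S (poly p)"
  by (rule smooth_on_set_coinduct[where C = "range poly"]) (auto intro!: bexI[OF _ rangeI] DERIV_subset[OF poly_DERIV])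

lemma smooth_on_set_const: "smooth_on_set S (\<lambda>_. c)"
  by (rule smooth_on_set_cong[OF smooth_on_set_poly[of S "[:c:]"]]) simp

lemma smooth_on_set_id: "smooth_on_set S (\<lambda>x. x)"
  by (rule smooth_on_set_cong[OF smooth_on_set_poly[of S "[:0, 1:]"]]) simp

lemma smooth_on_set_powr: "smooth_on_set {0<..} (\<lambda>x. x powr a)"
proof (rule smooth_on_set_coinduct[where C = "range (\<lambda>(c, e) x. c * x powr e)"])
  fix g :: "real \<Rightarrow> real" assume "g \<in> range (\<lambda>(c, e) x. c * x powr e)"
  then obtain c e where g: "g = (\<lambda>x. c * x powr e)" by auto
  have "(g has_real_derivative (c * e) * x powr (e - 1)) (at x within {0<..})" if "x > 0" for x
    using DERIV_subset[OF DERIV_cmult[OF has_real_derivative_powr[OF that, of e]]]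
    by (simp add: g mult.assoc)
  moreover have "(\<lambda>x. (c * e) * x powr (e - 1)) \<in> range (\<lambda>(c, e) x. c * x powr e)"
    by (rule range_eqI[of _ _ "(c * e, e - 1)"]) simp
  ultimately show "\<exists>g'\<in>range (\<lambda>(c, e) x. c * x powr e). \<forall>x\<in>{0<..}. (g has_real_derivative g' x) (at x within {0<..})"
    by auto
qed (rule range_eqI[of _ _ "(1, a)"], simp)

lemma smooth_on_set_exp: "smooth_on_set S (\<lambda>x. exp (c * x))"
proof (rule smooth_on_set_coinduct[where C = "range (\<lambda>e x. e * exp (c * x))"])
  fix g :: "real \<Rightarrow> real" assume "g \<in> range (\<lambda>e x. e * exp (c * x))"
  then obtain e where g: "g = (\<lambda>x. e * exp (c * x))" by auto
  have "(g has_real_derivative (e * c) * exp (c * x)) (at x within S)" for x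
    unfolding g by (rule derivative_eq_intros refl | simp)+
  then show "\<exists>g'\<in>range (\<lambda>e x. e * exp (c * x)). \<forall>x\<in>S. (g has_real_derivative g' x) (at x within S)"
    by (intro bexI[OF _ rangeI[of _ "e * c"]] ballI)
qed (rule range_eqI[of _ _ 1], simp)

lemma smooth_on_set_inverse:
  assumes "smooth_on_set S f" "\<And>x. x \<in> S \<Longrightarrow> f x > 0"
  shows "smooth_on_set S (\<lambda>x. 1 / f x)"
proof -
  have "smooth_on_set S (\<lambda>x. f x powr - 1)"
    by (rule smooth_on_set_compose[OF smooth_on_set_powr assms(1)]) (use assms(2) in auto)
  then show ?thesis
    by (rule smooth_on_set_cong) (simp add: powr_minus_divide abs_of_pos[OF assms(2)])
qed

lemma smooth_on_set_diff:
  assumes "smooth_on_set S f" "smooth_on_set S g" shows "smooth_on_set S (\<lambda>x. f x - g x)"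
  using smooth_on_set_add[OF assms(1) smooth_on_set_mult[OF smooth_on_set_const[of S "-1"] assms(2)]] by simp

lemma smooth_on_set_divide:
  assumes "smooth_on_set S f" "smooth_on_set S g" "\<And>x. x \<in> S \<Longrightarrow> g x > 0"
  shows "smooth_on_set S (\<lambda>x. f x / g x)"
  using smooth_on_set_mult[OF assms(1) smooth_on_set_inverse[OF assms(2,3)]] by simp

text \<open>Bootstrapping: the compositions of \<open>\<zeta>\<close> with smooth functions form a family closed under differentiation,
because the derivative of \<open>h \<circ> \<zeta>\<close> is \<open>(h' * g) \<circ> \<zeta>\<close>.\<close>

lemma smooth_on_set_ode:
  assumes g: "smooth_on_set T g" and T: "\<zeta> ` S \<subseteq> T"
    and ode: "\<And>x. x \<in> S \<Longrightarrow> (\<zeta> has_real_derivative g (\<zeta> x)) (at x within S)"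
  shows "smooth_on_set S \<zeta>"
proof (rule smooth_on_set_coinduct[where C = "{(\<lambda>x. h (\<zeta> x)) | h. smooth_on_set T h}"])
  show "\<zeta> \<in> {(\<lambda>x. h (\<zeta> x)) | h. smooth_on_set T h}"
    using smooth_on_set_id[of T] by (intro CollectI exI[of _ "\<lambda>x. x"]) simp
  fix f assume "f \<in> {(\<lambda>x. h (\<zeta> x)) | h. smooth_on_set T h}"
  then obtain h where f: "f = (\<lambda>x. h (\<zeta> x))" and h: "smooth_on_set T h" by blast
  obtain h' where h': "smooth_on_set T h'" "\<And>y. y \<in> T \<Longrightarrow> (h has_real_derivative h' y) (at y within T)"
    using smooth_on_set_derivE[OF h] by blast
  have "(f has_real_derivative h' (\<zeta> x) * g (\<zeta> x)) (at x within S)" if "x \<in> S" for x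
  proof -
    have "(h has_real_derivative h' (\<zeta> x)) (at (\<zeta> x) within \<zeta> ` S)"
      using h'(2)[of "\<zeta> x"] T that DERIV_subset by blast
    from DERIV_image_chain[OF this ode[OF that]] show ?thesis by (simp add: f o_def)
  qed
  moreover have "(\<lambda>x. h' (\<zeta> x) * g (\<zeta> x)) \<in> {(\<lambda>x. h (\<zeta> x)) | h. smooth_on_set T h}"
    using smooth_on_set_mult[OF h'(1) g] by (intro CollectI exI[of _ "\<lambda>y. h' y * g y"]) simp
  ultimately show "\<exists>g'\<in>{(\<lambda>x. h (\<zeta> x)) | h. smooth_on_set T h}. \<forall>x\<in>S. (f has_real_derivative g' x) (at x within S)"
    by (intro bexI[of _ "\<lambda>x. h' (\<zeta> x) * g (\<zeta> x)"] ballI)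
qed

section \<open>Scalar curvature of the admissible metrics\<close>

definition pair_of :: "'a \<Rightarrow> 'a \<Rightarrow> 'a \<Rightarrow> 'a \<Rightarrow> bool" where
  "pair_of a b i j \<longleftrightarrow> i = a \<and> j = b \<or> i = b \<and> j = a"

text \<open>The model metric in the coordinates \<open>(p, q, z, t)\<close>, as a function of \<open>(q, z)\<close>, with \<open>l = - s\<close>,
\<open>P z = (1 + x z) / x\<close> and the profile \<open>T\<close>.  Keeping \<open>P\<close> opaque, with derivative 1, keeps the rational
expressions below small.\<close>

definition metric_coeff :: "real \<Rightarrow> (real \<Rightarrow> real) \<Rightarrow> (real \<Rightarrow> real) \<Rightarrow> 4 \<Rightarrow> 4 \<Rightarrow> real \<Rightarrow> real \<Rightarrow> real" where
  "metric_coeff l P T i j q z =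
     (if i = 1 \<and> j = 1 then P z / (l * q\<^sup>2) + T z / (l\<^sup>2 * q\<^sup>2)
      else if pair_of 1 4 i j then T z / (l * q)
      else if i = 2 \<and> j = 2 then P z / (l * q\<^sup>2)
      else if i = 3 \<and> j = 3 then 1 / T z
      else if i = 4 \<and> j = 4 then T z else 0)"

definition metric_coeff_dq :: "real \<Rightarrow> (real \<Rightarrow> real) \<Rightarrow> (real \<Rightarrow> real) \<Rightarrow> 4 \<Rightarrow> 4 \<Rightarrow> real \<Rightarrow> real \<Rightarrow> real" where
  "metric_coeff_dq l P T i j q z =
     (if i = 1 \<and> j = 1 then - 2 * P z / (l * q^3) - 2 * T z / (l\<^sup>2 * q^3)
      else if pair_of 1 4 i j then - T z / (l * q\<^sup>2)
      else if i = 2 \<and> j = 2 then - 2 * P z / (l * q^3)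
      else if i = 3 \<and> j = 3 then 0
      else if i = 4 \<and> j = 4 then 0 else 0)"

definition metric_coeff_dz :: "real \<Rightarrow> (real \<Rightarrow> real) \<Rightarrow> (real \<Rightarrow> real) \<Rightarrow> (real \<Rightarrow> real) \<Rightarrow> 4 \<Rightarrow> 4 \<Rightarrow> real \<Rightarrow> real \<Rightarrow> real" where
  "metric_coeff_dz l P T T' i j q z =
     (if i = 1 \<and> j = 1 then 1 / (l * q\<^sup>2) + T' z / (l\<^sup>2 * q\<^sup>2)
      else if pair_of 1 4 i j then T' z / (l * q)
      else if i = 2 \<and> j = 2 then 1 / (l * q\<^sup>2)
      else if i = 3 \<and> j = 3 then - T' z / (T z)\<^sup>2
      else if i = 4 \<and> j = 4 then T' z else 0)"

definition inverse_metric_coeff :: "real \<Rightarrow> (real \<Rightarrow> real) \<Rightarrow> (real \<Rightarrow> real) \<Rightarrow> 4 \<Rightarrow> 4 \<Rightarrow> real \<Rightarrow> real \<Rightarrow> real" where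
  "inverse_metric_coeff l P T i j q z =
     (if i = 1 \<and> j = 1 then l * q\<^sup>2 / P z
      else if pair_of 1 4 i j then - q / P z
      else if i = 2 \<and> j = 2 then l * q\<^sup>2 / P z
      else if i = 3 \<and> j = 3 then T z
      else if i = 4 \<and> j = 4 then 1 / T z + 1 / (l * P z) else 0)"

text \<open>The Christoffel symbols of the model, with upper index \<open>k\<close>.  With \<open>a = 1 / (l q)\<close> the metric is
\<open>P l a\<^sup>2 (dp\<^sup>2 + dq\<^sup>2) + dz\<^sup>2 / T + T (dt + a dp)\<^sup>2\<close>; the terms with a factor
\<open>T / P\<close> are due to the curvature \<open>d\<theta> = \<omega>\<close> of the connection.\<close>

definition christoffel_coeff :: "real \<Rightarrow> (real \<Rightarrow> real) \<Rightarrow> (real \<Rightarrow> real) \<Rightarrow> (real \<Rightarrow> real) \<Rightarrow> 4 \<Rightarrow> 4 \<Rightarrow> 4 \<Rightarrow> real \<Rightarrow> real \<Rightarrow> real" where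
  "christoffel_coeff l P T T' k i j q z =
     (if k = 1 then
        (if pair_of 1 2 i j then - 1 / q - T z / (2 * l * P z * q)
         else if pair_of 2 4 i j then - T z / (2 * P z)
         else if pair_of 1 3 i j then 1 / (2 * P z) else 0)
      else if k = 2 then
        (if i = 1 \<and> j = 1 then 1 / q + T z / (l * P z * q)
         else if pair_of 1 4 i j then T z / (2 * P z)
         else if i = 2 \<and> j = 2 then - 1 / q
         else if pair_of 2 3 i j then 1 / (2 * P z) else 0)
      else if k = 3 then
        (if i = 1 \<and> j = 1 then - T z / (2 * l * q\<^sup>2) - T z * T' z / (2 * l\<^sup>2 * q\<^sup>2)
         else if pair_of 1 4 i j then - T z * T' z / (2 * l * q)
         else if i = 4 \<and> j = 4 then - T z * T' z / 2
         else if i = 2 \<and> j = 2 then - T z / (2 * l * q\<^sup>2)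
         else if i = 3 \<and> j = 3 then - T' z / (2 * T z) else 0)
      else
        (if pair_of 1 2 i j then 1 / (2 * l * q\<^sup>2) + T z / (2 * l\<^sup>2 * P z * q\<^sup>2)
         else if pair_of 2 4 i j then T z / (2 * l * P z * q)
         else if pair_of 1 3 i j then T' z / (2 * l * q * T z) - 1 / (2 * l * P z * q)
         else if pair_of 3 4 i j then T' z / (2 * T z) else 0))"

definition christoffel_coeff_dq :: "real \<Rightarrow> (real \<Rightarrow> real) \<Rightarrow> (real \<Rightarrow> real) \<Rightarrow> (real \<Rightarrow> real) \<Rightarrow> 4 \<Rightarrow> 4 \<Rightarrow> 4 \<Rightarrow> real \<Rightarrow> real \<Rightarrow> real" where
  "christoffel_coeff_dq l P T T' k i j q z =
     (if k = 1 then
        (if pair_of 1 2 i j then 1 / q\<^sup>2 + T z / (2 * l * P z * q\<^sup>2)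
         else if pair_of 2 4 i j then 0
         else if pair_of 1 3 i j then 0 else 0)
      else if k = 2 then
        (if i = 1 \<and> j = 1 then - 1 / q\<^sup>2 - T z / (l * P z * q\<^sup>2)
         else if pair_of 1 4 i j then 0
         else if i = 2 \<and> j = 2 then 1 / q\<^sup>2
         else if pair_of 2 3 i j then 0 else 0)
      else if k = 3 then
        (if i = 1 \<and> j = 1 then T z / (l * q^3) + T z * T' z / (l\<^sup>2 * q^3)
         else if pair_of 1 4 i j then T z * T' z / (2 * l * q\<^sup>2)
         else if i = 4 \<and> j = 4 then 0
         else if i = 2 \<and> j = 2 then T z / (l * q^3)
         else if i = 3 \<and> j = 3 then 0 else 0)
      else
        (if pair_of 1 2 i j then - 1 / (l * q^3) - T z / (l\<^sup>2 * P z * q^3)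
         else if pair_of 2 4 i j then - T z / (2 * l * P z * q\<^sup>2)
         else if pair_of 1 3 i j then - T' z / (2 * l * q\<^sup>2 * T z) + 1 / (2 * l * P z * q\<^sup>2)
         else if pair_of 3 4 i j then 0 else 0))"

definition christoffel_coeff_dz :: "real \<Rightarrow> (real \<Rightarrow> real) \<Rightarrow> (real \<Rightarrow> real) \<Rightarrow> (real \<Rightarrow> real) \<Rightarrow> (real \<Rightarrow> real) \<Rightarrow> 4 \<Rightarrow> 4 \<Rightarrow> 4 \<Rightarrow> real \<Rightarrow> real \<Rightarrow> real" where
  "christoffel_coeff_dz l P T T' T'' k i j q z =
     (let d = (T' z * P z - T z) / (P z)\<^sup>2; e = (T'' z * T z - (T' z)\<^sup>2) / (T z)\<^sup>2;
          f = (T' z)\<^sup>2 + T z * T'' z in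
     if k = 1 then
        (if pair_of 1 2 i j then - d / (2 * l * q)
         else if pair_of 2 4 i j then - d / 2
         else if pair_of 1 3 i j then - 1 / (2 * (P z)\<^sup>2) else 0)
      else if k = 2 then
        (if i = 1 \<and> j = 1 then d / (l * q)
         else if pair_of 1 4 i j then d / 2
         else if i = 2 \<and> j = 2 then 0
         else if pair_of 2 3 i j then - 1 / (2 * (P z)\<^sup>2) else 0)
      else if k = 3 then
        (if i = 1 \<and> j = 1 then - T' z / (2 * l * q\<^sup>2) - f / (2 * l\<^sup>2 * q\<^sup>2)
         else if pair_of 1 4 i j then - f / (2 * l * q)
         else if i = 4 \<and> j = 4 then - f / 2
         else if i = 2 \<and> j = 2 then - T' z / (2 * l * q\<^sup>2)
         else if i = 3 \<and> j = 3 then - e / 2 else 0)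
      else
        (if pair_of 1 2 i j then d / (2 * l\<^sup>2 * q\<^sup>2)
         else if pair_of 2 4 i j then d / (2 * l * q)
         else if pair_of 1 3 i j then e / (2 * l * q) + 1 / (2 * l * (P z)\<^sup>2 * q)
         else if pair_of 3 4 i j then e / 2 else 0))"

text \<open>The tables above branch on indices, never on the point of differentiation, and the tables of derivatives
repeat the branches of the original even where they vanish; so the derivatives can be verified leaf by leaf.\<close>

lemma DERIV_if_cases:
  assumes "(f has_real_derivative f') (at x)" "(g has_real_derivative g') (at x)"
  shows "((\<lambda>x. if c then f x else g x) has_real_derivative (if c then f' else g')) (at x)"
  using assms by simp

lemma metric_coeff_deriv_q:
  assumes "l > 0" "q > 0"
  shows "((\<lambda>q. metric_coeff l P T i j q z) has_real_derivative metric_coeff_dq l P T i j q z) (at q)"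
  unfolding metric_coeff_def metric_coeff_dq_def using assms
  by (intro DERIV_if_cases; (auto intro!: derivative_eq_intros simp: field_simps power2_eq_square power3_eq_cube))

lemma metric_coeff_deriv_z:
  assumes "l > 0" "q > 0" "T z > 0" "(P has_real_derivative 1) (at z)" "(T has_real_derivative T' z) (at z)"
  shows "((\<lambda>z. metric_coeff l P T i j q z) has_real_derivative metric_coeff_dz l P T T' i j q z) (at z)"
  unfolding metric_coeff_def metric_coeff_dz_def using assms(1-3)
  by (intro DERIV_if_cases; (auto intro!: derivative_eq_intros assms simp: field_simps power2_eq_square power3_eq_cube))

lemma christoffel_coeff_deriv_q:
  assumes "l > 0" "q > 0" "P z > 0" "T z > 0" 
  shows "((\<lambda>q. christoffel_coeff l P T T' k i j q z) has_real_derivative christoffel_coeff_dq l P T T' k i j q z) (at q)"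
  unfolding christoffel_coeff_def christoffel_coeff_dq_def using assms
  by (intro DERIV_if_cases; (auto intro!: derivative_eq_intros simp: field_simps power2_eq_square power3_eq_cube))

lemma christoffel_coeff_deriv_z:
  assumes "l > 0" "q > 0" "P z > 0" "T z > 0" "(P has_real_derivative 1) (at z)" "(T has_real_derivative T' z) (at z)"
   "(T' has_real_derivative T'' z) (at z)"
  shows "((\<lambda>z. christoffel_coeff l P T T' k i j q z) has_real_derivative christoffel_coeff_dz l P T T' T'' k i j q z) (at z)"
  unfolding christoffel_coeff_def christoffel_coeff_dz_def Let_def using assms(1-4)
  by (intro DERIV_if_cases; (auto intro!: derivative_eq_intros assms simp: field_simps power2_eq_square power3_eq_cube))

text \<open>The chart domain over a part \<open>a < z < b\<close> of the fibre: being open, it makes partial derivatives depend only on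
values within it.\<close>

definition region :: "real \<Rightarrow> real \<Rightarrow> pt set" where
  "region a b = {r. r $ 2 > 0 \<and> r $ 3 \<in> {a<..<b}}"

lemma eventually_region:
  assumes "p \<in> region a b"
  shows "\<forall>\<^sub>F h in nhds 0. p + h *\<^sub>R axis i 1 \<in> region a b"
proof -
  have lim: "((\<lambda>h. (p + h *\<^sub>R axis i 1) $ m) \<longlongrightarrow> p $ m) (nhds 0)" for m
    by (auto intro!: tendsto_eq_intros filterlim_ident)
  have "\<forall>\<^sub>F h in nhds 0. (p + h *\<^sub>R axis i 1) $ 2 > 0"
    by (rule order_tendstoD(1)[OF lim]) (use assms in \<open>simp add: region_def\<close>)
  moreover have "\<forall>\<^sub>F h in nhds 0. (p + h *\<^sub>R axis i 1) $ 3 > a"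
    by (rule order_tendstoD(1)[OF lim]) (use assms in \<open>simp add: region_def\<close>)
  moreover have "\<forall>\<^sub>F h in nhds 0. (p + h *\<^sub>R axis i 1) $ 3 < b"
    by (rule order_tendstoD(2)[OF lim]) (use assms in \<open>simp add: region_def\<close>)
  ultimately show ?thesis
    by eventually_elim (simp add: region_def)
qed

text \<open>The model is invariant under translations of \<open>p\<close> and \<open>t\<close>, so every tensor component is a function of
\<open>(q, z)\<close> and its partial derivatives reduce to ordinary ones.\<close>

lemma partial_qz:
  assumes p: "p \<in> region a b"
    and f: "\<And>r. r \<in> region a b \<Longrightarrow> f r = \<phi> (r $ 2) (r $ 3)"
    and dq: "((\<lambda>q. \<phi> q (p $ 3)) has_real_derivative Dq) (at (p $ 2))"
    and dz: "((\<lambda>z. \<phi> (p $ 2) z) has_real_derivative Dz) (at (p $ 3))"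
  shows "partial i f p = (if i = 2 then Dq else if i = 3 then Dz else 0)"
proof -
  have eq: "partial i f p = deriv (\<lambda>h. \<phi> ((p + h *\<^sub>R axis i 1) $ 2) ((p + h *\<^sub>R axis i 1) $ 3)) 0"
    unfolding partial_def
    by (intro deriv_cong_ev eventually_mono[OF eventually_region[OF p]] f) auto
  consider "i = 2" | "i = 3" | "i \<noteq> 2" "i \<noteq> 3" by blast
  then show ?thesis
  proof cases
    case 1
    have "((\<lambda>h. \<phi> (p $ 2 + h) (p $ 3)) has_real_derivative Dq) (at 0)"
      using dq DERIV_at_within_shift[of "\<lambda>q. \<phi> q (p $ 3)" Dq "p $ 2" 0 UNIV] by simp
    then show ?thesis using 1 unfolding eq by (simp add: axis_def DERIV_imp_deriv)
  next
    case 2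
    have "((\<lambda>h. \<phi> (p $ 2) (p $ 3 + h)) has_real_derivative Dz) (at 0)"
      using dz DERIV_at_within_shift[of "\<lambda>q. \<phi> (p $ 2) q" Dz "p $ 3" 0 UNIV] by simp
    then show ?thesis using 2 unfolding eq by (simp add: axis_def DERIV_imp_deriv)
  next
    case 3
    then have "(axis i (1::real) :: pt) $ 2 = 0" "(axis i (1::real) :: pt) $ 3 = 0" by (simp_all add: axis_def)
    then show ?thesis using 3 unfolding eq by simp
  qed
qed

text \<open>A one-sided inverse of a square matrix is two-sided, hence unique.\<close>

lemma matrix_inv_eqI:
  fixes A B :: "real ^ 'n ^ 'n"
  assumes "A ** B = mat 1"
  shows "matrix_inv A = B"
proof -
  have BA: "B ** A = mat 1" using assms matrix_left_right_inverse by blast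
  have "A ** matrix_inv A = mat 1 \<and> matrix_inv A ** A = mat 1"
    unfolding matrix_inv_def by (rule someI[where x = B]) (use assms BA in simp)
  then have "matrix_inv A = (matrix_inv A ** A) ** B"
    by (metis assms matrix_mul_assoc matrix_mul_rid)
  then show ?thesis
    using \<open>A ** matrix_inv A = mat 1 \<and> matrix_inv A ** A = mat 1\<close> by (simp add: matrix_mul_lid)
qed

text \<open>A profile \<open>T\<close> with two derivatives and positive on \<open>(a, b)\<close>: exactly the regularity that the scalar curvature
on that part involves.\<close>

locale admissible_data =
  fixes s x a b :: real and T T' T'' :: "real \<Rightarrow> real"
  assumes s_neg: "s < 0" and x_pos: "0 < x"
    and base_pos: "\<And>z. z \<in> {a<..<b} \<Longrightarrow> 1 + x * z > 0"
    and T_pos: "\<And>z. z \<in> {a<..<b} \<Longrightarrow> T z > 0"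
    and DT: "\<And>z. z \<in> {a<..<b} \<Longrightarrow> (T has_real_derivative T' z) (at z)"
    and DT': "\<And>z. z \<in> {a<..<b} \<Longrightarrow> (T' has_real_derivative T'' z) (at z)"
begin

abbreviation "l \<equiv> - s"
abbreviation "P z \<equiv> (1 + x * z) / x"

lemma l_pos: "l > 0" using s_neg by simp
lemma P_pos: "z \<in> {a<..<b} \<Longrightarrow> P z > 0" using base_pos x_pos by simp
lemma DP: "(P has_real_derivative 1) (at z)"
  using x_pos by (auto intro!: derivative_eq_intros)

abbreviation G :: "pt \<Rightarrow> real ^ 4 ^ 4" where
  "G \<equiv> \<lambda>p. \<chi> i j. admissible_metric s x T p (axis i 1) (axis j 1)"

lemma G_component:
  assumes "p \<in> region a b"
  shows "G p $ i $ j = metric_coeff l P T i j (p $ 2) (p $ 3)"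
proof -
  define q z where "q = p $ 2" and "z = p $ 3"
  have q: "q > 0" using assms by (simp add: region_def q_def)
  have "\<forall>i j. G p $ i $ j = metric_coeff l P T i j q z"
    using q s_neg
    unfolding forall_4
    apply (simp add: admissible_metric_def base_metric_def connection_form_def metric_coeff_def pair_of_def axis_def flip: q_def z_def)
    apply (simp add: power2_eq_square)
    done
  then show ?thesis by (simp add: q_def z_def)
qed

lemma G_inverse:
  assumes p: "p \<in> region a b"
  shows "matrix_inv (G p) $ i $ j = inverse_metric_coeff l P T i j (p $ 2) (p $ 3)"
proof -
  define q z where "q = p $ 2" and "z = p $ 3"
  have q: "q > 0" and z: "z \<in> {a<..<b}" using p by (auto simp: region_def q_def z_def)
  define c where "c = P z"
  have c: "c > 0" using P_pos[OF z] c_def by simp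
  have entry: "\<forall>i j. (\<Sum>k\<in>UNIV. metric_coeff l P T i k q z * inverse_metric_coeff l P T k j q z) = (if i = j then 1 else 0)"
    using q c s_neg T_pos[OF z] unfolding forall_4 sum_4
    apply (simp add: metric_coeff_def inverse_metric_coeff_def pair_of_def flip: c_def)
    apply (simp add: field_simps power2_eq_square)
    done
  have "G p ** (\<chi> i j. inverse_metric_coeff l P T i j q z) = mat 1"
    using entry G_component[OF p]
    by (simp add: vec_eq_iff matrix_matrix_mult_def mat_def q_def z_def)
  then show ?thesis by (simp add: matrix_inv_eqI q_def z_def)
qed

lemma christoffel_G:
  assumes p: "p \<in> region a b"
  shows "christoffel G k i j p = christoffel_coeff l P T T' k i j (p $ 2) (p $ 3)"
proof -
  define q z where "q = p $ 2" and "z = p $ 3"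
  have q: "q > 0" and z: "z \<in> {a<..<b}" using p by (auto simp: region_def q_def z_def)
  define c where "c = P z"
  have c: "c > 0" using P_pos[OF z] c_def by simp
  have part: "partial m (\<lambda>r. G r $ i $ j) p =
      (if m = 2 then metric_coeff_dq l P T i j q z else if m = 3 then metric_coeff_dz l P T T' i j q z else 0)" for m i j
    unfolding q_def z_def
    apply (rule partial_qz[where \<phi> = "metric_coeff l P T i j", OF p G_component])
    subgoal by assumption
    subgoal by (rule metric_coeff_deriv_q[OF l_pos]) (use q in \<open>simp add: q_def\<close>)
    subgoal by (rule metric_coeff_deriv_z[OF l_pos _ _ DP DT]) (use q z T_pos[OF z] in \<open>simp_all add: q_def z_def\<close>)
    done
  have "\<forall>k i j. christoffel G k i j p = christoffel_coeff l P T T' k i j q z"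
    using q c l_pos T_pos[OF z]
    unfolding forall_4 christoffel_def
    apply (simp only: part G_inverse[OF p, folded q_def z_def] sum_4)
    apply (simp add: metric_coeff_dq_def metric_coeff_dz_def inverse_metric_coeff_def christoffel_coeff_def pair_of_def flip: c_def)
    apply (simp add: field_simps power2_eq_square power3_eq_cube)
    done
  then show ?thesis by (simp add: q_def z_def)
qed

text \<open>The expected value: \<open>2 s / P\<close> is the base curvature divided by the conformal factor, \<open>- T''\<close> is the curvature
of the fibre metric, and \<open>- 2 T' / P\<close> comes from the variation of the base metric along the fibre together with
the curvature of \<open>\<theta>\<close>.\<close>

lemma scalar_curvature_G:
  assumes p: "p \<in> region a b"
  shows "admissible_scal s x T p = (2 * s - 2 * T' (p $ 3)) / P (p $ 3) - T'' (p $ 3)"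
proof -
  define q z where "q = p $ 2" and "z = p $ 3"
  have q: "q > 0" and z: "z \<in> {a<..<b}" using p by (auto simp: region_def q_def z_def)
  define c where "c = P z"
  have c: "c > 0" using P_pos[OF z] c_def by simp
  have part: "partial m (christoffel G k i j) p =
      (if m = 2 then christoffel_coeff_dq l P T T' k i j q z else if m = 3 then christoffel_coeff_dz l P T T' T'' k i j q z else 0)" for m k i j
    unfolding q_def z_def
    apply (rule partial_qz[where \<phi> = "christoffel_coeff l P T T' k i j", OF p christoffel_G])
    subgoal by assumption
    subgoal by (rule christoffel_coeff_deriv_q[OF l_pos]) (use q z T_pos[OF z] P_pos[OF z] in \<open>simp_all add: q_def z_def\<close>)
    subgoal by (rule christoffel_coeff_deriv_z[OF l_pos _ _ _ DP DT DT']) (use q z T_pos[OF z] P_pos[OF z] in \<open>simp_all add: q_def z_def\<close>)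
    done
  have "scalar_curvature G p = (2 * s - 2 * T' z) / c - T'' z"
    using q c s_neg T_pos[OF z]
    unfolding scalar_curvature_def ricci_def
    apply (simp only: part christoffel_G[OF p, folded q_def z_def] G_inverse[OF p, folded q_def z_def] sum_4)
    apply (simp add: inverse_metric_coeff_def christoffel_coeff_def christoffel_coeff_dq_def christoffel_coeff_dz_def pair_of_def Let_def flip: c_def)
    apply (simp add: field_simps power2_eq_square power3_eq_cube)
    done
  then show ?thesis by (simp add: admissible_scal_def c_def z_def)
qed

end

section \<open>The extremal polynomial\<close>

lemma one_plus_pos:
  fixes x z :: real
  assumes "0 < x" "x < 1" "z \<in> {-1..1}"
  shows "1 + x * z > 0"
proof -
  have "x * z \<ge> x * (-1)" using assms by (intro mult_left_mono) auto
  then show ?thesis using assms by simp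
qed

text \<open>In terms of \<open>F = (1 + x z) \<Theta>\<close> the terms with \<open>\<Theta>'\<close> and \<open>\<Theta>''\<close> combine to \<open>F''\<close>, since
\<open>F'' = (1 + x z) \<Theta>'' + 2 x \<Theta>'\<close>.  This is what makes extremality a linear condition on \<open>F\<close>.\<close>

lemma admissible_scal_quotient:
  fixes F F' F'' :: "real \<Rightarrow> real"
  assumes "s < 0" "0 < x" and w: "\<And>z. z \<in> {a<..<b} \<Longrightarrow> 1 + x * z > 0"
    and F: "\<And>z. z \<in> {a<..<b} \<Longrightarrow> F z > 0"
    and D: "\<And>z. z \<in> {a<..<b} \<Longrightarrow> (F has_real_derivative F' z) (at z)"
      "\<And>z. z \<in> {a<..<b} \<Longrightarrow> (F' has_real_derivative F'' z) (at z)"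
    and \<Theta>: "\<And>z. z \<in> {a<..<b} \<Longrightarrow> \<Theta> z = F z / (1 + x * z)"
    and p: "p $ 2 > 0" "p $ 3 \<in> {a<..<b}"
  shows "admissible_scal s x \<Theta> p = (2 * s * x - F'' (p $ 3)) / (1 + x * (p $ 3))"
proof -
  define T' where "T' z = (F' z - x * \<Theta> z) / (1 + x * z)" for z
  define T'' where "T'' z = (F'' z - 2 * x * T' z) / (1 + x * z)" for z
  have D\<Theta>: "(\<Theta> has_real_derivative T' z) (at z)" if z: "z \<in> {a<..<b}" for z
  proof -
    have "((\<lambda>z. F z / (1 + x * z)) has_real_derivative T' z) (at z)"
      using w[OF z] by (auto intro!: derivative_eq_intros D(1)[OF z] simp: T'_def \<Theta>[OF z] divide_simps)
    moreover have "\<forall>\<^sub>F y in nhds z. \<Theta> y = F y / (1 + x * y)"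
      by (rule eventually_mono[OF eventually_nhds_in_open[OF open_greaterThanLessThan z]]) (rule \<Theta>)
    ultimately show ?thesis by (simp add: DERIV_cong_ev[OF refl _ refl])
  qed
  interpret admissible_data s x a b \<Theta> T' T''
  proof
    fix z assume z: "z \<in> {a<..<b}"
    show "\<Theta> z > 0" using \<Theta>[OF z] F[OF z] w[OF z] by simp
    show "(\<Theta> has_real_derivative T' z) (at z)" by (rule D\<Theta>[OF z])
    show "(T' has_real_derivative T'' z) (at z)"
      unfolding T'_def[abs_def] using w[OF z]
      by (auto intro!: derivative_eq_intros D(2)[OF z] D\<Theta>[OF z] simp: T''_def T'_def divide_simps)
  qed (use assms w in auto)
  have "p \<in> region a b" using p by (simp add: region_def)
  from scalar_curvature_G[OF this] show ?thesis
    using w[OF p(2)] \<open>0 < x\<close> unfolding T''_def by (simp add: divide_simps) (simp add: algebra_simps)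
qed

text \<open>The coefficient \<open>c\<close> for which \<open>F = (1 - z\<^sup>2) (1 + x z - c (1 - z\<^sup>2))\<close> satisfies \<open>F''(- 1 / x) = 2 s x\<close>:
indeed \<open>((1 - z\<^sup>2) (1 + x z))''\<close> and \<open>((1 - z\<^sup>2)\<^sup>2)''\<close> take the values \<open>4\<close> and \<open>12 / x\<^sup>2 - 4\<close> there.\<close>

definition ext_const :: "real \<Rightarrow> real \<Rightarrow> real" where
  "ext_const s x = x\<^sup>2 * (2 - s * x) / (2 * (3 - x\<^sup>2))"

definition ext_factor :: "real \<Rightarrow> real \<Rightarrow> real \<Rightarrow> real" where
  "ext_factor s x z = 1 + x * z - ext_const s x * (1 - z\<^sup>2)"

text \<open>The polynomial \<open>(1 - z\<^sup>2) (1 + x z - c (1 - z\<^sup>2))\<close>, expanded.\<close>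

definition ext_poly :: "real \<Rightarrow> real \<Rightarrow> real poly" where
  "ext_poly s x = (let c = ext_const s x in [:1 - c, x, 2 * c - 1, - x, - c:])"

lemma poly_ext_poly: "poly (ext_poly s x) z = (1 - z\<^sup>2) * ext_factor s x z"
  by (simp add: ext_poly_def ext_factor_def Let_def power2_eq_square algebra_simps)

text \<open>The coefficients of the affine function \<open>A z + B\<close> in \<open>F'' = 2 s x + (1 + x z) (A z + B)\<close>; the scalar curvature
of the extremal metric is \<open>- (A z + B)\<close>.\<close>

definition ext_A :: "real \<Rightarrow> real \<Rightarrow> real" where
  "ext_A s x = - 12 * ext_const s x / x"
definition ext_B :: "real \<Rightarrow> real \<Rightarrow> real" where
  "ext_B s x = 4 * ext_const s x - 2 - 2 * s * x"

lemma x_sq_less: "0 < x \<Longrightarrow> x < 1 \<Longrightarrow> x\<^sup>2 < (1::real)"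
  by (simp add: power_less_one_iff)

lemma poly_ext_poly'':
  assumes "0 < x" "x < 1"
  shows "poly (pderiv (pderiv (ext_poly s x))) z = 2 * s * x + (1 + x * z) * (ext_A s x * z + ext_B s x)"
proof -
  have "x * x < 3" using x_sq_less[OF assms] by (simp add: power2_eq_square)
  then have "ext_const s x * (2 * (3 - x\<^sup>2)) = x\<^sup>2 * (2 - s * x)"
    by (simp add: ext_const_def power2_eq_square)
  then have "ext_A s x + x * ext_B s x = - 6 * x"
    using assms by (simp add: ext_A_def ext_B_def field_simps power2_eq_square)
  moreover have "x * ext_A s x = - 12 * ext_const s x" using assms by (simp add: ext_A_def)
  moreover have "2 * s * x + (1 + x * z) * (ext_A s x * z + ext_B s x)
    = 2 * s * x + ext_B s x + (ext_A s x + x * ext_B s x) * z + (x * ext_A s x) * z\<^sup>2"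
    by (simp add: power2_eq_square algebra_simps)
  moreover have "poly (pderiv (pderiv (ext_poly s x))) z
    = 2 * (2 * ext_const s x - 1) - 6 * x * z - 12 * ext_const s x * z\<^sup>2"
    by (simp add: ext_poly_def Let_def pderiv_pCons power2_eq_square algebra_simps)
  ultimately show ?thesis by (simp add: ext_B_def)
qed

lemma poly_ext_poly'_ends:
  "poly (pderiv (ext_poly s x)) (-1) = 2 * (1 - x)" "poly (pderiv (ext_poly s x)) 1 = - 2 * (1 + x)"
  by (simp_all add: ext_poly_def Let_def pderiv_pCons)

lemma is_extremal_poly_ext_poly:
  assumes "0 < x" "x < 1"
  shows "is_extremal_poly s x (ext_poly s x)"
  unfolding is_extremal_poly_def
proof (intro conjI poly_ext_poly'_ends)
  show "\<exists>A B. \<forall>z\<in>{-1..1}. poly (pderiv (pderiv (ext_poly s x))) z = (1 + x * z) * (2 * s * x / (1 + x * z) + A * z + B)"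
  proof (rule exI[of _ "ext_A s x"], rule exI[of _ "ext_B s x"], rule ballI)
    fix z :: real assume z: "z \<in> {-1..1}"
    show "poly (pderiv (pderiv (ext_poly s x))) z
        = (1 + x * z) * (2 * s * x / (1 + x * z) + ext_A s x * z + ext_B s x)"
      unfolding poly_ext_poly''[OF assms] using one_plus_pos[OF assms z] by (simp add: field_simps)
  qed
qed (simp_all add: poly_ext_poly)

lemma poly_eqI_interval:
  fixes p q :: "real poly"
  assumes "\<And>z. z \<in> {-1..1} \<Longrightarrow> poly p z = poly q z"
  shows "p = q"
proof (rule ccontr)
  assume "p \<noteq> q"
  then have "finite {z. poly (p - q) z = 0}" by (intro poly_roots_finite) simp
  moreover have "{-1..1} \<subseteq> {z. poly (p - q) z = 0}" using assms by auto
  ultimately have "finite {-1..1 :: real}" by (rule finite_subset[rotated])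
  then show False using infinite_Icc[of "-1 :: real" 1] by simp
qed

text \<open>The difference \<open>H\<close> of two extremal polynomials has \<open>H'' = (1 + x z) (A' z + B')\<close>, hence degree at most four,
and vanishes to second order at \<open>\<plusminus>1\<close>.  These are four linear equations for its remaining four coefficients;
the system is regular because \<open>x\<^sup>2 < 3\<close>.\<close>

lemma is_extremal_poly_unique:
  assumes x: "0 < x" "x < 1" and F: "is_extremal_poly s x F"
  shows "F = ext_poly s x"
proof -
  define H where "H = F - ext_poly s x"
  obtain A B where AB: "\<And>z. z \<in> {-1..1} \<Longrightarrow> poly (pderiv (pderiv F)) z = (1 + x * z) * (2 * s * x / (1 + x * z) + A * z + B)"
    using F unfolding is_extremal_poly_def by blast
  define A' B' where "A' = A - ext_A s x" and "B' = B - ext_B s x"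
  have H'': "pderiv (pderiv H) = [:B', A' + x * B', x * A':]"
  proof (rule poly_eqI_interval)
    fix z :: real assume z: "z \<in> {-1..1}"
    have "1 + x * z > 0" by (rule one_plus_pos[OF x z])
    then show "poly (pderiv (pderiv H)) z = poly [:B', A' + x * B', x * A':] z"
      by (simp add: H_def pderiv_diff AB[OF z] poly_ext_poly''[OF x] A'_def B'_def field_simps)
  qed
  have co: "of_nat ((n + 1) * (n + 2)) * coeff H (n + 2) = coeff [:B', A' + x * B', x * A':] n" for n
    unfolding H''[symmetric] by (simp add: coeff_pderiv algebra_simps)
  define a0 a1 where "a0 = coeff H 0" and "a1 = coeff H 1"
  have "H = [:a0, a1, B' / 2, (A' + x * B') / 6, x * A' / 12:]"
  proof (rule poly_eqI)
    fix n :: nat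
    consider "n = 0" | "n = 1" | m where "n = m + 2"
      by (metis One_nat_def add_2_eq_Suc' not0_implies_Suc)
    then show "coeff H n = coeff [:a0, a1, B' / 2, (A' + x * B') / 6, x * A' / 12:] n"
    proof cases
      case 3
      have nz: "of_nat ((m + 1) * (m + 2)) \<noteq> (0 :: real)" by (simp only: of_nat_eq_0_iff) simp
      have "coeff H n = coeff [:B', A' + x * B', x * A':] m / of_nat ((m + 1) * (m + 2))"
        using co[of m] nz 3 by (simp add: eq_divide_eq mult.commute del: of_nat_mult of_nat_add)
      moreover consider "m = 0" | "m = 1" | "m = 2" | k where "m = k + 3"
        by (metis One_nat_def Suc_1 add.commute add_Suc_right not0_implies_Suc numeral_3_eq_3 plus_nat.add_0)
      ultimately show ?thesis
        using 3 by cases (auto simp: coeff_pCons numeral_2_eq_2 numeral_3_eq_3 split: nat.splits)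
    qed (simp_all add: a0_def a1_def)
  qed
  note H = this
  have ends: "poly H 1 = 0" "poly H (-1) = 0" "poly (pderiv H) 1 = 0" "poly (pderiv H) (-1) = 0"
    using F is_extremal_poly_ext_poly[OF x, of s]
    by (simp_all add: is_extremal_poly_def H_def pderiv_diff)
  then have e: "a0 + a1 + B' / 2 + (A' + x * B') / 6 + x * A' / 12 = 0"
    "a0 - a1 + B' / 2 - (A' + x * B') / 6 + x * A' / 12 = 0"
    "a1 + B' + (A' + x * B') / 2 + x * A' / 3 = 0"
    "a1 - B' + (A' + x * B') / 2 - x * A' / 3 = 0"
    by (subst (asm) (1 2 3 4) H; simp add: pderiv_pCons field_simps)+
  have 1: "A' + x * B' = 0" using e by argo
  have 2: "a1 = 0" using e by argo
  have 3: "B' = - (x * A') / 3" using e by argo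
  have "A' * (3 - x * x) = 0" using 1 unfolding 3 by (simp add: algebra_simps)
  moreover have "x * x < 3" using x_sq_less[OF x] by (simp add: power2_eq_square)
  ultimately have "A' = 0" by simp
  then have "H = 0" using 2 3 e H by simp
  then show ?thesis by (simp add: H_def)
qed

lemma extremal_poly_eq:
  assumes "0 < x" "x < 1"
  shows "extremal_poly s x = ext_poly s x"
  unfolding extremal_poly_def
  using is_extremal_poly_ext_poly[OF assms] is_extremal_poly_unique[OF assms] by (rule the_equality)

section \<open>Cusps and cones of the fibre metric\<close>

lemma continuous_on_Icc_boundedE:
  fixes f :: "real \<Rightarrow> real"
  assumes "continuous_on {a..b} f"
  obtains L where "\<And>z. z \<in> {a..b} \<Longrightarrow> \<bar>f z\<bar> \<le> L"
  using compact_imp_bounded[OF compact_continuous_image[OF assms compact_Icc]]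
  unfolding bounded_iff by (metis imageI real_norm_def)

lemma DERIV_inverse_on_open:
  fixes f :: "real \<Rightarrow> real"
  assumes "open S" "x \<in> S" "(f has_real_derivative f') (at x)" "f' \<noteq> 0"
    and "continuous_on S f" "\<And>z. z \<in> S \<Longrightarrow> g (f z) = z"
  shows "(g has_real_derivative 1 / f') (at (f x))"
proof -
  have "(g has_derivative (*) (1 / f')) (at (f x))"
    by (rule has_derivative_inverse_strong[OF assms(1,2,5,6)])
      (use assms(3,4) in \<open>auto simp: has_field_derivative_def fun_eq_iff\<close>)
  then show ?thesis by (simp add: has_field_derivative_def)
qed

text \<open>In the coordinate \<open>z = p + e exp (-\<sigma>)\<close> the double zero supplies the factor \<open>exp (-2\<sigma>)\<close> of the angular part and
cancels \<open>z'\<^sup>2\<close> in the radial part, so both coefficients are the smooth functions \<open>h\<close> and \<open>1 / h\<close> of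
\<open>w = exp (-\<sigma>)\<close>.  The sign \<open>e\<close> tells on which side of \<open>p\<close> the part lies.\<close>

lemma cusp_at_double_zero:
  assumes h: "smooth_on_set U h" "\<And>z. z \<in> U \<Longrightarrow> h z > 0"
    and p: "p \<in> U" and e: "e = 1 \<or> e = (-1 :: real)" and wd: "wd > 0"
    and side: "\<And>w. w \<in> {0<..wd} \<Longrightarrow> p + e * w \<in> {a<..<b}"
    and ab: "{a<..<b} \<subseteq> U"
    and \<Theta>: "\<And>z. z \<in> {a<..<b} \<Longrightarrow> \<Theta> z = (z - p)\<^sup>2 * h z"
  shows "cusp_at \<Theta> a b p"
proof -
  define \<sigma>0 where "\<sigma>0 = - ln wd"
  have wd': "exp (- \<sigma>0) = wd" using wd by (simp add: \<sigma>0_def)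
  have ee: "e\<^sup>2 = 1" "e * e = 1" using e by auto
  define \<zeta> where "\<zeta> = (\<lambda>\<sigma>. p + e * exp (-1 * \<sigma>))"
  define \<zeta>' where "\<zeta>' = (\<lambda>\<sigma>. - e * exp (- \<sigma>))"
  have small: "exp (-\<sigma>) \<in> {0<..wd}" if "\<sigma> \<ge> \<sigma>0" for \<sigma>
    using that unfolding wd'[symmetric] by simp
  have in_ab: "\<zeta> \<sigma> \<in> {a<..<b}" if "\<sigma> \<ge> \<sigma>0" for \<sigma>
    using side[OF small[OF that]] by (simp add: \<zeta>_def)
  have arg: "(\<lambda>w. p + e * w) ` {0..wd} \<subseteq> U"
  proof (rule image_subsetI)
    fix w assume "w \<in> {0..wd}"
    show "p + e * w \<in> U"
    proof (cases "w = 0")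
      case False
      then have "p + e * w \<in> {a<..<b}" using \<open>w \<in> {0..wd}\<close> by (intro side) auto
      then show ?thesis using ab by blast
    qed (use p in simp)
  qed
  have r2: "smooth_on_set {0..wd} (\<lambda>w. h (p + e * w))"
    by (rule smooth_on_set_compose[OF h(1) _ arg])
      (intro smooth_on_set_add smooth_on_set_mult smooth_on_set_const smooth_on_set_id)
  have pos: "h (p + e * w) > 0" if "w \<in> {0..wd}" for w
    using arg that by (intro h(2)) blast
  have r1: "smooth_on_set {0..wd} (\<lambda>w. 1 / h (p + e * w))"
    by (rule smooth_on_set_inverse[OF r2 pos])
  have lim: "(\<zeta> \<longlongrightarrow> p) at_top"
  proof -
    have "((\<lambda>\<sigma>::real. exp (- \<sigma>)) \<longlongrightarrow> 0) at_top"
      using exp_at_bot filterlim_uminus_at_bot_at_top by (rule filterlim_compose)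
    from tendsto_add[OF tendsto_const[of p] tendsto_mult[OF tendsto_const[of e] this]]
    show ?thesis by (simp add: \<zeta>_def)
  qed
  have val: "\<Theta> (\<zeta> \<sigma>) = h (p + e * exp (- \<sigma>)) * exp (- 2 * \<sigma>)" if "\<sigma> \<ge> \<sigma>0" for \<sigma>
    using \<Theta>[OF in_ab[OF that]] ee
    by (simp add: \<zeta>_def power_mult_distrib exp_double[symmetric] mult.commute flip: power2_eq_square)
  show ?thesis
    unfolding cusp_at_def wd'
  proof (rule exI[of _ \<zeta>], rule exI[of _ \<zeta>'], rule exI[of _ "\<lambda>w. 1 / h (p + e * w)"],
      rule exI[of _ "\<lambda>w. h (p + e * w)"], rule exI[of _ \<sigma>0], intro conjI allI impI ballI)
    show "smooth_on_set {\<sigma>0..} \<zeta>"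
      unfolding \<zeta>_def by (intro smooth_on_set_add smooth_on_set_mult smooth_on_set_const smooth_on_set_exp)
    fix \<sigma> assume \<sigma>: "\<sigma> \<ge> \<sigma>0"
    show "\<zeta> \<sigma> \<in> {a<..<b}" by (rule in_ab[OF \<sigma>])
    show "(\<zeta> has_real_derivative \<zeta>' \<sigma>) (at \<sigma> within {\<sigma>0..})"
      unfolding \<zeta>_def \<zeta>'_def by (auto intro!: derivative_eq_intros)
    show "\<Theta> (\<zeta> \<sigma>) = h (p + e * exp (- \<sigma>)) * exp (- 2 * \<sigma>)" by (rule val[OF \<sigma>])
    show "(\<zeta>' \<sigma>)\<^sup>2 / \<Theta> (\<zeta> \<sigma>) = 1 / h (p + e * exp (- \<sigma>))"
      using ee pos[of "exp (-\<sigma>)"] small[OF \<sigma>]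
      unfolding val[OF \<sigma>] \<zeta>'_def by (simp add: power_mult_distrib exp_double[symmetric])
  next
    show "(\<zeta> \<longlongrightarrow> p) at_top" by (rule lim)
    show "smooth_on_set {0..exp (- \<sigma>0)} (\<lambda>w. 1 / h (p + e * w))" unfolding wd' by (rule r1)
    show "smooth_on_set {0..exp (- \<sigma>0)} (\<lambda>w. h (p + e * w))" unfolding wd' by (rule r2)
    fix w assume "w \<in> {0..exp (- \<sigma>0)}"
    then show "h (p + e * w) > 0" "1 / h (p + e * w) > 0" using pos unfolding wd' by simp_all
  qed
qed

text \<open>Separation of variables: the solution is the inverse of a primitive of \<open>1 / k\<close>.  The interval is symmetric so
that the initial point \<open>0\<close> is interior and the inverse function theorem applies there as well.\<close>

lemma autonomous_ode_solution:
  fixes k :: "real \<Rightarrow> real"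
  assumes R: "R > 0" and k: "continuous_on {-R..R} k" "\<And>r. r \<in> {-R..R} \<Longrightarrow> k r > 0"
  obtains \<epsilon> \<rho> where "\<epsilon> > 0" "\<rho> 0 = 0"
    "\<And>t. t \<in> {0..<\<epsilon>} \<Longrightarrow> (\<rho> has_real_derivative k (\<rho> t)) (at t)"
    "\<And>t. t \<in> {0<..<\<epsilon>} \<Longrightarrow> \<rho> t \<in> {0<..<R}"
proof -
  let ?S = "{-R<..<R}"
  have "continuous_on {-R..R} (\<lambda>r. 1 / k r)"
    using k by (intro continuous_intros) force+
  then obtain \<tau>0 where \<tau>0: "\<And>r. r \<in> {-R..R} \<Longrightarrow> (\<tau>0 has_vector_derivative 1 / k r) (at r within {-R..R})"
    by (rule antiderivative_continuous) (rule that)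
  define \<tau> where "\<tau> r = \<tau>0 r - \<tau>0 0" for r
  have D: "(\<tau> has_real_derivative 1 / k r) (at r)" if "r \<in> ?S" for r
  proof -
    have "(\<tau>0 has_real_derivative 1 / k r) (at r within {-R..R})"
      using \<tau>0[of r] that by (simp add: has_real_derivative_iff_has_vector_derivative)
    then have "(\<tau>0 has_real_derivative 1 / k r) (at r)"
      using that at_within_Icc_at[of "-R" r R] by simp
    then show ?thesis unfolding \<tau>_def by (auto intro!: derivative_eq_intros)
  qed
  have cont: "continuous_on ?S \<tau>"
    by (rule DERIV_continuous_on[where D = "\<lambda>r. 1 / k r"]) (rule has_field_derivative_at_within[OF D])
  have mono: "\<tau> r < \<tau> r'" if "r \<in> ?S" "r' \<in> ?S" "r < r'" for r r'
  proof (rule DERIV_pos_imp_increasing[OF that(3)])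
    fix y assume "r \<le> y" "y \<le> r'"
    then have "y \<in> ?S" using that by simp
    then show "\<exists>d. (\<tau> has_real_derivative d) (at y) \<and> d > 0"
      using D k(2)[of y] by (intro exI[of _ "1 / k y"]) simp
  qed
  have inj: "inj_on \<tau> ?S"
    by (rule inj_onI) (metis mono less_irrefl linorder_less_linear)
  define \<rho> where "\<rho> = the_inv_into ?S \<tau>"
  have \<rho>: "\<rho> (\<tau> r) = r" if "r \<in> ?S" for r
    using inj that by (simp add: \<rho>_def the_inv_into_f_f)
  have D\<rho>: "(\<rho> has_real_derivative k r) (at (\<tau> r))" if "r \<in> ?S" for r
    using DERIV_inverse_on_open[OF _ that D[OF that] _ cont, of \<rho>] \<rho> k(2)[of r] that by simp
  define \<epsilon> where "\<epsilon> = \<tau> (R / 2)"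
  have \<tau>0: "\<tau> 0 = 0" by (simp add: \<tau>_def)
  have surj: "\<exists>r\<in>{0..<R}. \<tau> r = t \<and> (t > 0 \<longrightarrow> r > 0)" if "t \<in> {0..<\<epsilon>}" for t
  proof -
    have "\<exists>r\<ge>0. r \<le> R / 2 \<and> \<tau> r = t"
      by (rule IVT') (use that R \<tau>0 cont in \<open>auto simp: \<epsilon>_def intro: continuous_on_subset\<close>)
    then obtain r where "r \<ge> 0" "r \<le> R / 2" "\<tau> r = t" by blast
    then show ?thesis using \<tau>0 R by (intro bexI[of _ r]) (auto simp: le_less)
  qed
  show thesis
  proof (rule that[of \<epsilon> \<rho>])
    show "\<epsilon> > 0" using mono[of 0 "R / 2"] R by (simp add: \<epsilon>_def \<tau>0)
    show "\<rho> 0 = 0" using \<rho>[of 0] R by (simp add: \<tau>0)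
    show "(\<rho> has_real_derivative k (\<rho> t)) (at t)" if t: "t \<in> {0..<\<epsilon>}" for t
    proof -
      obtain r where "r \<in> {0..<R}" "\<tau> r = t" using surj[OF t] by blast
      then show ?thesis using D\<rho>[of r] \<rho>[of r] R by auto
    qed
    show "\<rho> t \<in> {0<..<R}" if t: "t \<in> {0<..<\<epsilon>}" for t
    proof -
      obtain r where "r \<in> {0<..<R}" "\<tau> r = t" using surj[of t] t by force
      then show ?thesis using \<rho>[of r] R by auto
    qed
  qed
qed

text \<open>The arc-length parameter satisfies \<open>z'\<^sup>2 = \<Theta> z\<close>, which degenerates at a simple zero of \<open>\<Theta>\<close>.  With
\<open>z = p + e r\<^sup>2\<close> it becomes \<open>r' = k r\<close> for \<open>k r = sqrt (h (p + e r\<^sup>2)) / 2\<close>, which is smooth and positive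
across \<open>r = 0\<close>.  Then \<open>\<Theta> = (2 r k r)\<^sup>2\<close>, and \<open>r = k(0) \<sigma> + O(\<sigma>\<^sup>2)\<close> yields the cone with
\<open>\<kappa> = 2 k(0)\<^sup>2\<close> and order 1.\<close>

lemma conical_at_simple_zero:
  assumes h: "smooth_on_set U h" "\<And>z. z \<in> U \<Longrightarrow> h z > 0"
    and p: "p \<in> U" and e: "e = 1 \<or> e = (-1 :: real)" and wd: "wd > 0"
    and side: "\<And>w. w \<in> {0<..wd} \<Longrightarrow> p + e * w \<in> {a<..<b}"
    and ab: "{a<..<b} \<subseteq> U"
    and \<Theta>: "\<And>z. z \<in> {a<..<b} \<Longrightarrow> \<Theta> z = e * (z - p) * h z"
  shows "has_conical_singularity \<Theta> a b p"
proof -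
  have ee: "e\<^sup>2 = 1" "e * e = 1" "e * (e * y) = y" for y using e by auto
  define R where "R = sqrt wd"
  have R: "R > 0" using wd by (simp add: R_def)
  have sq: "r\<^sup>2 \<in> {0..wd}" if "r \<in> {-R..R}" for r
  proof -
    have "\<bar>r\<bar> \<le> R" using that by auto
    then have "r\<^sup>2 \<le> R\<^sup>2" by (metis abs_le_square_iff abs_of_pos R)
    then show ?thesis using wd by (simp add: R_def)
  qed
  have arg: "p + e * r\<^sup>2 \<in> U" if "r \<in> {-R..R}" for r
  proof (cases "r = 0")
    case False
    then have "p + e * r\<^sup>2 \<in> {a<..<b}" using sq[OF that] by (intro side) auto
    then show ?thesis using ab by blast
  qed (use p in simp)
  define k where "k r = 1 / 2 * h (p + e * (r * r)) powr (1 / 2)" for r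
  have smooth_k: "smooth_on_set {-R..R} k"
    unfolding k_def
    by (intro smooth_on_set_mult[OF smooth_on_set_const] smooth_on_set_compose[OF smooth_on_set_powr]
        smooth_on_set_compose[OF h(1)] smooth_on_set_add[OF smooth_on_set_const]
        smooth_on_set_mult[OF smooth_on_set_id smooth_on_set_id])
      (use arg h(2) in \<open>auto simp: power2_eq_square\<close>)
  have k_pos: "k r > 0" if "r \<in> {-R..R}" for r
    using h(2)[OF arg[OF that]] by (simp add: k_def power2_eq_square)
  have k_sq: "4 * (k r)\<^sup>2 = h (p + e * r\<^sup>2)" if "r \<in> {-R..R}" for r
  proof -
    have pos: "h (p + e * r\<^sup>2) > 0" by (rule h(2)[OF arg[OF that]])
    then have "k r = 1 / 2 * sqrt (h (p + e * r\<^sup>2))"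
      by (simp add: k_def powr_half_sqrt flip: power2_eq_square)
    then show ?thesis using pos by (simp only: power_mult_distrib) (simp add: power2_eq_square)
  qed
  obtain \<epsilon> \<rho> where \<epsilon>: "\<epsilon> > 0" and \<rho>0: "\<rho> 0 = 0"
    and D\<rho>: "\<And>t. t \<in> {0..<\<epsilon>} \<Longrightarrow> (\<rho> has_real_derivative k (\<rho> t)) (at t)"
    and \<rho>R: "\<And>t. t \<in> {0<..<\<epsilon>} \<Longrightarrow> \<rho> t \<in> {0<..<R}"
    by (rule autonomous_ode_solution[OF R smooth_on_set_continuous[OF smooth_k]], erule k_pos) (rule that)
  have \<rho>R': "\<rho> t \<in> {-R..R}" if "t \<in> {0..<\<epsilon>}" for t
    using \<rho>R[of t] \<rho>0 that R by (cases "t = 0") auto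
  define \<zeta> where "\<zeta> t = p + e * (\<rho> t * \<rho> t)" for t
  define \<zeta>' where "\<zeta>' t = 2 * e * \<rho> t * k (\<rho> t)" for t
  have in_ab: "\<zeta> t \<in> {a<..<b}" if t: "t \<in> {0<..<\<epsilon>}" for t
  proof -
    have "(\<rho> t)\<^sup>2 \<in> {0<..wd}" using sq[of "\<rho> t"] \<rho>R[OF t] by auto
    then show ?thesis using side by (simp add: \<zeta>_def power2_eq_square)
  qed
  have val: "\<Theta> (\<zeta> t) = (2 * \<rho> t * k (\<rho> t))\<^sup>2" if t: "t \<in> {0<..<\<epsilon>}" for t
    using \<Theta>[OF in_ab[OF t]] k_sq[OF \<rho>R'[of t]] t ee
    by (simp add: \<zeta>_def power_mult_distrib power2_eq_square mult.assoc mult.left_commute)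
  define k0 where "k0 = k 0"
  have k0: "k0 > 0" using k_pos[of 0] R by (simp add: k0_def)
  obtain k' where k': "smooth_on_set {-R..R} k'"
      "\<And>r. r \<in> {-R..R} \<Longrightarrow> (k has_real_derivative k' r) (at r within {-R..R})"
    by (rule smooth_on_set_derivE[OF smooth_k]) (rule that)
  obtain L where L: "\<And>r. r \<in> {-R..R} \<Longrightarrow> \<bar>k' r\<bar> \<le> L"
    by (rule continuous_on_Icc_boundedE[OF smooth_on_set_continuous[OF k'(1)]]) (rule that)
  obtain K where K: "\<And>r. r \<in> {-R..R} \<Longrightarrow> \<bar>k r\<bar> \<le> K"
    by (rule continuous_on_Icc_boundedE[OF smooth_on_set_continuous[OF smooth_k]]) (rule that)
  have L0: "L \<ge> 0" using order_trans[OF abs_ge_zero L[of 0]] R by simp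
  have K0: "K \<ge> 0" using order_trans[OF abs_ge_zero K[of 0]] R by simp
  have lip: "\<bar>k r - k0\<bar> \<le> L * \<bar>r\<bar>" if "r \<in> {-R..R}" for r
    using field_differentiable_bound[of "{-R..R}" k k' L r 0] k'(2) L that R by (simp add: k0_def)
  have \<rho>_le: "\<bar>\<rho> t\<bar> \<le> K * t" if t: "t \<in> {0..<\<epsilon>}" for t
  proof -
    have "norm (\<rho> t - \<rho> 0) \<le> K * norm (t - 0)"
      by (rule field_differentiable_bound[of "{0..<\<epsilon>}" _ "\<lambda>t. k (\<rho> t)"])
        (use t \<epsilon> D\<rho> K \<rho>R' in \<open>auto intro: has_field_derivative_at_within\<close>)
    then show ?thesis using t \<rho>0 by simp
  qed
  have \<rho>_lin: "\<bar>\<rho> t - k0 * t\<bar> \<le> L * K * t\<^sup>2" if t: "t \<in> {0..<\<epsilon>}" for t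
  proof -
    have "norm ((\<rho> t - k0 * t) - (\<rho> 0 - k0 * 0)) \<le> (L * (K * t)) * norm (t - 0)"
    proof (rule field_differentiable_bound[of "{0..t}" _ "\<lambda>t. k (\<rho> t) - k0"])
      show "norm (k (\<rho> r) - k0) \<le> L * (K * t)" if "r \<in> {0..t}" for r
      proof -
        have "\<bar>k (\<rho> r) - k0\<bar> \<le> L * \<bar>\<rho> r\<bar>" using lip \<rho>R' that t by simp
        also have "\<dots> \<le> L * (K * r)" using \<rho>_le[of r] that t L0 by (intro mult_left_mono) auto
        also have "\<dots> \<le> L * (K * t)" using that L0 K0 by (intro mult_left_mono) auto
        finally show ?thesis by simp
      qed
    qed (use t \<epsilon> in \<open>auto intro!: derivative_eq_intros has_field_derivative_at_within[OF D\<rho>]\<close>)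
    then show ?thesis using t \<rho>0 by (simp add: power2_eq_square algebra_simps)
  qed
  define C where "C = (K * L * K + k0 * L * K)"
  \<comment> \<open>Both \<open>\<Theta>\<close> and the cone are squares, of \<open>2 r k r\<close> and of \<open>2 k(0)\<^sup>2 \<sigma>\<close>; the difference of squares is estimated by factors of order 2 and 1.\<close>
  have main: "\<bar>\<Theta> (\<zeta> t) - (2 * k0\<^sup>2)\<^sup>2 * t\<^sup>2\<bar> \<le> (4 * C * (K * K + k0 * k0)) * t ^ 3" if t: "t \<in> {0<..<\<epsilon>}" for t
  proof -
    have t': "t \<in> {0..<\<epsilon>}" using t by simp
    let ?A = "\<rho> t * k (\<rho> t)" and ?B = "k0 * k0 * t"
    have "?A - ?B = \<rho> t * (k (\<rho> t) - k0) + k0 * (\<rho> t - k0 * t)" by (simp add: algebra_simps)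
    also have "\<bar>\<dots>\<bar> \<le> \<bar>\<rho> t\<bar> * \<bar>k (\<rho> t) - k0\<bar> + k0 * \<bar>\<rho> t - k0 * t\<bar>"
      using abs_triangle_ineq[of "\<rho> t * (k (\<rho> t) - k0)" "k0 * (\<rho> t - k0 * t)"] k0
      by (simp add: abs_mult)
    also have "\<dots> \<le> (K * t) * (L * (K * t)) + k0 * (L * K * t\<^sup>2)"
    proof (intro add_mono mult_mono mult_left_mono)
      show "\<bar>k (\<rho> t) - k0\<bar> \<le> L * (K * t)"
        using lip[OF \<rho>R'[OF t']] mult_left_mono[OF \<rho>_le[OF t'] L0] by linarith
    qed (use \<rho>_le[OF t'] \<rho>_lin[OF t'] k0 K0 t in auto)
    also have "\<dots> = C * t\<^sup>2" by (simp add: C_def power2_eq_square algebra_simps)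
    finally have diff: "\<bar>?A - ?B\<bar> \<le> C * t\<^sup>2" .
    have "\<bar>?A + ?B\<bar> \<le> \<bar>\<rho> t\<bar> * \<bar>k (\<rho> t)\<bar> + k0 * k0 * t"
      using abs_triangle_ineq[of ?A ?B] t k0 by (simp add: abs_mult)
    also have "\<bar>\<rho> t\<bar> * \<bar>k (\<rho> t)\<bar> \<le> (K * t) * K"
      using \<rho>_le[OF t'] K[OF \<rho>R'[OF t']] K0 t by (intro mult_mono) auto
    finally have summ: "\<bar>?A + ?B\<bar> \<le> (K * K + k0 * k0) * t" by (simp add: algebra_simps)
    have "\<bar>?A - ?B\<bar> * \<bar>?A + ?B\<bar> \<le> (C * t\<^sup>2) * ((K * K + k0 * k0) * t)"
      using diff summ by (intro mult_mono) (auto intro: order_trans[OF abs_ge_zero])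
    moreover have "\<Theta> (\<zeta> t) - (2 * k0\<^sup>2)\<^sup>2 * t\<^sup>2 = 4 * ((?A - ?B) * (?A + ?B))"
      unfolding val[OF t] by (simp add: power2_eq_square algebra_simps)
    moreover have "(4 * C * (K * K + k0 * k0)) * t ^ 3 = 4 * ((C * t\<^sup>2) * ((K * K + k0 * k0) * t))"
      by (simp add: power2_eq_square power3_eq_cube)
    ultimately show ?thesis by (simp only: abs_mult)
  qed
  have "conical_at (2 * k0\<^sup>2) 1 \<Theta> a b p"
    unfolding conical_at_def
  proof (rule exI[of _ \<zeta>], rule exI[of _ \<zeta>'], rule exI[of _ \<epsilon>], intro conjI ballI)
    show "\<epsilon> > 0" by (rule \<epsilon>)
    have sm: "smooth_on_set {0<..<\<epsilon>} \<rho>"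
    proof (rule smooth_on_set_ode[OF smooth_k])
      show "\<rho> ` {0<..<\<epsilon>} \<subseteq> {-R..R}" using \<rho>R by force
    qed (auto intro!: has_field_derivative_at_within D\<rho>)
    show "smooth_on_set {0<..<\<epsilon>} \<zeta>"
      unfolding \<zeta>_def by (intro smooth_on_set_add smooth_on_set_mult smooth_on_set_const sm)
    have "isCont \<rho> 0" using D\<rho>[of 0] \<epsilon> by (auto intro: DERIV_isCont)
    then have "isCont \<zeta> 0" unfolding \<zeta>_def by (intro continuous_intros)
    then show "(\<zeta> \<longlongrightarrow> p) (at_right 0)"
      using \<rho>0 unfolding isCont_def \<zeta>_def by (auto intro: filterlim_mono[OF _ order_refl at_le])
    fix t assume t: "t \<in> {0<..<\<epsilon>}"
    show "\<zeta> t \<in> {a<..<b}" by (rule in_ab[OF t])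
    show "(\<zeta> has_real_derivative \<zeta>' t) (at t)"
      unfolding \<zeta>_def \<zeta>'_def using D\<rho>[of t] t by (auto intro!: derivative_eq_intros)
    have "2 * \<rho> t * k (\<rho> t) \<noteq> 0" using \<rho>R[OF t] k_pos[OF \<rho>R'[of t]] t by auto
    then show "(\<zeta>' t)\<^sup>2 / \<Theta> (\<zeta> t) = 1"
      unfolding val[OF t] \<zeta>'_def using ee(1) by (simp add: power_mult_distrib)
  next
    show "(\<lambda>\<sigma>. \<Theta> (\<zeta> \<sigma>) - (2 * k0\<^sup>2)\<^sup>2 * \<sigma>\<^sup>2) \<in> O[at_right 0](\<lambda>\<sigma>. \<sigma> powr (2 + 1))"
    proof (rule bigoI)
      have "\<forall>\<^sub>F t in at_right 0. t \<in> {0<..<\<epsilon>}" using \<epsilon> by (rule eventually_at_right_real)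
      then show "\<forall>\<^sub>F t in at_right 0. norm (\<Theta> (\<zeta> t) - (2 * k0\<^sup>2)\<^sup>2 * t\<^sup>2) \<le>
          (4 * C * (K * K + k0 * k0)) * norm (t powr (2 + 1))"
        by eventually_elim (use main in \<open>simp add: powr_numeral\<close>)
    qed
  qed
  then show ?thesis
    unfolding has_conical_singularity_def using k0 by (intro exI[of _ "2 * k0\<^sup>2"] exI[of _ 1] conjI) auto
qed

section \<open>Splitting of the fibre at the zeros of the extremal polynomial\<close>

lemma extremal_profile_eq:
  assumes "0 < x" "x < 1"
  shows "extremal_profile s x z = poly (ext_poly s x) z / poly [:1, x:] z"
  unfolding extremal_profile_def extremal_poly_eq[OF assms] by simp

lemma smooth_extremal_profile:
  assumes "0 < x" "x < 1"
  shows "smooth_on_set {-1..1} (extremal_profile s x)"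
  unfolding extremal_profile_eq[OF assms, abs_def]
  by (intro smooth_on_set_divide smooth_on_set_poly) (use one_plus_pos[OF assms] in \<open>auto simp: mult.commute\<close>)

lemma admissible_extremal_on_part:
  assumes s: "s < 0" and x: "0 < x" "x < 1" and ab: "-1 \<le> a" "b \<le> 1"
    and pos: "\<And>z. z \<in> {a<..<b} \<Longrightarrow> poly (ext_poly s x) z > 0"
  shows "admissible_extremal_on s x (extremal_profile s x) a b"
  unfolding admissible_extremal_on_def
proof (intro conjI ballI)
  have w: "1 + x * z > 0" if "z \<in> {a<..<b}" for z
    using that ab by (intro one_plus_pos x) auto
  show "smooth_on_set {a<..<b} (extremal_profile s x)"
    by (rule smooth_on_set_subset[OF smooth_extremal_profile[OF x]]) (use ab in auto)
  show "extremal_profile s x z > 0" if "z \<in> {a<..<b}" for z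
    using pos[OF that] w[OF that] by (simp add: extremal_profile_def extremal_poly_eq[OF x])
  show "\<exists>A B. \<forall>p :: pt. p $ 2 > 0 \<and> p $ 3 \<in> {a<..<b} \<longrightarrow>
      admissible_scal s x (extremal_profile s x) p = A * p $ 3 + B"
  proof (rule exI[of _ "- ext_A s x"], rule exI[of _ "- ext_B s x"], intro allI impI, elim conjE)
    fix p :: pt assume p: "p $ 2 > 0" "p $ 3 \<in> {a<..<b}"
    have "admissible_scal s x (extremal_profile s x) p =
        (2 * s * x - poly (pderiv (pderiv (ext_poly s x))) (p $ 3)) / (1 + x * (p $ 3))"
      by (rule admissible_scal_quotient[OF s x(1) w pos poly_DERIV poly_DERIV _ p])
        (simp_all add: extremal_profile_def extremal_poly_eq[OF x])
    also have "\<dots> = - (ext_A s x * p $ 3 + ext_B s x)"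
      unfolding poly_ext_poly''[OF x] using w[OF p(2)] by simp
    finally show "admissible_scal s x (extremal_profile s x) p = - ext_A s x * p $ 3 + - ext_B s x"
      by simp
  qed
qed

text \<open>The boundary slopes are right because \<open>F'(\<plusminus>1)\<close> was prescribed as \<open>\<mp>2\<close> times the value of \<open>1 + x z\<close> there.\<close>

lemma extremal_profile_in_profiles:
  assumes x: "0 < x" "x < 1" and pos: "\<And>z. z \<in> {-1<..<1} \<Longrightarrow> poly (ext_poly s x) z > 0"
  shows "extremal_profile s x \<in> profiles"
proof -
  let ?F = "ext_poly s x"
  have D: "(extremal_profile s x has_real_derivative
      (poly (pderiv ?F) z * poly [:1, x:] z - poly ?F z * poly (pderiv [:1, x:]) z) / (poly [:1, x:] z * poly [:1, x:] z))
      (at z within {-1..1})" if "z \<in> {-1..1}" for z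
    unfolding extremal_profile_eq[OF x, abs_def]
    by (intro DERIV_divide has_field_derivative_at_within[OF poly_DERIV])
      (use one_plus_pos[OF x that] in \<open>simp add: mult.commute\<close>)
  have "(2 - 2 * x) / (1 - x) = 2" "(- 2 - 2 * x) / (1 + x) = -2" using x by (simp_all add: field_simps)
  note ends = this
  have "(extremal_profile s x has_real_derivative 2) (at (-1) within {-1..1})"
    using ends D[of "-1"] x by (simp add: poly_ext_poly'_ends poly_ext_poly)
  moreover have "(extremal_profile s x has_real_derivative -2) (at 1 within {-1..1})"
    using ends D[of 1] x by (simp add: poly_ext_poly'_ends poly_ext_poly)
  ultimately show ?thesis
    using smooth_extremal_profile[OF x] pos one_plus_pos[OF x]
    by (simp add: profiles_def extremal_profile_def extremal_poly_eq[OF x] poly_ext_poly)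
qed

text \<open>The larger root \<open>\<tau>\<close> of \<open>4 \<tau> (1 - \<tau>) = x\<^sup>2\<close>: the value of the coefficient \<open>c\<close> at which the discriminant
\<open>x\<^sup>2 - 4 c (1 - c)\<close> of the quadratic factor vanishes while its vertex lies inside \<open>(-1, 1)\<close>.\<close>

definition threshold :: "real \<Rightarrow> real" where
  "threshold x = (1 + sqrt (1 - x\<^sup>2)) / 2"

lemma threshold_bounds: "0 < x \<Longrightarrow> x < 1 \<Longrightarrow> threshold x > 1 / 2"
  using x_sq_less[of x] by (simp add: threshold_def)

lemma threshold_lt_1: "0 < x \<Longrightarrow> x < 1 \<Longrightarrow> threshold x < 1"
  using x_sq_less[of x] by (simp add: threshold_def)

lemma threshold_root: "0 < x \<Longrightarrow> x < 1 \<Longrightarrow> 4 * threshold x * (1 - threshold x) = x\<^sup>2"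
proof -
  assume "0 < x" "x < 1"
  define r where "r = sqrt (1 - x\<^sup>2)"
  have "r * r = 1 - x\<^sup>2" using x_sq_less[OF \<open>0 < x\<close> \<open>x < 1\<close>] by (simp add: r_def)
  then show ?thesis unfolding threshold_def r_def[symmetric] by (simp add: field_simps)
qed

definition vertex :: "real \<Rightarrow> real" where "vertex x = - x / (2 * threshold x)"

lemma vertex_bounds:
  assumes "0 < x" "x < 1" shows "-1 < vertex x" "vertex x < 0"
  using threshold_bounds[OF assms] assms by (simp_all add: vertex_def field_simps)

text \<open>Completing the square for \<open>c = \<tau>\<close> and keeping track of the difference \<open>\<tau> - c\<close>.  All three regimes are read
off from the sign of the first summand.\<close>

lemma ext_factor_decomp:
  assumes "0 < x" "x < 1"
  shows "ext_factor s x z = (threshold x - ext_const s x) * (1 - z\<^sup>2) + threshold x * (z - vertex x)\<^sup>2"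
proof -
  define t where "t = threshold x"
  have t: "t > 1/2" "4 * t * (1 - t) = x\<^sup>2"
    using threshold_bounds[OF assms] threshold_root[OF assms] by (simp_all add: t_def)
  have "t * (z - vertex x)\<^sup>2 = t * z\<^sup>2 + x * z + x\<^sup>2 / (4 * t)"
    using t(1) unfolding vertex_def t_def[symmetric] by (simp add: field_simps power2_eq_square)
  also have "x\<^sup>2 / (4 * t) = 1 - t" using t(1) unfolding t(2)[symmetric] by simp
  finally show ?thesis unfolding ext_factor_def t_def by (simp add: algebra_simps)
qed

lemma ext_const_strict_mono:
  assumes "s < 0" "0 \<le> x" "x < y" "y \<le> 1"
  shows "ext_const s x < ext_const s y"
proof -
  have sq: "x\<^sup>2 < y\<^sup>2" "y\<^sup>2 \<le> 1" using assms by (auto intro: power_strict_mono simp: power_le_one)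
  have "s * y < s * x" using assms by simp
  moreover have "s * x \<le> 0" using assms by (simp add: mult_nonpos_nonneg)
  ultimately have "x\<^sup>2 * (2 - s * x) < y\<^sup>2 * (2 - s * y)"
    using sq by (intro mult_strict_mono) auto
  moreover have "x\<^sup>2 * (2 - s * x) \<ge> 0" using \<open>s * x \<le> 0\<close> by (intro mult_nonneg_nonneg) auto
  ultimately show ?thesis
    unfolding ext_const_def using sq by (intro frac_less) auto
qed

text \<open>The difference \<open>c - \<tau>\<close> is strictly increasing, equals \<open>-1\<close> at \<open>x = 0\<close> and \<open>- s / 4 > 0\<close> at \<open>x = 1\<close>; the last
sign is the place where the genus enters.\<close>

lemma critical_point:
  assumes s: "s < 0"
  obtains xs where "0 < xs" "xs < 1" "ext_const s xs = threshold xs"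
    "\<And>x. 0 < x \<Longrightarrow> x < xs \<Longrightarrow> ext_const s x < threshold x"
    "\<And>x. xs < x \<Longrightarrow> x < 1 \<Longrightarrow> ext_const s x > threshold x"
proof -
  define f where "f x = ext_const s x - threshold x" for x
  have mono: "f x < f y" if "0 \<le> x" "x < y" "y \<le> 1" for x y
  proof -
    have "x\<^sup>2 \<le> y\<^sup>2" using that by (intro power_mono) auto
    then have "sqrt (1 - y\<^sup>2) \<le> sqrt (1 - x\<^sup>2)" by simp
    then show ?thesis
      using ext_const_strict_mono[OF s that] unfolding f_def threshold_def by argo
  qed
  have cont: "continuous_on {0..1} f"
  proof -
    have "2 * (3 - x\<^sup>2) \<noteq> 0" if "x \<in> {0..1}" for x :: real
      using that power_le_one[of x 2] by auto
    then show ?thesis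
      unfolding f_def ext_const_def threshold_def by (intro continuous_intros) auto
  qed
  have "f 0 = -1" by (simp add: f_def ext_const_def threshold_def)
  moreover have "f 1 = - s / 4" by (simp add: f_def ext_const_def threshold_def field_simps)
  ultimately obtain xs where xs: "0 \<le> xs" "xs \<le> 1" "f xs = 0"
    using IVT'[of f 0 0 1] cont s by auto
  have "xs \<noteq> 0" "xs \<noteq> 1" using xs(3) \<open>f 0 = -1\<close> \<open>f 1 = - s / 4\<close> s by auto
  show thesis
  proof (rule that[of xs])
    show "ext_const s x < threshold x" if "0 < x" "x < xs" for x
      using mono[of x xs] that xs by (simp add: f_def)
    show "ext_const s x > threshold x" if "xs < x" "x < 1" for x
      using mono[of xs x] that xs by (simp add: f_def)
  qed (use xs \<open>xs \<noteq> 0\<close> \<open>xs \<noteq> 1\<close> in \<open>auto simp: f_def\<close>)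
qed

lemma subcritical_positive:
  assumes x: "0 < x" "x < 1" and sub: "ext_const s x < threshold x" and z: "z \<in> {-1<..<1}"
  shows "poly (ext_poly s x) z > 0"
proof -
  have z2: "1 - z\<^sup>2 > 0" using z by (simp add: abs_square_less_1 abs_less_iff)
  have "ext_factor s x z > 0"
    unfolding ext_factor_decomp[OF x] using sub z2 threshold_bounds[OF x]
    by (intro add_pos_nonneg mult_pos_pos mult_nonneg_nonneg) auto
  then show ?thesis using z2 by (simp add: poly_ext_poly)
qed

text \<open>The quadratic factor is positive at \<open>\<plusminus>1\<close> and negative at the vertex of the critical parabola, so it has a root
on either side; two distinct roots determine its factorisation.\<close>

lemma supercritical_roots:
  assumes x: "0 < x" "x < 1" and super: "ext_const s x > threshold x"
  obtains z1 z2 where "-1 < z1" "z1 < z2" "z2 < 1"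
    "\<And>z. ext_factor s x z = ext_const s x * (z - z1) * (z - z2)"
proof -
  let ?c = "ext_const s x" and ?G = "ext_factor s x"
  have v: "-1 < vertex x" "vertex x < 1" using vertex_bounds[OF x] by auto
  have "?G (vertex x) < 0"
    unfolding ext_factor_decomp[OF x] using super v
    by (simp add: mult_neg_pos abs_square_less_1 abs_less_iff)
  moreover have "?G (-1) > 0" "?G 1 > 0" using x by (simp_all add: ext_factor_def)
  moreover have "continuous_on S ?G" for S unfolding ext_factor_def by (intro continuous_intros)
  ultimately obtain z1 z2 where z: "-1 \<le> z1" "z1 \<le> vertex x" "?G z1 = 0" "vertex x \<le> z2" "z2 \<le> 1" "?G z2 = 0"
    using IVT2'[of ?G "vertex x" 0 "-1"] IVT'[of ?G "vertex x" 0 1] v by (metis less_imp_le)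
  have ne: "z1 \<noteq> -1" "z1 \<noteq> vertex x" "z2 \<noteq> vertex x" "z2 \<noteq> 1"
    using z \<open>?G (vertex x) < 0\<close> \<open>?G (-1) > 0\<close> \<open>?G 1 > 0\<close> by auto
  have "(z1 - z2) * (?c * (z1 + z2) + x) = ?G z1 - ?G z2"
    by (simp add: ext_factor_def power2_eq_square algebra_simps)
  then have "?c * (z1 + z2) + x = 0" using z ne by auto
  then have xe: "x = - ?c * (z1 + z2)" by simp
  have "1 - ?c = ?c * z1 * z2"
    using z(3) unfolding ext_factor_def by (subst (asm) (1) xe) (simp add: power2_eq_square algebra_simps)
  then have "?G z = ?c * (z - z1) * (z - z2)" for z
    unfolding ext_factor_def by (subst (1) xe) (simp add: power2_eq_square algebra_simps)
  then show thesis using that[of z1 z2] z ne by auto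
qed


lemma critical_splitting:
  assumes s: "s < 0" and x: "0 < x" "x < 1" and crit: "ext_const s x = threshold x"
  shows "admissible_extremal_on s x (extremal_profile s x) (-1) (vertex x)"
    and "cusp_at (extremal_profile s x) (-1) (vertex x) (vertex x)"
    and "admissible_extremal_on s x (extremal_profile s x) (vertex x) 1"
    and "cusp_at (extremal_profile s x) (vertex x) 1 (vertex x)"
proof -
  let ?t = "threshold x" and ?v = "vertex x"
  have t: "?t > 0" using threshold_bounds[OF x] by simp
  have v: "-1 < ?v" "?v < 1" using vertex_bounds[OF x] by auto
  have F: "poly (ext_poly s x) z = (1 - z\<^sup>2) * (?t * (z - ?v)\<^sup>2)" for z
    by (simp add: poly_ext_poly ext_factor_decomp[OF x] crit)
  have z2: "1 - z\<^sup>2 > 0" if "z \<in> {-1<..<1}" for z :: real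
    using that by (simp add: abs_square_less_1 abs_less_iff)
  have pos: "poly (ext_poly s x) z > 0" if "z \<in> {-1<..<1}" "z \<noteq> ?v" for z
    unfolding F using z2[OF that(1)] that(2) t by simp
  define h where "h z = poly [:?t, 0, - ?t:] z / poly [:1, x:] z" for z
  have h_smooth: "smooth_on_set {-1<..<1} h"
    unfolding h_def by (intro smooth_on_set_divide smooth_on_set_poly)
      (use one_plus_pos[OF x] in \<open>auto simp: mult.commute\<close>)
  have h_pos: "h z > 0" if "z \<in> {-1<..<1}" for z
  proof -
    have "poly [:?t, 0, - ?t:] z = ?t * (1 - z\<^sup>2)" by (simp add: power2_eq_square algebra_simps)
    then show ?thesis unfolding h_def
      using t z2[OF that] one_plus_pos[OF x, of z] that by (simp add: mult.commute)
  qed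
  have prof: "extremal_profile s x z = (z - ?v)\<^sup>2 * h z" for z
  proof -
    have "(1 - z\<^sup>2) * (?t * (z - ?v)\<^sup>2) = (z - ?v)\<^sup>2 * poly [:?t, 0, - ?t:] z"
      by (simp add: power2_eq_square algebra_simps)
    then show ?thesis unfolding extremal_profile_eq[OF x] F h_def by (simp only: times_divide_eq_right)
  qed
  show "admissible_extremal_on s x (extremal_profile s x) (-1) ?v"
    by (rule admissible_extremal_on_part[OF s x]) (use v in \<open>auto intro!: pos\<close>)
  show "admissible_extremal_on s x (extremal_profile s x) ?v 1"
    by (rule admissible_extremal_on_part[OF s x]) (use v in \<open>auto intro!: pos\<close>)
  show "cusp_at (extremal_profile s x) (-1) ?v ?v"
    by (rule cusp_at_double_zero[OF h_smooth h_pos, where e = "-1" and wd = "(?v + 1) / 2"])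
      (use v prof in \<open>auto simp: field_simps\<close>)
  show "cusp_at (extremal_profile s x) ?v 1 ?v"
    by (rule cusp_at_double_zero[OF h_smooth h_pos, where e = 1 and wd = "(1 - ?v) / 2"])
      (use v prof in \<open>auto simp: field_simps\<close>)
qed

text \<open>At each root the other linear factor is absorbed into the smooth positive coefficient; it has a fixed sign only
up to the other root, which is why positivity near one root is asserted on an interval ending at the other.\<close>

lemma supercritical_splitting:
  assumes s: "s < 0" and x: "0 < x" "x < 1" and super: "ext_const s x > threshold x"
  obtains z1 z2 where "-1 < z1" "z1 < z2" "z2 < 1"
    "\<And>z. z \<in> {-1<..<z1} \<Longrightarrow> poly (ext_poly s x) z > 0"
    "\<And>z. z \<in> {z1<..<z2} \<Longrightarrow> poly (ext_poly s x) z < 0"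
    "\<And>z. z \<in> {z2<..<1} \<Longrightarrow> poly (ext_poly s x) z > 0"
    "has_conical_singularity (extremal_profile s x) (-1) z1 z1"
    "has_conical_singularity (extremal_profile s x) z2 1 z2"
proof -
  let ?c = "ext_const s x"
  have c: "?c > 0" using threshold_bounds[OF x] super by simp
  obtain z1 z2 where z: "-1 < z1" "z1 < z2" "z2 < 1"
    and G: "\<And>z. ext_factor s x z = ?c * (z - z1) * (z - z2)"
    using supercritical_roots[OF x super] by metis
  have z_sq: "1 - z\<^sup>2 > 0" if "z \<in> {-1<..<1}" for z :: real
    using that by (simp add: abs_square_less_1 abs_less_iff)
  have F: "poly (ext_poly s x) z = (1 - z\<^sup>2) * (?c * ((z - z1) * (z - z2)))" for z
    by (simp add: poly_ext_poly G)
  define h where "h p e z = poly ([:?c, 0, - ?c:] * [:- e * p, e:]) z / poly [:1, x:] z" for p e z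
  have h_smooth: "smooth_on_set U (h p e)" if "U \<subseteq> {-1<..<1}" for U p e
    unfolding h_def by (intro smooth_on_set_divide smooth_on_set_poly)
      (use one_plus_pos[OF x] that in \<open>force simp: mult.commute\<close>)
  have h_pos: "h p e z > 0" if "z \<in> {-1<..<1}" "e * (z - p) > 0" for p e z
  proof -
    have "poly ([:?c, 0, - ?c:] * [:- e * p, e:]) z = ?c * (1 - z\<^sup>2) * (e * (z - p))"
      by (simp add: power2_eq_square algebra_simps)
    then show ?thesis unfolding h_def
      using c z_sq[OF that(1)] that one_plus_pos[OF x, of z] by (simp add: mult.commute)
  qed
  have prof: "extremal_profile s x z = -1 * (z - z1) * h z2 (-1) z" "extremal_profile s x z = 1 * (z - z2) * h z1 1 z" for z
  proof -
    have "(1 - z\<^sup>2) * (?c * ((z - z1) * (z - z2))) = -1 * (z - z1) * poly ([:?c, 0, - ?c:] * [:- (-1) * z2, -1:]) z"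
      "(1 - z\<^sup>2) * (?c * ((z - z1) * (z - z2))) = 1 * (z - z2) * poly ([:?c, 0, - ?c:] * [:- 1 * z1, 1:]) z"
      by (simp_all add: power2_eq_square algebra_simps)
    then show "extremal_profile s x z = -1 * (z - z1) * h z2 (-1) z" "extremal_profile s x z = 1 * (z - z2) * h z1 1 z"
      unfolding extremal_profile_eq[OF x] F h_def by (simp_all only: times_divide_eq_right)
  qed
  show thesis
  proof (rule that[OF z])
    show "poly (ext_poly s x) u > 0" if "u \<in> {-1<..<z1}" for u
      unfolding F using z_sq[of u] c that z by (intro mult_pos_pos mult_neg_neg) auto
    show "poly (ext_poly s x) u > 0" if "u \<in> {z2<..<1}" for u
      unfolding F using z_sq[of u] c that z by (intro mult_pos_pos) auto
    show "poly (ext_poly s x) u < 0" if "u \<in> {z1<..<z2}" for u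
      unfolding F using z_sq[of u] c that z by (intro mult_pos_neg mult_pos_neg) auto
    show "has_conical_singularity (extremal_profile s x) (-1) z1 z1"
      by (rule conical_at_simple_zero[where U = "{-1<..<z2}" and h = "h z2 (-1)" and e = "-1" and wd = "(z1 + 1) / 2"])
        (use z prof(1) in \<open>auto intro!: h_smooth h_pos simp: field_simps\<close>)
    show "has_conical_singularity (extremal_profile s x) z2 1 z2"
      by (rule conical_at_simple_zero[where U = "{z1<..<1}" and h = "h z1 1" and e = 1 and wd = "(1 - z2) / 2"])
        (use z prof(2) in \<open>auto intro!: h_smooth h_pos simp: field_simps\<close>)
  qed
qed

section \<open>Paths of potentials, moment coordinates and Legendre transforms\<close>

lemma DERIV_u_c:
  assumes "z \<in> {-1<..<1}"
  shows "(u_c has_real_derivative artanh z) (at z)"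
proof -
  have "((\<lambda>z. (1 - z) * ln (1 - z)) has_real_derivative - ln (1 - z) - 1) (at z)"
    using assms by (auto intro!: derivative_eq_intros)
  moreover have "((\<lambda>z. (1 + z) * ln (1 + z)) has_real_derivative ln (1 + z) + 1) (at z)"
    using assms by (auto intro!: derivative_eq_intros)
  ultimately have "((\<lambda>z. ((1 - z) * ln (1 - z) + (1 + z) * ln (1 + z)) / 2) has_real_derivative
      ((- ln (1 - z) - 1) + (ln (1 + z) + 1)) / 2) (at z)"
    by (intro DERIV_cdivide DERIV_add)
  then have "(u_c has_real_derivative (ln (1 + z) - ln (1 - z)) / 2) (at z)"
    by (simp add: u_c_def[abs_def])
  then show ?thesis using assms by (simp add: artanh_def ln_div)
qed

lemma DERIV_artanh: "z \<in> {-1<..<1} \<Longrightarrow> (artanh has_real_derivative 1 / (1 - z\<^sup>2)) (at z)"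
  by (rule artanh_real_has_field_derivative) auto

lemma one_minus_sq_pos: "z \<in> {-1<..<1} \<Longrightarrow> 1 - z\<^sup>2 > (0 :: real)"
  by (simp add: abs_square_less_1 abs_less_iff)

text \<open>A potential together with the first two derivatives of \<open>v = u - u_c\<close>, which extend smoothly to the closed
interval although \<open>u'\<close> and \<open>u''\<close> blow up at \<open>\<plusminus>1\<close>.  The convexity of \<open>u\<close> is expressed after multiplication
by \<open>1 - z\<^sup>2\<close>, so that it also makes sense at the endpoints.\<close>

locale potential_data =
  fixes u v1 v2 :: "real \<Rightarrow> real"
  assumes v1: "\<And>z. z \<in> {-1..1} \<Longrightarrow> ((\<lambda>z. u z - u_c z) has_real_derivative v1 z) (at z within {-1..1})"
    and v2: "\<And>z. z \<in> {-1..1} \<Longrightarrow> (v1 has_real_derivative v2 z) (at z within {-1..1})"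
    and v2_smooth: "smooth_on_set {-1..1} v2"
    and convex: "\<And>z. z \<in> {-1..1} \<Longrightarrow> 1 + (1 - z\<^sup>2) * v2 z > 0"
    and u_0: "u 0 = 0"
begin

definition v :: "real \<Rightarrow> real" where "v z = u z - u_c z"
abbreviation U :: "real \<Rightarrow> real \<Rightarrow> real" where "U t \<equiv> segment_path u t"
text \<open>The first two derivatives in \<open>z\<close> of the potential at time \<open>t\<close> of the segment from \<open>u_c\<close> to \<open>u\<close>.\<close>

definition du :: "real \<Rightarrow> real \<Rightarrow> real" where "du t z = artanh z + t * v1 z"
definition ddu :: "real \<Rightarrow> real \<Rightarrow> real" where "ddu t z = 1 / (1 - z\<^sup>2) + t * v2 z"
abbreviation m :: "real \<Rightarrow> real \<Rightarrow> real" where "m t \<equiv> moment (U t)"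

lemma U_eq: "U t z = u_c z + t * v z"
  by (simp add: segment_path_def v_def algebra_simps)

lemma U_0: "U 0 = u_c"
  by (rule ext) (simp add: segment_path_def)

lemma DERIV_v: "z \<in> {-1<..<1} \<Longrightarrow> (v has_real_derivative v1 z) (at z)"
  using v1[of z] at_within_Icc_at[of "-1" z 1] by (simp add: v_def[abs_def])

lemma DERIV_v1: "z \<in> {-1<..<1} \<Longrightarrow> (v1 has_real_derivative v2 z) (at z)"
  using v2[of z] at_within_Icc_at[of "-1" z 1] by simp

lemma cont_v: "continuous_on {-1..1} v" and cont_v1: "continuous_on {-1..1} v1" and cont_v2: "continuous_on {-1..1} v2"
  using DERIV_continuous_on[OF v1] DERIV_continuous_on[OF v2] smooth_on_set_continuous[OF v2_smooth]
  by (simp_all add: v_def[abs_def])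

lemma DERIV_U: "z \<in> {-1<..<1} \<Longrightarrow> (U t has_real_derivative du t z) (at z)"
  unfolding U_eq[abs_def] du_def by (intro DERIV_add DERIV_u_c DERIV_cmult DERIV_v)

lemma DERIV_du: "z \<in> {-1<..<1} \<Longrightarrow> (du t has_real_derivative ddu t z) (at z)"
  unfolding du_def[abs_def] ddu_def by (intro DERIV_add DERIV_artanh DERIV_cmult DERIV_v1)

lemma deriv_U: "z \<in> {-1<..<1} \<Longrightarrow> deriv (U t) z = du t z"
  by (rule DERIV_imp_deriv[OF DERIV_U])

lemma deriv_deriv_U: "z \<in> {-1<..<1} \<Longrightarrow> deriv (deriv (U t)) z = ddu t z"
proof -
  assume z: "z \<in> {-1<..<1}"
  have "\<forall>\<^sub>F y in nhds z. deriv (U t) y = du t y"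
    by (rule eventually_mono[OF eventually_nhds_in_open[OF open_greaterThanLessThan z]]) (rule deriv_U)
  then have "deriv (deriv (U t)) z = deriv (du t) z" by (rule deriv_cong_ev) simp
  then show ?thesis by (simp add: DERIV_imp_deriv[OF DERIV_du[OF z]])
qed

text \<open>A convex combination of \<open>1\<close> and \<open>1 + (1 - z\<^sup>2) v2 z\<close>.\<close>

lemma convex_path:
  assumes t: "t \<in> {0..1}" and z: "z \<in> {-1..1}"
  shows "1 + t * ((1 - z\<^sup>2) * v2 z) > 0"
proof -
  have "1 + t * ((1 - z\<^sup>2) * v2 z) = (1 - t) * 1 + t * (1 + (1 - z\<^sup>2) * v2 z)" by (simp add: algebra_simps)
  also have "\<dots> > 0"
  proof (cases "t = 0")
    case False
    then show ?thesis using t convex[OF z] by (intro add_nonneg_pos) auto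
  qed simp
  finally show ?thesis .
qed

lemma ddu_eq: "z \<in> {-1<..<1} \<Longrightarrow> ddu t z = (1 + t * ((1 - z\<^sup>2) * v2 z)) / (1 - z\<^sup>2)"
  using one_minus_sq_pos[of z] by (simp add: ddu_def field_simps)

lemma ddu_pos: "t \<in> {0..1} \<Longrightarrow> z \<in> {-1<..<1} \<Longrightarrow> ddu t z > 0"
  using convex_path[of t z] one_minus_sq_pos[of z] by (simp add: ddu_eq)

lemma du_less:
  assumes t: "t \<in> {0..1}" and "y \<in> {-1<..<1}" "z \<in> {-1<..<1}" "y < z"
  shows "du t y < du t z"
proof (rule DERIV_pos_imp_increasing[OF \<open>y < z\<close>])
  fix w assume "y \<le> w" "w \<le> z"
  then have "w \<in> {-1<..<1}" using assms by auto
  then show "\<exists>d. (du t has_real_derivative d) (at w) \<and> d > 0"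
    using DERIV_du ddu_pos[OF t] by blast
qed

lemma du_less_iff:
  assumes "t \<in> {0..1}" "y \<in> {-1<..<1}" "z \<in> {-1<..<1}"
  shows "du t y < du t z \<longleftrightarrow> y < z"
  using du_less[OF assms(1)] assms(2,3) by (metis less_asym less_irrefl linorder_neqE_linordered_idom)

lemma cont_du: "continuous_on {-1<..<1} (du t)"
  by (rule DERIV_continuous_on) (rule has_field_derivative_at_within[OF DERIV_du])

text \<open>The term \<open>t v'\<close> is bounded, whereas \<open>artanh\<close> is onto the reals.\<close>

lemma du_surj:
  assumes t: "t \<in> {0..1}"
  shows "\<exists>z\<in>{-1<..<1}. du t z = y"
proof -
  obtain M where M: "\<And>z. z \<in> {-1..1} \<Longrightarrow> \<bar>v1 z\<bar> \<le> M"
    by (rule continuous_on_Icc_boundedE[OF cont_v1]) (rule that)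
  have M0: "M \<ge> 0" using M[of 0] by auto
  \<comment> \<open>At \<open>z = tanh Y\<close> the derivative of \<open>u_c\<close> equals \<open>Y\<close>, which beats the bounded term \<open>t v'\<close>.\<close>
  define Y where "Y = \<bar>y\<bar> + M"
  have Y: "Y \<ge> 0" using M0 by (simp add: Y_def)
  have b: "tanh a \<in> {-1<..<1}" for a :: real using tanh_real_bounds by auto
  have tv: "\<bar>t * v1 (tanh a)\<bar> \<le> M" for a
  proof -
    have "\<bar>t\<bar> * \<bar>v1 (tanh a)\<bar> \<le> 1 * M" using t M[of "tanh a"] b[of a] by (intro mult_mono) auto
    then show ?thesis by (simp add: abs_mult)
  qed
  have "du t (tanh (- Y)) \<le> y" "y \<le> du t (tanh Y)"
    using tv[of "-Y"] tv[of Y] unfolding du_def artanh_tanh_real Y_def by linarith+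
  moreover have "tanh (- Y) \<le> tanh Y" using Y by (simp only: tanh_real_le_iff)
  ultimately have "\<exists>z\<ge>tanh (- Y). z \<le> tanh Y \<and> du t z = y"
  proof (intro IVT')
    show "continuous_on {tanh (- Y)..tanh Y} (du t)"
      by (rule continuous_on_subset[OF cont_du]) (use b[of Y] b[of "-Y"] in auto)
  qed
  then obtain z where "tanh (- Y) \<le> z" "z \<le> tanh Y" "du t z = y" by blast
  then show ?thesis using b[of Y] b[of "-Y"] by (intro bexI[of _ z]) auto
qed

lemma moment_eqI:
  assumes t: "t \<in> {0..1}" and z: "z \<in> {-1<..<1}" and "du t z = y"
  shows "m t y = z"
proof -
  have "(THE w. w \<in> {-1<..<1} \<and> deriv (U t) w = y) = z"
  proof (rule the_equality)
    fix w assume w: "w \<in> {-1<..<1} \<and> deriv (U t) w = y"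
    then show "w = z" using du_less[OF t, of w z] du_less[OF t, of z w] z assms(3) deriv_U[of w t]
      by (metis less_irrefl linorder_neqE_linordered_idom)
  qed (use assms deriv_U in auto)
  then show ?thesis by (simp add: moment_def the_inv_into_def)
qed

lemma moment:
  assumes "t \<in> {0..1}"
  shows "m t y \<in> {-1<..<1}" "du t (m t y) = y"
  using du_surj[OF assms, of y] moment_eqI[OF assms] by auto

lemma moment_du: "t \<in> {0..1} \<Longrightarrow> z \<in> {-1<..<1} \<Longrightarrow> m t (du t z) = z"
  by (rule moment_eqI) auto

lemma DERIV_moment:
  assumes t: "t \<in> {0..1}"
  shows "(m t has_real_derivative 1 / ddu t (m t y)) (at y)"
  using DERIV_inverse_on_open[OF _ moment(1)[OF t, of y] DERIV_du[OF moment(1)[OF t]] _ cont_du moment_du[OF t]]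
    ddu_pos[OF t moment(1)[OF t, of y]] moment(2)[OF t, of y]
  by simp

lemma range_moment:
  assumes t: "t \<in> {0..1}" shows "range (m t) = {-1<..<1}"
proof
  show "range (m t) \<subseteq> {-1<..<1}" using moment(1)[OF t] by blast
  show "{-1<..<1} \<subseteq> range (m t)" using moment_du[OF t] by (metis rangeI subsetI)
qed

text \<open>The terms with the derivative of the moment coordinate cancel, because \<open>U' (m y) = y\<close>.\<close>

lemma DERIV_legendre:
  assumes t: "t \<in> {0..1}"
  shows "(legendre (U t) has_real_derivative m t y) (at y)"
proof -
  have "((\<lambda>y. U t (m t y)) has_real_derivative du t (m t y) * (1 / ddu t (m t y))) (at y)"
    by (rule DERIV_chain2[OF DERIV_U[OF moment(1)[OF t]] DERIV_moment[OF t]])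
  from DERIV_add[OF DERIV_minus[OF this] DERIV_mult[OF DERIV_ident DERIV_moment[OF t]]]
  show ?thesis unfolding legendre_def[abs_def] moment(2)[OF t] by simp
qed

lemma DERIV_kpot:
  assumes t: "t \<in> {0..1}"
  shows "(kpot (U t) has_real_derivative m t y - m 0 y) (at y)"
  using DERIV_diff[OF DERIV_legendre[OF t] DERIV_legendre[of 0]] unfolding kpot_def[abs_def] U_0 by simp

lemma base_coeff_kpot: "t \<in> {0..1} \<Longrightarrow> x > 0 \<Longrightarrow> base_coeff x (kpot (U t)) y = (1 + x * m t y) / x"
  by (simp add: base_coeff_def DERIV_imp_deriv[OF DERIV_kpot] U_0 field_simps)

lemma fibre_coeff_kpot:
  assumes t: "t \<in> {0..1}"
  shows "fibre_coeff (kpot (U t)) y = 1 / ddu t (m t y)"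
proof -
  have "deriv (kpot (U t)) = (\<lambda>y. m t y - m 0 y)"
    by (rule ext) (rule DERIV_imp_deriv[OF DERIV_kpot[OF t]])
  then have "deriv (deriv (kpot (U t))) y = 1 / ddu t (m t y) - 1 / ddu 0 (m 0 y)"
    using DERIV_imp_deriv[OF DERIV_diff[OF DERIV_moment[OF t] DERIV_moment[of 0]]] by simp
  moreover have "deriv (moment u_c) y = 1 / ddu 0 (m 0 y)"
    using DERIV_imp_deriv[OF DERIV_moment[of 0]] by (simp add: U_0)
  ultimately show ?thesis by (simp add: fibre_coeff_def)
qed

text \<open>The Legendre transform is the supremum of the affine functions \<open>y z - U z\<close>, attained where \<open>U' z = y\<close>.\<close>

lemma legendre_max:
  assumes t: "t \<in> {0..1}" and z: "z \<in> {-1<..<1}"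
  shows "y * z - U t z \<le> legendre (U t) y"
proof -
  let ?f = "\<lambda>z. y * z - U t z" and ?m = "m t y"
  have mm: "?m \<in> {-1<..<1}" "du t ?m = y" using moment[OF t] by auto
  have D: "(?f has_real_derivative y - du t w) (at w)" if "w \<in> {-1<..<1}" for w
    using that by (auto intro!: derivative_eq_intros DERIV_U)
  have "?f z \<le> ?f ?m"
  proof (cases "z \<le> ?m")
    case True
    show ?thesis
    proof (rule DERIV_nonneg_imp_nondecreasing[OF True])
      fix w assume w: "z \<le> w" "w \<le> ?m"
      then have w': "w \<in> {-1<..<1}" using z mm by auto
      have "du t w \<le> y" using du_less_iff[OF t mm(1) w'] w mm(2) by auto
      then show "\<exists>d. (?f has_real_derivative d) (at w) \<and> d \<ge> 0" using D[OF w'] by force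
    qed
  next
    case False
    then have "?m \<le> z" by simp
    then show ?thesis
    proof (rule DERIV_nonpos_imp_nonincreasing)
      fix w assume w: "?m \<le> w" "w \<le> z"
      then have w': "w \<in> {-1<..<1}" using z mm by auto
      have "y \<le> du t w" using du_less_iff[OF t w' mm(1)] w mm(2) by auto
      then show "\<exists>d. (?f has_real_derivative d) (at w) \<and> d \<le> 0" using D[OF w'] by force
    qed
  qed
  then show ?thesis by (simp add: legendre_def)
qed

text \<open>As a supremum of functions affine in the time, the Legendre transform is convex in the time; comparing at the
point that is optimal for \<open>t\<close> gives a supporting line.\<close>

lemma legendre_tangent:
  assumes "t \<in> {0..1}" "\<tau> \<in> {0..1}"
  shows "legendre (U \<tau>) y \<ge> legendre (U t) y - (\<tau> - t) * v (m t y)"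
  using legendre_max[OF assms(2) moment(1)[OF assms(1)], of y y]
  by (simp add: legendre_def U_eq algebra_simps)

text \<open>The slopes \<open>- v (m t y)\<close> of the supporting lines of a convex function increase.\<close>

lemma v_moment_antimono:
  assumes "t \<in> {0..1}" "\<tau> \<in> {0..1}" "t \<le> \<tau>"
  shows "v (m \<tau> y) \<le> v (m t y)"
proof (cases "t = \<tau>")
  case False
  have "0 \<le> (\<tau> - t) * (v (m t y) - v (m \<tau> y))"
    using legendre_tangent[OF assms(1,2), of y] legendre_tangent[OF assms(2,1), of y] by (simp add: algebra_simps)
  then show ?thesis using assms(3) False by (simp add: zero_le_mult_iff)
qed simp

lemma moment_tendsto:
  assumes t: "t \<in> {0..1}"
  shows "((\<lambda>\<tau>. m \<tau> y) \<longlongrightarrow> m t y) (at t within {0..1})"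
proof (rule order_tendstoI)
  have ev: "\<forall>\<^sub>F \<tau> in at t within {0..1}. \<tau> \<in> {0..1}" by (simp add: eventually_at_filter)
  have lim: "((\<lambda>\<tau>. du \<tau> a) \<longlongrightarrow> du t a) (at t within {0..1})" for a
    unfolding du_def by (intro tendsto_intros)
  note mm = moment[OF t, of y]
  {
    fix a assume a: "a < m t y"
    show "\<forall>\<^sub>F \<tau> in at t within {0..1}. a < m \<tau> y"
    proof (cases "a \<le> -1")
      case True
      show ?thesis using ev
      proof eventually_elim
        case (elim \<tau>)
        then show ?case using moment(1)[OF elim, of y] True by auto
      qed
    next
      case False
      then have a': "a \<in> {-1<..<1}" using a mm by auto
      have "du t a < y" using du_less[OF t a' mm(1) a] mm(2) by simp
      then have "\<forall>\<^sub>F \<tau> in at t within {0..1}. du \<tau> a < y" by (rule order_tendstoD(2)[OF lim])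
      then show ?thesis using ev
      proof eventually_elim
        case (elim \<tau>)
        then show ?case using du_less_iff[OF elim(2) a' moment(1)[OF elim(2)], of y] moment(2)[OF elim(2)] by simp
      qed
    qed
  next
    fix a assume a: "m t y < a"
    show "\<forall>\<^sub>F \<tau> in at t within {0..1}. m \<tau> y < a"
    proof (cases "1 \<le> a")
      case True
      show ?thesis using ev
      proof eventually_elim
        case (elim \<tau>)
        then show ?case using moment(1)[OF elim, of y] True by auto
      qed
    next
      case False
      then have a': "a \<in> {-1<..<1}" using a mm by auto
      have "y < du t a" using du_less[OF t mm(1) a' a] mm(2) by simp
      then have "\<forall>\<^sub>F \<tau> in at t within {0..1}. y < du \<tau> a" by (rule order_tendstoD(1)[OF lim])
      then show ?thesis using ev
      proof eventually_elim
        case (elim \<tau>)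
        then show ?case using du_less_iff[OF elim(2) moment(1)[OF elim(2)] a', of y] moment(2)[OF elim(2)] by simp
      qed
    qed
  }
qed

text \<open>Envelope theorem: the supporting lines at \<open>t\<close> and at \<open>\<tau>\<close> enclose the difference quotient between
\<open>- v (m t y)\<close> and \<open>- v (m \<tau> y)\<close>, and the moment coordinate is continuous in the time.\<close>

lemma deriv_kpot_path:
  assumes t: "t \<in> {0<..<1}"
  shows "deriv (\<lambda>\<tau>. kpot (U \<tau>) y) t = - v (m t y)"
proof -
  have t': "t \<in> {0..1}" using t by simp
  have at: "at t within {0..1} = at t" using t by (simp add: at_within_Icc_at)
  let ?L = "\<lambda>\<tau>. legendre (U \<tau>) y"
  have "isCont v (m t y)" using DERIV_isCont[OF DERIV_v[OF moment(1)[OF t']]] .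
  then have lim: "((\<lambda>\<tau>. v (m \<tau> y) - v (m t y)) \<longlongrightarrow> 0) (at t)"
    using isCont_tendsto_compose[OF _ moment_tendsto[OF t', of y], of v] unfolding at by (simp add: LIM_zero)
  have "((\<lambda>\<tau>. (?L \<tau> - ?L t) / (\<tau> - t) - (- v (m t y))) \<longlongrightarrow> 0) (at t)"
  proof (rule Lim_null_comparison[OF _ tendsto_rabs_zero[OF lim]])
    have "\<forall>\<^sub>F \<tau> in at t. \<tau> \<in> {0<..<1} \<and> \<tau> \<noteq> t"
      using eventually_at_in_open[OF open_greaterThanLessThan t] by (auto elim: eventually_mono)
    then show "\<forall>\<^sub>F \<tau> in at t. norm ((?L \<tau> - ?L t) / (\<tau> - t) - (- v (m t y))) \<le> \<bar>v (m \<tau> y) - v (m t y)\<bar>"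
    proof eventually_elim
      case (elim \<tau>)
      then have \<tau>: "\<tau> \<in> {0..1}" "\<tau> \<noteq> t" by auto
      have "\<bar>?L \<tau> - ?L t + (\<tau> - t) * v (m t y)\<bar> \<le> \<bar>(\<tau> - t) * (v (m \<tau> y) - v (m t y))\<bar>"
        using legendre_tangent[OF t' \<tau>(1), of y] legendre_tangent[OF \<tau>(1) t', of y] by (simp add: algebra_simps)
      moreover have "(?L \<tau> - ?L t) / (\<tau> - t) - (- v (m t y)) = (?L \<tau> - ?L t + (\<tau> - t) * v (m t y)) / (\<tau> - t)"
        using \<tau>(2) by (simp add: field_simps)
      ultimately show ?case using \<tau>(2) by (simp add: abs_mult divide_le_eq mult.commute)
    qed
  qed
  then have "(?L has_real_derivative - v (m t y)) (at t)"
    unfolding has_field_derivative_iff by (rule LIM_zero_cancel)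
  then have "((\<lambda>\<tau>. kpot (U \<tau>) y) has_real_derivative - v (m t y)) (at t)"
    unfolding kpot_def by (auto intro!: derivative_eq_intros)
  then show ?thesis by (rule DERIV_imp_deriv)
qed

end

section \<open>The modified K-energy in closed form\<close>

text \<open>An integrand known only in the interior may be arbitrary at the endpoints.  This is needed because derivatives
with respect to the time are two-sided and hence only controlled inside \<open>[0, 1]\<close>, and curvatures are only
defined inside \<open>(-1, 1)\<close>.\<close>

lemma set_lborel_integral_Icc:
  fixes f g :: "real \<Rightarrow> real"
  assumes S: "{a<..<b} \<subseteq> S" "S \<subseteq> {a..b}" and g: "continuous_on {a..b} g"
    and eq: "\<And>z. z \<in> {a<..<b} \<Longrightarrow> f z = g z"
  shows "(LINT z:S|lborel. f z) = integral {a..b} g"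
proof -
  have "(LINT z:S|lborel. f z) = (LINT z:{a..b}|lborel. g z)"
    unfolding set_lebesgue_integral_def
  proof (rule integral_discrete_difference[of "{a, b}"])
    fix z assume "z \<notin> {a, b}"
    then consider "z \<in> {a<..<b}" | "z \<notin> {a..b}" by force
    then show "indicat_real S z *\<^sub>R f z = indicat_real {a..b} z *\<^sub>R g z"
    proof cases
      case 1
      then have "z \<in> S" "z \<in> {a..b}" using S by auto
      then show ?thesis using eq[OF 1] by simp
    next
      case 2
      then have "z \<notin> S" using S by blast
      then show ?thesis using 2 by simp
    qed
  qed auto
  also have "\<dots> = integral {a..b} g"
    by (rule set_borel_integral_eq_integral(2)[OF borel_integrable_atLeastAtMost'[OF g]])
  finally show ?thesis .
qed

lemma integral_by_parts_twice:
  fixes f f' f'' D D' D'' :: "real \<Rightarrow> real"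
  assumes f: "\<And>z. z \<in> {a..b} \<Longrightarrow> (f has_real_derivative f' z) (at z within {a..b})"
      "\<And>z. z \<in> {a..b} \<Longrightarrow> (f' has_real_derivative f'' z) (at z within {a..b})" "continuous_on {a..b} f''"
    and D: "\<And>z. z \<in> {a..b} \<Longrightarrow> (D has_real_derivative D' z) (at z within {a..b})"
      "\<And>z. z \<in> {a..b} \<Longrightarrow> (D' has_real_derivative D'' z) (at z within {a..b})" "continuous_on {a..b} D''"
    and "a \<le> b" "D a = 0" "D b = 0" "D' a = 0" "D' b = 0"
  shows "integral {a..b} (\<lambda>z. f z * D'' z) = integral {a..b} (\<lambda>z. f'' z * D z)"
proof -
  have "((\<lambda>z. f z * D'' z - f'' z * D z) has_integral (f b * D' b - f' b * D b) - (f a * D' a - f' a * D a)) {a..b}"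
  proof (rule fundamental_theorem_of_calculus[OF \<open>a \<le> b\<close>])
    fix z assume z: "z \<in> {a..b}"
    have "((\<lambda>z. f z * D' z - f' z * D z) has_real_derivative
        (f' z * D' z + D'' z * f z) - (f'' z * D z + D' z * f' z)) (at z within {a..b})"
      by (intro DERIV_diff DERIV_mult f D z)
    then show "((\<lambda>z. f z * D' z - f' z * D z) has_vector_derivative f z * D'' z - f'' z * D z) (at z within {a..b})"
      by (simp add: has_real_derivative_iff_has_vector_derivative algebra_simps)
  qed
  then have "integral {a..b} (\<lambda>z. f z * D'' z - f'' z * D z) = 0"
    using assms by (simp add: integral_unique)
  moreover have "(\<lambda>z. f z * D'' z) integrable_on {a..b}" "(\<lambda>z. f'' z * D z) integrable_on {a..b}"
    by (intro integrable_continuous_interval continuous_on_mult DERIV_continuous_on[OF f(1)]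
        DERIV_continuous_on[OF D(1)] f(3) D(3); assumption)+
  ultimately show ?thesis by (simp add: integral_diff)
qed

text \<open>The product of the factor 2 in \<open>\<omega>\<^sup>2\<close>, the area of the base and the length of the circle orbits.\<close>

definition vol_const :: "nat \<Rightarrow> real" where
  "vol_const deg = 2 * (2 * pi * real deg) * (2 * pi)"

context potential_data
begin

text \<open>In the moment coordinate \<open>z = m t y\<close> the volume form becomes \<open>(1 + x z) / x dz\<close>, whatever the potential: the
coefficient of \<open>dy \<and> \<theta>\<close> is the derivative of \<open>m t\<close>, so this is a change of variables on the line.\<close>

lemma int_M_kpot:
  assumes t: "t \<in> {0..1}" and x: "0 < x" "x < 1"
    and k: "continuous_on {-1<..<1} k" "\<And>z. z \<in> {-1<..<1} \<Longrightarrow> \<bar>k z\<bar> \<le> B"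
    and h: "\<And>z. z \<in> {-1<..<1} \<Longrightarrow> h (du t z) = k z"
  shows "(\<lambda>z. k z * ((1 + x * z) / x)) absolutely_integrable_on {-1<..<1}"
    and "int_M deg x (kpot (U t)) h = vol_const deg * integral {-1<..<1} (\<lambda>z. k z * ((1 + x * z) / x))"
proof -
  define f where "f z = k z * ((1 + x * z) / x)" for z
  have cf: "continuous_on {-1<..<1} f"
    unfolding f_def using x by (intro continuous_intros k) auto
  have "f absolutely_integrable_on {-1<..<1}"
  proof (rule measurable_bounded_by_integrable_imp_absolutely_integrable)
    show "f \<in> borel_measurable (lebesgue_on {-1<..<1})"
      by (rule continuous_imp_measurable_on_sets_lebesgue[OF cf]) simp
    show "(\<lambda>z :: real. B * (2 / x)) integrable_on {-1<..<1}"
      by (rule integrable_on_open_interval_real[THEN iffD2]) (intro integrable_continuous_interval continuous_on_const)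
    show "norm (f z) \<le> B * (2 / x)" if z: "z \<in> {-1<..<1}" for z
    proof -
      have "\<bar>k z\<bar> * \<bar>(1 + x * z) / x\<bar> \<le> B * (2 / x)"
      proof (rule mult_mono)
        have "x * z \<le> x * 1" using x z by (intro mult_left_mono) auto
        then have "1 + x * z \<le> 2" using x by linarith
        moreover have "1 + x * z > 0" using one_plus_pos[OF x, of z] z by simp
        ultimately show "\<bar>(1 + x * z) / x\<bar> \<le> 2 / x" using x by (simp add: divide_right_mono)
        show "\<bar>k z\<bar> \<le> B" by (rule k(2)[OF z])
        then show "0 \<le> B" by linarith
      qed simp
      then show ?thesis by (simp add: f_def abs_mult)
    qed
  qed simp
  then show abs: "(\<lambda>z. k z * ((1 + x * z) / x)) absolutely_integrable_on {-1<..<1}"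
    by (simp add: f_def[abs_def])
  define g where "g y = \<bar>1 / ddu t (m t y)\<bar> * f (m t y)" for y
  have "inj (m t)" by (rule injI) (metis moment(2)[OF t])
  then have "g absolutely_integrable_on UNIV \<and> integral UNIV g = integral {-1<..<1} f"
    unfolding g_def
    by (subst has_absolute_integral_change_of_variables_1')
      (use DERIV_moment[OF t] abs in \<open>auto simp: range_moment[OF t] f_def[abs_def]\<close>)
  then have g: "g absolutely_integrable_on UNIV" "integral UNIV g = integral {-1<..<1} f" by auto
  have cm: "continuous_on UNIV (m t)"
    using DERIV_moment[OF t] by (auto intro!: continuous_at_imp_continuous_on DERIV_isCont)
  have "continuous_on {-1<..<1} (ddu t)"
    unfolding ddu_def[abs_def]
    by (intro continuous_intros continuous_on_subset[OF cont_v2]) (use one_minus_sq_pos in force)+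
  then have "continuous_on UNIV (\<lambda>y. ddu t (m t y))"
    by (rule continuous_on_compose2[OF _ cm]) (use moment(1)[OF t] in auto)
  moreover have "continuous_on UNIV (\<lambda>y. f (m t y))"
    by (rule continuous_on_compose2[OF cf cm]) (use moment(1)[OF t] in auto)
  moreover have "ddu t (m t y) \<noteq> 0" for y using ddu_pos[OF t moment(1)[OF t], of y] by simp
  ultimately have "continuous_on UNIV g"
    unfolding g_def by (intro continuous_intros) auto
  then have gm: "g \<in> borel_measurable lborel" using borel_measurable_continuous_onI by auto
  have eq: "h y * base_coeff x (kpot (U t)) y * fibre_coeff (kpot (U t)) y = g y" for y
  proof -
    have "h y = k (m t y)" using h[OF moment(1)[OF t, of y]] by (simp add: moment(2)[OF t])
    then show ?thesis
      using ddu_pos[OF t moment(1)[OF t], of y] x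
      by (simp add: g_def f_def base_coeff_kpot[OF t] fibre_coeff_kpot[OF t])
  qed
  have "(LINT y|lborel. g y) = integral\<^sup>L lebesgue g" by (rule integral_completion[OF gm, symmetric])
  also have "\<dots> = integral UNIV g"
    using set_lebesgue_integral_eq_integral(2)[OF g(1)] by (simp add: set_lebesgue_integral_def)
  finally show "int_M deg x (kpot (U t)) h = vol_const deg * integral {-1<..<1} (\<lambda>z. k z * ((1 + x * z) / x))"
    unfolding int_M_def vol_const_def eq g(2) f_def by simp
qed

definition q :: "real \<Rightarrow> real" where "q z = (1 - z\<^sup>2) * v2 z"

text \<open>The difference \<open>F_\<Omega> - F\<close> between the extremal polynomial and the function \<open>F = (1 + x z) \<Theta>\<close> of the metric at
time \<open>t\<close>.\<close>

definition defect :: "real \<Rightarrow> real \<Rightarrow> real \<Rightarrow> real \<Rightarrow> real" where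
  "defect s x t z = poly (ext_poly s x) z - (1 - z\<^sup>2) * (1 + x * z) / (1 + t * q z)"

text \<open>Both functions have the same values and slopes at \<open>\<plusminus>1\<close>.  Concretely, the difference is
\<open>(1 - z\<^sup>2)\<^sup>2\<close> times a function that is smooth up to the boundary.\<close>

lemma defect_derivs:
  assumes t: "t \<in> {0..1}"
  obtains D1 D2 where
    "\<And>z. z \<in> {-1..1} \<Longrightarrow> (defect s x t has_real_derivative D1 z) (at z within {-1..1})"
    "\<And>z. z \<in> {-1..1} \<Longrightarrow> (D1 has_real_derivative D2 z) (at z within {-1..1})"
    "continuous_on {-1..1} D2" "D1 (-1) = 0" "D1 1 = 0"
proof -
  \<comment> \<open>The quotient of the defect by \<open>(1 - z\<^sup>2)\<^sup>2\<close>.\<close>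
  define E where "E z = t * (poly [:1, x:] z * v2 z) / (1 + t * (poly [:1, 0, -1:] z * v2 z)) - ext_const s x" for z
  have pos: "1 + t * (poly [:1, 0, -1:] z * v2 z) > 0" if "z \<in> {-1..1}" for z
    using convex_path[OF t that] by (simp add: power2_eq_square algebra_simps)
  have "smooth_on_set {-1..1} E"
    unfolding E_def
    by (intro smooth_on_set_diff smooth_on_set_divide smooth_on_set_mult smooth_on_set_add smooth_on_set_const
        smooth_on_set_poly v2_smooth pos)
  then obtain E1 where E1: "smooth_on_set {-1..1} E1" "\<And>z. z \<in> {-1..1} \<Longrightarrow> (E has_real_derivative E1 z) (at z within {-1..1})"
    by (rule smooth_on_set_derivE) (rule that)
  have defect_eq: "defect s x t z = (poly [:1, 0, -1:] z)\<^sup>2 * E z" if "z \<in> {-1..1}" for z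
  proof -
    define w d where "w = 1 - z\<^sup>2" and "d = 1 + t * (w * v2 z)"
    have d: "d > 0" using convex_path[OF t that] by (simp add: d_def w_def)
    have w: "poly [:1, 0, -1:] z = w" by (simp add: w_def power2_eq_square)
    have "defect s x t z = w * ((1 + x * z) - ext_const s x * w) - w * (1 + x * z) / d"
      by (simp add: defect_def poly_ext_poly ext_factor_def q_def w_def d_def)
    also have "\<dots> = w\<^sup>2 * (t * ((1 + x * z) * v2 z) / d - ext_const s x)"
      using d by (simp add: field_simps power2_eq_square) (simp add: d_def algebra_simps)
    finally show ?thesis unfolding E_def w d_def by (simp add: mult.commute)
  qed
  define D1 where "D1 z = 2 * poly [:1, 0, -1:] z * (-2 * z) * E z + E1 z * (poly [:1, 0, -1:] z)\<^sup>2" for z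
  have D: "(defect s x t has_real_derivative D1 z) (at z within {-1..1})" if z: "z \<in> {-1..1}" for z
  proof -
    have "((\<lambda>z. (poly [:1, 0, -1:] z)\<^sup>2) has_real_derivative 2 * poly [:1, 0, -1:] z * (-2 * z)) (at z within {-1..1})"
      by (auto intro!: derivative_eq_intros)
    from DERIV_mult[OF this E1(2)[OF z]]
    have "((\<lambda>z. (poly [:1, 0, -1:] z)\<^sup>2 * E z) has_real_derivative D1 z) (at z within {-1..1})"
      unfolding D1_def .
    then show ?thesis
      using has_field_derivative_transform_within[OF _ zero_less_one z, of _ "D1 z" "defect s x t"] defect_eq
      by simp
  qed
  have "smooth_on_set {-1..1} D1"
  proof -
    have "smooth_on_set {-1..1} (\<lambda>z. poly [:0, -4, 0, 4:] z * E z + E1 z * (poly [:1, 0, -1:] z * poly [:1, 0, -1:] z))"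
      by (intro smooth_on_set_add smooth_on_set_mult smooth_on_set_poly E1(1) \<open>smooth_on_set {-1..1} E\<close>)
    then show ?thesis by (rule smooth_on_set_cong) (simp add: D1_def power2_eq_square algebra_simps)
  qed
  then obtain D2 where "smooth_on_set {-1..1} D2" "\<And>z. z \<in> {-1..1} \<Longrightarrow> (D1 has_real_derivative D2 z) (at z within {-1..1})"
    by (rule smooth_on_set_derivE) (rule that)
  then show thesis
    using D by (intro that[of D1 D2] smooth_on_set_continuous) (auto simp: D1_def)
qed

lemma defect_ends: "defect s x t (-1) = 0" "defect s x t 1 = 0"
  by (simp_all add: defect_def poly_ext_poly)

lemma scal_at_path:
  assumes s: "s < 0" and x: "0 < x" "x < 1" and t: "t \<in> {0..1}" and z: "z \<in> {-1<..<1}"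
    and D: "\<And>z. z \<in> {-1..1} \<Longrightarrow> (defect s x t has_real_derivative D1 z) (at z within {-1..1})"
      "\<And>z. z \<in> {-1..1} \<Longrightarrow> (D1 has_real_derivative D2 z) (at z within {-1..1})"
  shows "scal_at s x (profile_of (U t)) z = D2 z / (1 + x * z) - (ext_A s x * z + ext_B s x)"
proof -
  let ?P = "ext_poly s x"
  have at: "at z within {-1..1} = at z" if "z \<in> {-1<..<1}" for z :: real
    using that by (simp add: at_within_Icc_at)
  have w: "1 + x * z > 0" if "z \<in> {-1<..<1}" for z using one_plus_pos[OF x, of z] that by simp
  have F: "poly ?P z - defect s x t z = (1 - z\<^sup>2) * (1 + x * z) / (1 + t * q z)" for z by (simp add: defect_def)
  have qpos: "1 + t * q z > 0" if "z \<in> {-1<..<1}" for z using convex_path[OF t, of z] that by (simp add: q_def)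
  have "scal_at s x (profile_of (U t)) z =
      (2 * s * x - (poly (pderiv (pderiv ?P)) z - D2 z)) / (1 + x * z)"
  proof -
    let ?p = "vector [0, 1, z, 0] :: pt"
    have p: "?p $ 2 = 1" "?p $ 3 = z" by (simp_all add: vector_def)
    have "admissible_scal s x (profile_of (U t)) ?p =
        (2 * s * x - (poly (pderiv (pderiv ?P)) (?p $ 3) - D2 (?p $ 3))) / (1 + x * ?p $ 3)"
    proof (rule admissible_scal_quotient[where a = "-1" and b = 1 and F = "\<lambda>z. poly ?P z - defect s x t z"
          and F' = "\<lambda>z. poly (pderiv ?P) z - D1 z"])
      fix z :: real assume z: "z \<in> {-1<..<1}"
      show "1 + x * z > 0" by (rule w[OF z])
      show "poly ?P z - defect s x t z > 0"
        unfolding F using one_minus_sq_pos[OF z] w[OF z] qpos[OF z] by simp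
      show "((\<lambda>z. poly ?P z - defect s x t z) has_real_derivative poly (pderiv ?P) z - D1 z) (at z)"
        using D(1)[of z] z at[OF z] by (auto intro!: DERIV_diff poly_DERIV)
      show "((\<lambda>z. poly (pderiv ?P) z - D1 z) has_real_derivative poly (pderiv (pderiv ?P)) z - D2 z) (at z)"
        using D(2)[of z] z at[OF z] by (auto intro!: DERIV_diff poly_DERIV)
      show "profile_of (U t) z = (poly ?P z - defect s x t z) / (1 + x * z)"
        unfolding F using w[OF z] by (simp add: profile_of_def deriv_deriv_U[OF z] ddu_eq[OF z] q_def)
    qed (use s x z p in auto)
    then show ?thesis unfolding scal_at_def p .
  qed
  then show ?thesis
    unfolding poly_ext_poly''[OF x] using w[OF z] by (simp add: divide_simps)
qed

text \<open>This quadratic form in \<open>(a, b)\<close> is positive definite for \<open>x\<^sup>2 < 3\<close>, which makes the orthogonal projection onto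
the affine functions unique.\<close>

lemma integral_weighted_square:
  "integral {-1..1} (\<lambda>z. (a * z + b) * ((a * z + b) * (1 + x * z))) = 2 / 3 * (a + x * b)\<^sup>2 + (2 - 2 * x\<^sup>2 / 3) * (b :: real)\<^sup>2"
proof -
  let ?F = "\<lambda>z. b\<^sup>2 * z + (2 * a * b + x * b\<^sup>2) * z^2 / 2 + (a\<^sup>2 + 2 * x * a * b) * z^3 / 3 + x * a\<^sup>2 * z^4 / 4"
  have "((\<lambda>z. (a * z + b) * ((a * z + b) * (1 + x * z))) has_integral ?F 1 - ?F (-1)) {-1..1}"
  proof (rule fundamental_theorem_of_calculus)
    fix z :: real
    have "(?F has_real_derivative (a * z + b) * ((a * z + b) * (1 + x * z))) (at z within {-1..1})"
      by (auto intro!: derivative_eq_intros simp: field_simps power2_eq_square power3_eq_cube)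
    then show "(?F has_vector_derivative (a * z + b) * ((a * z + b) * (1 + x * z))) (at z within {-1..1})"
      by (simp add: has_real_derivative_iff_has_vector_derivative)
  qed simp
  then have "integral {-1..1} (\<lambda>z. (a * z + b) * ((a * z + b) * (1 + x * z))) = ?F 1 - ?F (-1)"
    by (rule integral_unique)
  also have "\<dots> = 2 / 3 * (a + x * b)\<^sup>2 + (2 - 2 * x\<^sup>2 / 3) * b\<^sup>2"
    by (simp add: field_simps power2_eq_square)
  finally show ?thesis .
qed

text \<open>The remainder \<open>D2 / (1 + x z)\<close> is orthogonal to the affine functions for the weight \<open>1 + x z\<close>, since \<open>D2\<close> is
the second derivative of a function vanishing to second order at \<open>\<plusminus>1\<close>.  Hence the affine part
\<open>- (A z + B)\<close> of the scalar curvature is its Killing part.\<close>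

lemma scal_perp_path:
  assumes s: "s < 0" and x: "0 < x" "x < 1" and t: "t \<in> {0..1}" and z: "z \<in> {-1<..<1}"
    and D: "\<And>z. z \<in> {-1..1} \<Longrightarrow> (defect s x t has_real_derivative D1 z) (at z within {-1..1})"
      "\<And>z. z \<in> {-1..1} \<Longrightarrow> (D1 has_real_derivative D2 z) (at z within {-1..1})"
      "continuous_on {-1..1} D2" "D1 (-1) = 0" "D1 1 = 0"
  shows "scal_perp s x (profile_of (U t)) z = D2 z / (1 + x * z)"
proof -
  let ?S = "scal_at s x (profile_of (U t))"
  have S: "?S z = D2 z / (1 + x * z) - (ext_A s x * z + ext_B s x)" if "z \<in> {-1<..<1}" for z
    by (rule scal_at_path[OF s x t that D(1,2)])
  have orth: "integral {-1..1} (\<lambda>z. (a * z + b) * D2 z) = 0" for a b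
  proof -
    have "integral {-1..1} (\<lambda>z. (a * z + b) * D2 z) = integral {-1..1} (\<lambda>z. 0 * defect s x t z)"
      by (rule integral_by_parts_twice[where f' = "\<lambda>_. a" and D' = D1])
        (use D defect_ends in \<open>auto intro!: derivative_eq_intros continuous_intros\<close>)
    then show ?thesis by simp
  qed
  have inner: "(LINT z:{-1<..<1}|lborel. (?S z - (a * z + b)) * (a' * z + b') * ((1 + x * z) / x)) =
      - (integral {-1..1} (\<lambda>z. (a' * z + b') * (((a + ext_A s x) * z + (b + ext_B s x)) * (1 + x * z))) / x)" for a b a' b'
  proof -
    let ?g = "\<lambda>z. (a' * z + b') * D2 z / x - (a' * z + b') * (((a + ext_A s x) * z + (b + ext_B s x)) * (1 + x * z)) / x"
    have "(LINT z:{-1<..<1}|lborel. (?S z - (a * z + b)) * (a' * z + b') * ((1 + x * z) / x)) = integral {-1..1} ?g"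
    proof (rule set_lborel_integral_Icc)
      show "continuous_on {-1..1} ?g" using x by (intro continuous_intros D(3)) auto
      fix z :: real assume z: "z \<in> {-1<..<1}"
      define w where "w = 1 + x * z"
      have "w > 0" using one_plus_pos[OF x, of z] z by (simp add: w_def)
      then show "(?S z - (a * z + b)) * (a' * z + b') * ((1 + x * z) / x) = ?g z"
        using x unfolding S[OF z] w_def[symmetric] by (simp add: field_simps)
    qed auto
    also have "\<dots> = integral {-1..1} (\<lambda>z. (a' * z + b') * D2 z / x)
       - integral {-1..1} (\<lambda>z. (a' * z + b') * (((a + ext_A s x) * z + (b + ext_B s x)) * (1 + x * z)) / x)"
      by (rule integral_diff) (use x in \<open>auto intro!: integrable_continuous_interval continuous_intros D(3)\<close>)
    also have "integral {-1..1} (\<lambda>z. (a' * z + b') * D2 z / x) = 0"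
      using orth[of a' b'] by simp
    finally show ?thesis by simp
  qed
  have "killing_part x ?S = (\<lambda>z. - ext_A s x * z + - ext_B s x)"
    unfolding killing_part_def
  proof (rule the_equality)
    show "(\<lambda>z. - ext_A s x * z + - ext_B s x) \<in> killing_potentials \<and>
      (\<forall>h\<in>killing_potentials. (LINT z:{-1<..<1}|lborel. (?S z - (- ext_A s x * z + - ext_B s x)) * h z * ((1 + x * z) / x)) = 0)"
    proof
      show "(\<lambda>z. - ext_A s x * z + - ext_B s x) \<in> killing_potentials"
        unfolding killing_potentials_def by blast
      show "\<forall>h\<in>killing_potentials. (LINT z:{-1<..<1}|lborel. (?S z - (- ext_A s x * z + - ext_B s x)) * h z * ((1 + x * z) / x)) = 0"
        unfolding killing_potentials_def
      proof (intro ballI, elim CollectE exE)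
        fix h :: "real \<Rightarrow> real" and a' b' assume h: "h = (\<lambda>z. a' * z + b')"
        show "(LINT z:{-1<..<1}|lborel. (?S z - (- ext_A s x * z + - ext_B s x)) * h z * ((1 + x * z) / x)) = 0"
          unfolding h inner by simp
      qed
    qed
  next
    fix k assume k: "k \<in> killing_potentials \<and>
      (\<forall>h\<in>killing_potentials. (LINT z:{-1<..<1}|lborel. (?S z - k z) * h z * ((1 + x * z) / x)) = 0)"
    then obtain a b where ab: "k = (\<lambda>z. a * z + b)" unfolding killing_potentials_def by blast
    define a' b' where "a' = a + ext_A s x" and "b' = b + ext_B s x"
    have "(\<lambda>z. a' * z + b') \<in> killing_potentials" unfolding killing_potentials_def by blast
    then have "(LINT z:{-1<..<1}|lborel. (?S z - (a * z + b)) * (a' * z + b') * ((1 + x * z) / x)) = 0"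
      by (rule bspec[OF conjunct2[OF k[unfolded ab]]])
    then have "2 / 3 * (a' + x * b')\<^sup>2 + (2 - 2 * x\<^sup>2 / 3) * b'\<^sup>2 = 0"
      using x unfolding inner a'_def[symmetric] b'_def[symmetric] integral_weighted_square by simp
    moreover have "2 - 2 * x\<^sup>2 / 3 > 0" using x_sq_less[OF x] by simp
    moreover from this have "(2 - 2 * x\<^sup>2 / 3) * b'\<^sup>2 \<ge> 0" by (intro mult_nonneg_nonneg) auto
    moreover have "2 / 3 * (a' + x * b')\<^sup>2 \<ge> 0" by simp
    ultimately have "2 / 3 * (a' + x * b')\<^sup>2 = 0" "(2 - 2 * x\<^sup>2 / 3) * b'\<^sup>2 = 0" by linarith+
    then have "b' = 0" "a' + x * b' = 0" using \<open>2 - 2 * x\<^sup>2 / 3 > 0\<close> by auto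
    then have "a = - ext_A s x" "b = - ext_B s x" by (simp_all add: a'_def b'_def)
    then show "k = (\<lambda>z. - ext_A s x * z + - ext_B s x)" unfolding ab by simp
  qed
  then show ?thesis unfolding scal_perp_def S[OF z] by simp
qed

lemma cont_q: "continuous_on {-1..1} q"
  unfolding q_def[abs_def] by (intro continuous_intros cont_v2)

lemma q_path_pos: "t \<in> {0..1} \<Longrightarrow> z \<in> {-1..1} \<Longrightarrow> 1 + t * q z > 0"
  using convex_path[of t z] by (simp add: q_def)

lemma cont_ext_factor: "continuous_on S (ext_factor s x)"
  unfolding ext_factor_def[abs_def] by (intro continuous_intros)

text \<open>The product \<open>v'' (F_\<Omega> - F)\<close>, written with \<open>q\<close> so that it is visibly continuous up to \<open>z = \<plusminus>1\<close>.\<close>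

definition energy_density :: "real \<Rightarrow> real \<Rightarrow> real \<Rightarrow> real \<Rightarrow> real" where
  "energy_density s x t z = q z * ext_factor s x z - (1 + x * z) * (q z / (1 + t * q z))"

lemma int_M_energy:
  assumes s: "s < 0" and x: "0 < x" "x < 1" and t: "t \<in> {0<..<1}"
  shows "int_M deg x (kpot (U t)) (\<lambda>y. deriv (\<lambda>\<tau>. kpot (U \<tau>) y) t * scal_perp s x (profile_of (U t)) (m t y))
    = - (vol_const deg / x * integral {-1..1} (energy_density s x t))"
proof -
  have t': "t \<in> {0..1}" using t by simp
  obtain D1 D2 where D: "\<And>z. z \<in> {-1..1} \<Longrightarrow> (defect s x t has_real_derivative D1 z) (at z within {-1..1})"
      "\<And>z. z \<in> {-1..1} \<Longrightarrow> (D1 has_real_derivative D2 z) (at z within {-1..1})"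
      "continuous_on {-1..1} D2" "D1 (-1) = 0" "D1 1 = 0"
    using defect_derivs[OF t', of s x] by metis
  define k where "k z = - v z * (D2 z / (1 + x * z))" for z
  have ck: "continuous_on {-1..1} k"
    unfolding k_def using one_plus_pos[OF x] by (intro continuous_intros cont_v D(3)) force
  obtain B where B: "\<And>z. z \<in> {-1..1} \<Longrightarrow> \<bar>k z\<bar> \<le> B"
    by (rule continuous_on_Icc_boundedE[OF ck]) (rule that)
  have "int_M deg x (kpot (U t)) (\<lambda>y. deriv (\<lambda>\<tau>. kpot (U \<tau>) y) t * scal_perp s x (profile_of (U t)) (m t y))
      = vol_const deg * integral {-1<..<1} (\<lambda>z. k z * ((1 + x * z) / x))"
  proof (rule int_M_kpot(2)[OF t' x])
    show "continuous_on {-1<..<1} k" by (rule continuous_on_subset[OF ck]) auto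
    show "\<bar>k z\<bar> \<le> B" if "z \<in> {-1<..<1}" for z using B that by simp
    show "deriv (\<lambda>\<tau>. kpot (U \<tau>) (du t z)) t * scal_perp s x (profile_of (U t)) (m t (du t z)) = k z"
      if "z \<in> {-1<..<1}" for z
      using scal_perp_path[OF s x t' that D] by (simp add: deriv_kpot_path[OF t] moment_du[OF t' that] k_def)
  qed
  also have "integral {-1<..<1} (\<lambda>z. k z * ((1 + x * z) / x)) = integral {-1..1} (\<lambda>z. - (1 / x) * (v z * D2 z))"
    unfolding integral_open_interval_real[symmetric]
  proof (rule integral_cong)
    fix z :: real assume "z \<in> {-1..1}"
    then have "1 + x * z \<noteq> 0" using one_plus_pos[OF x, of z] by simp
    then show "k z * ((1 + x * z) / x) = - (1 / x) * (v z * D2 z)" by (simp add: k_def)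
  qed
  also have "\<dots> = - (1 / x) * integral {-1..1} (\<lambda>z. v z * D2 z)" by (rule integral_mult_right)
  also have "integral {-1..1} (\<lambda>z. v z * D2 z) = integral {-1..1} (\<lambda>z. v2 z * defect s x t z)"
    by (rule integral_by_parts_twice[where f' = v1 and D' = D1])
      (use D v1 v2 cont_v2 defect_ends in \<open>auto simp: v_def[abs_def]\<close>)
  also have "\<dots> = integral {-1..1} (energy_density s x t)"
    by (rule integral_cong) (simp add: energy_density_def defect_def poly_ext_poly q_def algebra_simps)
  finally show ?thesis by simp
qed

lemma cont_energy_density: "continuous_on ({0..1} \<times> {-1..1}) (\<lambda>(t, z). energy_density s x t z)"
proof -
  have q: "continuous_on ({0..1} \<times> {-1..1}) (\<lambda>p. q (snd p))"
    by (rule continuous_on_compose2[OF cont_q continuous_on_snd[OF continuous_on_id]]) auto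
  have G: "continuous_on ({0..1} \<times> {-1..1}) (\<lambda>p :: real \<times> real. ext_factor s x (snd p))"
    by (rule continuous_on_compose2[OF cont_ext_factor continuous_on_snd[OF continuous_on_id]]) auto
  show ?thesis
    unfolding case_prod_unfold energy_density_def
    by (intro continuous_intros q G) (use q_path_pos in force)
qed

text \<open>After exchanging the integrals, the time integral is elementary, as \<open>q / (1 + t q)\<close> is the derivative of
\<open>ln (1 + t q)\<close>.\<close>

theorem modified_K_energy_eq:
  assumes s: "base_curv gen deg < 0" and x: "0 < x" "x < 1"
  shows "modified_K_energy gen deg x u = vol_const deg / x *
    integral {-1..1} (\<lambda>z. q z * ext_factor (base_curv gen deg) x z - (1 + x * z) * ln (1 + q z))"
proof -
  let ?s = "base_curv gen deg"
  let ?I = "\<lambda>t. integral {-1..1} (energy_density ?s x t)"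
  have cont: "continuous_on {0..1} ?I"
    using integral_continuous_on_param[of "{0..1}" "-1" "1 :: real" "energy_density ?s x"] cont_energy_density[of ?s x] by simp
  have "modified_K_energy gen deg x u = - integral {0..1} (\<lambda>t. - (vol_const deg / x * ?I t))"
    unfolding modified_K_energy_def kenergy_along_def
    by (subst set_lborel_integral_Icc[OF _ _ _ int_M_energy[OF s x]])
      (use x in \<open>auto intro!: continuous_intros cont\<close>)
  also have "\<dots> = vol_const deg / x * integral {0..1} ?I" by simp
  also have "integral {0..1} ?I = integral {-1..1} (\<lambda>z. integral {0..1} (\<lambda>t. energy_density ?s x t z))"
    using integral_swap_continuous[of 0 "-1" 1 1 "energy_density ?s x"] cont_energy_density[of ?s x]
    by (simp add: cbox_Pair_eq)
  also have "\<dots> = integral {-1..1} (\<lambda>z. q z * ext_factor ?s x z - (1 + x * z) * ln (1 + q z))"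
  proof (rule integral_cong)
    fix z :: real assume z: "z \<in> {-1..1}"
    let ?F = "\<lambda>t. t * (q z * ext_factor ?s x z) - (1 + x * z) * ln (1 + t * q z)"
    have "((\<lambda>t. energy_density ?s x t z) has_integral ?F 1 - ?F 0) {0..1}"
    proof (rule fundamental_theorem_of_calculus)
      fix t :: real assume "t \<in> {0..1}"
      then have "(?F has_real_derivative energy_density ?s x t z) (at t within {0..1})"
        using q_path_pos[of t z] z unfolding energy_density_def
        by (auto intro!: derivative_eq_intros)
      then show "(?F has_vector_derivative energy_density ?s x t z) (at t within {0..1})"
        by (simp add: has_real_derivative_iff_has_vector_derivative)
    qed simp
    then show "integral {0..1} (\<lambda>t. energy_density ?s x t z) = q z * ext_factor ?s x z - (1 + x * z) * ln (1 + q z)"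
      by (simp add: integral_unique)
  qed
  finally show ?thesis .
qed

section \<open>A lower bound for the functional J\<close>

text \<open>Up to a constant factor, the integrand of the functional \<open>J\<close> at time \<open>t\<close>; the substitution \<open>y = artanh z\<close> refers both
volume forms to the moment coordinate of \<open>u_c\<close>.\<close>

definition J_rate :: "real \<Rightarrow> real \<Rightarrow> real" where
  "J_rate x t = integral {-1<..<1} (\<lambda>z. (v z - v (m t (artanh z))) * ((1 + x * z) / x))"

lemma du_0: "du 0 z = artanh z" by (simp add: du_def)

lemma cont_v_moment:
  assumes t: "t \<in> {0..1}" shows "continuous_on {-1<..<1} (\<lambda>z. v (m t (artanh z)))"
proof -
  have "continuous_on UNIV (m t)"
    using DERIV_moment[OF t] by (auto intro!: continuous_at_imp_continuous_on DERIV_isCont)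
  then have "continuous_on {-1<..<1} (\<lambda>z. m t (artanh z))"
    using continuous_on_compose2[of UNIV "m t" "{-1<..<1}" artanh] cont_du[of 0] by (simp add: du_0[abs_def])
  then show ?thesis
    by (rule continuous_on_compose2[OF cont_v]) (auto simp: less_imp_le moment(1)[OF t, simplified])
qed

lemma J_rate_integrable:
  assumes x: "0 < x" "x < 1" and t: "t \<in> {0..1}"
  shows "(\<lambda>z. (v z - v (m t (artanh z))) * ((1 + x * z) / x)) absolutely_integrable_on {-1<..<1}"
proof -
  obtain B where B: "\<And>z. z \<in> {-1..1} \<Longrightarrow> \<bar>v z\<bar> \<le> B" by (rule continuous_on_Icc_boundedE[OF cont_v]) (rule that)
  show ?thesis
  proof (rule int_M_kpot(1)[OF t x, where h = "\<lambda>y. v (m t y) - v (m t (artanh (m t y)))"])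
    show "continuous_on {-1<..<1} (\<lambda>z. v z - v (m t (artanh z)))"
      by (intro continuous_intros cont_v_moment t continuous_on_subset[OF cont_v]) auto
    show "\<bar>v z - v (m t (artanh z))\<bar> \<le> B + B" if "z \<in> {-1<..<1}" for z
      using B[of z] B[of "m t (artanh z)"] that moment(1)[OF t, of "artanh z"] by auto
  qed (simp add: moment_du[OF t])
qed

lemma int_M_J_rate:
  assumes x: "0 < x" "x < 1" and t: "t \<in> {0<..<1}"
  shows "int_M deg x (\<lambda>_. 0) (\<lambda>y. deriv (\<lambda>\<tau>. kpot (U \<tau>) y) t)
    - int_M deg x (kpot (U t)) (\<lambda>y. deriv (\<lambda>\<tau>. kpot (U \<tau>) y) t) = vol_const deg * J_rate x t"
proof -
  have t': "t \<in> {0..1}" using t by simp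
  obtain B where B: "\<And>z. z \<in> {-1..1} \<Longrightarrow> \<bar>v z\<bar> \<le> B" by (rule continuous_on_Icc_boundedE[OF cont_v]) (rule that)
  have k0: "kpot (U 0) = (\<lambda>_. 0)" by (rule ext) (simp add: kpot_def U_0)
  have b: "\<bar>- v (m t (artanh z))\<bar> \<le> B" if "z \<in> {-1<..<1}" for z
    using B[of "m t (artanh z)"] moment(1)[OF t', of "artanh z"] by auto
  have b': "\<bar>- v z\<bar> \<le> B" if "z \<in> {-1<..<1}" for z using B[of z] that by auto
  have c: "continuous_on {-1<..<1} (\<lambda>z. - v (m t (artanh z)))" by (intro continuous_intros cont_v_moment t')
  have c': "continuous_on {-1<..<1} (\<lambda>z. - v z)"
    by (intro continuous_intros continuous_on_subset[OF cont_v]) auto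
  have h: "deriv (\<lambda>\<tau>. kpot (U \<tau>) (du 0 z)) t = - v (m t (artanh z))" for z
    by (simp add: deriv_kpot_path[OF t] du_0)
  have h': "deriv (\<lambda>\<tau>. kpot (U \<tau>) (du t z)) t = - v z" if "z \<in> {-1<..<1}" for z
    by (simp add: deriv_kpot_path[OF t] moment_du[OF t' that])
  have t0: "0 \<in> {0..1 :: real}" by simp
  let ?h = "\<lambda>y. deriv (\<lambda>\<tau>. kpot (U \<tau>) y) t"
  have A: "(\<lambda>z. - v (m t (artanh z)) * ((1 + x * z) / x)) absolutely_integrable_on {-1<..<1}"
    "int_M deg x (\<lambda>_. 0) ?h = vol_const deg * integral {-1<..<1} (\<lambda>z. - v (m t (artanh z)) * ((1 + x * z) / x))"
    using int_M_kpot[OF t0 x c b h] unfolding k0 by blast+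
  have A': "(\<lambda>z. - v z * ((1 + x * z) / x)) absolutely_integrable_on {-1<..<1}"
    "int_M deg x (kpot (U t)) ?h = vol_const deg * integral {-1<..<1} (\<lambda>z. - v z * ((1 + x * z) / x))"
    using int_M_kpot[OF t' x c' b' h'] by blast+
  have i: "(\<lambda>z. - v (m t (artanh z)) * ((1 + x * z) / x)) integrable_on {-1<..<1}"
    "(\<lambda>z. - v z * ((1 + x * z) / x)) integrable_on {-1<..<1}"
    using A(1) A'(1) by (simp_all add: absolutely_integrable_on_def)
  have "J_rate x t = integral {-1<..<1} (\<lambda>z. - v (m t (artanh z)) * ((1 + x * z) / x))
      - integral {-1<..<1} (\<lambda>z. - v z * ((1 + x * z) / x))"
    unfolding J_rate_def integral_diff[OF i, symmetric] by (rule integral_cong) (simp add: left_diff_distrib diff_divide_distrib)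
  then show ?thesis unfolding A(2) A'(2) by (simp only: right_diff_distrib)
qed

lemma weight_pos: "0 < (x :: real) \<Longrightarrow> x < 1 \<Longrightarrow> z \<in> {-1..1} \<Longrightarrow> (1 + x * z) / x > 0"
  using one_plus_pos[of x z] by simp

lemma J_rate_mono:
  assumes x: "0 < x" "x < 1" and "t \<in> {0..1}" "\<tau> \<in> {0..1}" "t \<le> \<tau>"
  shows "J_rate x t \<le> J_rate x \<tau>"
  unfolding J_rate_def
proof (rule integral_le)
  show "(v z - v (m t (artanh z))) * ((1 + x * z) / x) \<le> (v z - v (m \<tau> (artanh z))) * ((1 + x * z) / x)"
    if "z \<in> {-1<..<1}" for z
    using v_moment_antimono[OF assms(3-5), of "artanh z"] weight_pos[OF x, of z] that
    by (intro mult_right_mono) auto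
qed (use J_rate_integrable[OF x] assms in \<open>auto simp: absolutely_integrable_on_def\<close>)

lemma J_rate_0: "J_rate x 0 = 0"
proof -
  have "J_rate x 0 = integral {-1<..<1} (\<lambda>z :: real. 0 :: real)"
    unfolding J_rate_def by (rule integral_cong) (use moment_du[of 0] in \<open>simp add: du_0\<close>)
  then show ?thesis by simp
qed

text \<open>For \<open>t \<ge> 1/2\<close> the supporting line at \<open>t\<close>, evaluated at time 0, bounds \<open>v (m t y)\<close> by twice the Legendre
transform of \<open>u_c\<close>, because all Legendre transforms are nonnegative (take \<open>z = 0\<close> in the supremum).  Off
\<open>[a, b]\<close> the integrand is nonnegative by monotonicity in the time.\<close>

lemma J_rate_lower:
  assumes x: "0 < x" "x < 1" and t: "t \<in> {1/2..1}"
    and ab: "-1 < a" "a \<le> b" "b < 1" and A: "A \<ge> 0"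
    and low: "\<And>z. z \<in> {a..b} \<Longrightarrow> v z - 2 * (z * artanh z - u_c z) \<ge> A"
  shows "J_rate x t \<ge> A * ((1 - x) / x) * (b - a)"
proof -
  have t': "t \<in> {0..1}" using t by auto
  let ?f = "\<lambda>z. (v z - v (m t (artanh z))) * ((1 + x * z) / x)"
  have f: "?f integrable_on {-1<..<1}" using J_rate_integrable[OF x t'] by (simp add: absolutely_integrable_on_def)
  have nonneg: "?f z \<ge> 0" if z: "z \<in> {-1<..<1}" for z
    using v_moment_antimono[of 0 t "artanh z"] t' moment_du[of 0 z] z weight_pos[OF x, of z]
    by (intro mult_nonneg_nonneg) (auto simp: du_0)
  have f': "?f integrable_on {a..b}"
  proof -
    have "?f absolutely_integrable_on {a..b}"
      by (rule set_integrable_subset[OF J_rate_integrable[OF x t']]) (use ab in auto)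
    then show ?thesis by (simp add: absolutely_integrable_on_def)
  qed
  have "A * ((1 - x) / x) * (b - a) = integral {a..b} (\<lambda>z. A * ((1 - x) / x))" using ab by simp
  also have "\<dots> \<le> integral {a..b} ?f"
  proof (rule integral_le)
    fix z assume z: "z \<in> {a..b}"
    then have z': "z \<in> {-1<..<1}" using ab by auto
    have "legendre (U t) (artanh z) \<ge> 0"
      using legendre_max[OF t', of 0 "artanh z"] u_0 by (simp add: U_eq v_def u_c_def)
    then have "legendre (U 0) (artanh z) \<ge> t * v (m t (artanh z))"
      using legendre_tangent[OF t', of 0 "artanh z"] by simp
    also have "legendre (U 0) (artanh z) = z * artanh z - u_c z"
      using moment_du[of 0 z] z' by (simp add: legendre_def U_0 du_0 mult.commute)
    finally have tv: "t * v (m t (artanh z)) \<le> z * artanh z - u_c z" .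
    have l0: "z * artanh z - u_c z \<ge> 0"
      using legendre_max[of 0 0 "artanh z"] moment_du[of 0 z] z'
      by (simp add: legendre_def U_0 du_0 mult.commute u_c_def)
    have "v (m t (artanh z)) \<le> 2 * (z * artanh z - u_c z)"
    proof (cases "v (m t (artanh z)) \<ge> 0")
      case True
      then have "1 / 2 * v (m t (artanh z)) \<le> t * v (m t (artanh z))" using t by (intro mult_right_mono) auto
      then show ?thesis using tv by simp
    qed (use l0 in auto)
    then have "v z - v (m t (artanh z)) \<ge> A" using low[OF z] by simp
    moreover have "x * z \<ge> x * (-1)" using x z' by (intro mult_left_mono) auto
    ultimately show "A * ((1 - x) / x) \<le> ?f z"
      using A x by (intro mult_mono divide_right_mono) auto
  qed (use f' in auto)
  also have "\<dots> \<le> integral {-1<..<1} ?f"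
    by (rule integral_subset_le) (use ab f f' nonneg in auto)
  finally show ?thesis by (simp add: J_rate_def)
qed

text \<open>The rate is nonnegative and increasing in the time, so only its values at times \<open>t \<ge> 1/2\<close> are used.
Monotonicity also provides the measurability in the time that the Lebesgue integral requires.\<close>

theorem J_functional_lower:
  assumes x: "0 < x" "x < 1" and deg: "deg > 0"
    and ab: "-1 < a" "a \<le> b" "b < 1" and A: "A \<ge> 0"
    and low: "\<And>z. z \<in> {a..b} \<Longrightarrow> v z - 2 * (z * artanh z - u_c z) \<ge> A"
  shows "J_functional deg x u \<ge> A * (1 - x) * (b - a) / 4"
proof -
  have vol: "vol_const deg > 0" using deg by (simp add: vol_const_def)
  \<comment> \<open>Extending the rate by constants outside \<open>[0, 1]\<close> makes it monotone on the whole line, hence Borel measurable.\<close>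
  define P where "P t = J_rate x (max 0 (min 1 t))" for t
  have P: "P t = J_rate x t" if "t \<in> {0..1}" for t using that by (simp add: P_def)
  have mono: "mono P" unfolding P_def by (rule monoI) (auto intro!: J_rate_mono x)
  have "set_integrable lborel {0..1} P"
    unfolding set_integrable_def
  proof (rule integrableI_bounded_set_indicator[where B = "P 1"])
    show "P \<in> borel_measurable lborel" using borel_measurable_mono[OF mono] by simp
    show "AE t in lborel. t \<in> {0..1} \<longrightarrow> norm (P t) \<le> P 1"
      using monoD[OF mono, of _ 1] monoD[OF mono, of 0] J_rate_0[of x] P[of 0] by (auto intro!: AE_I2)
  qed auto
  note PI = set_borel_integral_eq_integral[OF this]
  have int0: "int_M deg x (\<lambda>_. 0) (\<lambda>_. 1) = vol_const deg * (2 / x)"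
  proof -
    have k0: "kpot (U 0) = (\<lambda>_. 0)" by (rule ext) (simp add: kpot_def U_0)
    have "int_M deg x (kpot (U 0)) (\<lambda>_. 1) = vol_const deg * integral {-1<..<1} (\<lambda>z. 1 * ((1 + x * z) / x))"
      by (rule int_M_kpot(2)[OF _ x, where B = 1]) auto
    also have "integral {-1<..<1} (\<lambda>z. 1 * ((1 + x * z) / x)) = 2 / x"
    proof -
      have "((\<lambda>z. 1 * ((1 + x * z) / x)) has_integral (1 + x * 1^2 / 2) / x - (- 1 + x * (-1)^2 / 2) / x) {-1..1}"
        by (rule fundamental_theorem_of_calculus[where f = "\<lambda>z. (z + x * z^2 / 2) / x"])
          (use x in \<open>auto intro!: derivative_eq_intros simp: has_real_derivative_iff_has_vector_derivative[symmetric]\<close>)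
      then show ?thesis
        unfolding integral_open_interval_real[symmetric] using x
        by (subst integral_unique) (assumption, simp add: field_simps)
    qed
    finally show ?thesis unfolding k0 .
  qed
  have "(LINT t:{0..1}|lborel. int_M deg x (\<lambda>_. 0) (\<lambda>y. deriv (\<lambda>\<tau>. kpot (U \<tau>) y) t)
        - int_M deg x (kpot (U t)) (\<lambda>y. deriv (\<lambda>\<tau>. kpot (U \<tau>) y) t)) = (LINT t:{0..1}|lborel. vol_const deg * P t)"
    unfolding set_lebesgue_integral_def
  proof (rule integral_discrete_difference[of "{0, 1}"])
    fix t :: real assume "t \<notin> {0, 1}"
    then consider "t \<in> {0<..<1}" | "t \<notin> {0..1}" by force
    then show "indicat_real {0..1} t *\<^sub>R (int_M deg x (\<lambda>_. 0) (\<lambda>y. deriv (\<lambda>\<tau>. kpot (U \<tau>) y) t)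
        - int_M deg x (kpot (U t)) (\<lambda>y. deriv (\<lambda>\<tau>. kpot (U \<tau>) y) t)) = indicat_real {0..1} t *\<^sub>R (vol_const deg * P t)"
    proof cases
      case 1
      then show ?thesis unfolding int_M_J_rate[OF x 1] by (simp add: P)
    qed simp
  qed auto
  then have J: "J_functional deg x u = vol_const deg * integral {0..1} P / (vol_const deg * (2 / x))"
    unfolding J_functional_def J_along_def int0 using PI(2) by simp
  define c where "c = A * ((1 - x) / x) * (b - a)"
  have "c * (1 / 2) = integral {1/2..1 :: real} (\<lambda>_. c)" by simp
  also have "\<dots> \<le> integral {1/2..1} P"
  proof (rule integral_le)
    show "P integrable_on {1/2..1}" by (rule integrable_subinterval_real[OF PI(1)]) auto
    show "c \<le> P t" if "t \<in> {1/2..1}" for t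
      using J_rate_lower[OF x that ab A low] that by (simp add: P c_def)
  qed auto
  also have "\<dots> \<le> integral {0..1} P"
  proof (rule integral_subset_le)
    show "P integrable_on {1/2..1}" by (rule integrable_subinterval_real[OF PI(1)]) auto
    have "0 \<le> P t" if "t \<in> {0..1}" for t
      using monoD[OF mono, of 0 t] that J_rate_0[of x] P[of 0] by simp
    then show "\<forall>t\<in>{0..1}. 0 \<le> P t" by blast
  qed (use PI in auto)
  finally have "c / 2 * (x / 2) \<le> integral {0..1} P * (x / 2)" using x by (intro mult_right_mono) auto
  moreover have "J_functional deg x u = integral {0..1} P * (x / 2)" unfolding J using vol x by simp
  moreover have "c / 2 * (x / 2) = A * (1 - x) * (b - a) / 4" using x by (simp add: c_def)
  ultimately show ?thesis by simp
qed

end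

section \<open>The modified K-energy of the critical class\<close>

lemma potentialsE:
  assumes "u \<in> potentials"
  obtains v1 v2 where "potential_data u v1 v2"
proof -
  have u: "smooth_on_set {-1..1} (\<lambda>z. u z - u_c z)" "u 0 = 0" "\<And>z. z \<in> {-1<..<1} \<Longrightarrow> deriv (deriv u) z > 0"
    using assms by (auto simp: potentials_def)
  obtain v1 where v1: "smooth_on_set {-1..1} v1"
    "\<And>z. z \<in> {-1..1} \<Longrightarrow> ((\<lambda>z. u z - u_c z) has_real_derivative v1 z) (at z within {-1..1})"
    by (rule smooth_on_set_derivE[OF u(1)]) (rule that)
  obtain v2 where v2: "smooth_on_set {-1..1} v2"
    "\<And>z. z \<in> {-1..1} \<Longrightarrow> (v1 has_real_derivative v2 z) (at z within {-1..1})"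
    by (rule smooth_on_set_derivE[OF v1(1)]) (rule that)
  have D: "(u has_real_derivative artanh z + v1 z) (at z)" if z: "z \<in> {-1<..<1}" for z
  proof -
    have "((\<lambda>z. u z - u_c z) has_real_derivative v1 z) (at z)"
      using v1(2)[of z] z at_within_Icc_at[of "-1" z 1] by simp
    from DERIV_add[OF DERIV_u_c[OF z] this] show ?thesis by simp
  qed
  have dd: "deriv (deriv u) z = 1 / (1 - z\<^sup>2) + v2 z" if z: "z \<in> {-1<..<1}" for z
  proof -
    have "\<forall>\<^sub>F y in nhds z. deriv u y = artanh y + v1 y"
      by (rule eventually_mono[OF eventually_nhds_in_open[OF open_greaterThanLessThan z]]) (rule DERIV_imp_deriv[OF D])
    then have "deriv (deriv u) z = deriv (\<lambda>y. artanh y + v1 y) z" by (rule deriv_cong_ev) simp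
    also have "\<dots> = 1 / (1 - z\<^sup>2) + v2 z"
      using v2(2)[of z] z at_within_Icc_at[of "-1" z 1] by (intro DERIV_imp_deriv DERIV_add DERIV_artanh) auto
    finally show ?thesis .
  qed
  have "1 + (1 - z\<^sup>2) * v2 z > 0" if "z \<in> {-1..1}" for z
  proof (cases "z \<in> {-1<..<1}")
    case True
    have "(1 - z\<^sup>2) * (1 / (1 - z\<^sup>2) + v2 z) > 0"
      using u(3)[OF True] one_minus_sq_pos[OF True] unfolding dd[OF True] by (intro mult_pos_pos)
    then show ?thesis using one_minus_sq_pos[OF True] by (simp add: distrib_left)
  next
    case False
    then have "z = 1 \<or> z = -1" using that by auto
    then show ?thesis by auto
  qed
  then have "potential_data u v1 v2"
    using v1 v2 u(2) by unfold_locales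
  then show thesis by (rule that)
qed

text \<open>Any integrable minorant of the logarithm at 0 serves; this one has the simple primitive below.\<close>

lemma ln_ge_inverse_sqrt:
  fixes y :: real assumes "y > 0"
  shows "ln y \<ge> - 2 / sqrt y"
proof -
  have "ln (1 / sqrt y) \<le> 1 / sqrt y - 1" using assms by (intro ln_le_minus_one) simp
  moreover have "ln (1 / sqrt y) = - (ln y / 2)" using assms by (simp add: ln_div ln_sqrt)
  ultimately show ?thesis by (simp add: field_simps)
qed

text \<open>With the convention that \<open>sqrt\<close> is an odd function on the reals, one and the same primitive is valid on both
sides of the singularity.\<close>

lemma has_integral_inverse_sqrt_abs:
  "((\<lambda>z. 1 / sqrt \<bar>z - v\<bar>) has_integral 2 * sqrt (1 - v) - 2 * sqrt (- 1 - v)) {-1..1 :: real}"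
proof (rule fundamental_theorem_of_calculus_interior_strong[of "{v}" _ _ "\<lambda>z. 2 * sqrt (z - v)"])
  fix z :: real assume "z \<in> {-1<..<1} - {v}"
  then consider "z > v" | "z < v" by fastforce
  then have "((\<lambda>z. 2 * sqrt (z - v)) has_real_derivative 1 / sqrt \<bar>z - v\<bar>) (at z)"
  proof cases
    case 1
    then show ?thesis by (auto intro!: derivative_eq_intros simp: field_simps)
  next
    case 2
    have odd: "(\<lambda>z. 2 * sqrt (z - v)) = (\<lambda>z. - 2 * sqrt (v - z))"
    proof
      fix z show "2 * sqrt (z - v) = - 2 * sqrt (v - z)" using real_sqrt_minus[of "v - z"] by simp
    qed
    show ?thesis unfolding odd using 2 by (auto intro!: derivative_eq_intros simp: field_simps)
  qed
  then show "((\<lambda>z. 2 * sqrt (z - v)) has_vector_derivative 1 / sqrt \<bar>z - v\<bar>) (at z)"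
    by (simp add: has_real_derivative_iff_has_vector_derivative)
qed (auto intro!: continuous_intros)

text \<open>From \<open>ln (a W) \<le> a W - 1\<close> with \<open>a = t (z - v)\<^sup>2 / 4\<close>: this \<open>a\<close> is below the minimising value
\<open>t (z - v)\<^sup>2 / p\<close>, so the terms linear in \<open>W\<close> have a nonnegative sum, and \<open>a < 1\<close> fixes the sign of \<open>ln a\<close>.\<close>

lemma energy_density_lower:
  fixes t v z p W :: real
  assumes t: "1 / 2 < t" "t < 1" and zv: "z \<noteq> v" "\<bar>z - v\<bar> < 2" and p: "0 < p" "p < 2" and W: "W > 0"
  shows "(W - 1) * (t * (z - v)\<^sup>2) - p * ln W \<ge> - 4 + 2 * ln (t / 4) - 8 / sqrt \<bar>z - v\<bar>"
proof -
  define a where "a = t / 4 * \<bar>z - v\<bar>\<^sup>2"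
  have y: "\<bar>z - v\<bar> > 0" using zv by simp
  have sq: "\<bar>z - v\<bar>\<^sup>2 < 2\<^sup>2" using zv by (intro power_strict_mono) auto
  have a: "a > 0" using t y by (simp add: a_def)
  have "t * \<bar>z - v\<bar>\<^sup>2 < 1 * 4" using t sq y by (intro mult_strict_mono) auto
  then have a1: "a < 1" by (simp add: a_def)
  have G: "t * (z - v)\<^sup>2 = 4 * a" by (simp add: a_def)
  have "ln W + ln a = ln (a * W)" using a W by (simp add: ln_mult)
  also have "\<dots> \<le> a * W - 1" using a W by (intro ln_le_minus_one) simp
  finally have "p * ln W \<le> p * (a * W - 1 - ln a)" using p by (intro mult_left_mono) auto
  moreover have "p * (a * W) \<le> 4 * (a * W)" using p a W by (intro mult_right_mono) auto
  moreover have "p * (- ln a) \<le> 2 * (- ln a)" using p a a1 by (intro mult_right_mono) auto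
  ultimately have "(W - 1) * (4 * a) - p * ln W \<ge> - 4 * a + p + 2 * ln a" by (simp add: algebra_simps)
  moreover have "ln a = ln (t / 4) + 2 * ln \<bar>z - v\<bar>"
  proof -
    have "ln a = ln (t / 4) + ln (\<bar>z - v\<bar>\<^sup>2)"
      unfolding a_def by (rule ln_mult_pos) (use t y in \<open>auto intro: zero_less_power\<close>)
    also have "ln (\<bar>z - v\<bar>\<^sup>2) = 2 * ln \<bar>z - v\<bar>" by (subst ln_realpow) simp
    finally show ?thesis .
  qed
  moreover have "ln \<bar>z - v\<bar> \<ge> - 2 / sqrt \<bar>z - v\<bar>" by (rule ln_ge_inverse_sqrt[OF y])
  ultimately show ?thesis unfolding G using a1 p by (simp add: field_simps)
qed

text \<open>The pointwise lower bound for the integrand does not depend on the potential, and its singularity at the double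
zero is integrable.\<close>

theorem K_energy_bounded_below_critical:
  assumes s: "base_curv gen deg < 0" and x: "0 < x" "x < 1"
    and crit: "ext_const (base_curv gen deg) x = threshold x"
  shows "K_energy_bounded_below gen deg x"
proof -
  define t where "t = threshold x"
  define L where "L z = - 4 + 2 * ln (t / 4) - 8 * (1 / sqrt \<bar>z - vertex x\<bar>)" for z
  have L: "L integrable_on {-1..1}"
    unfolding L_def[abs_def]
    by (intro integrable_diff integrable_on_mult_right integrable_const_ivl
        has_integral_integrable[OF has_integral_inverse_sqrt_abs])
  have vol: "vol_const deg / x \<ge> 0" using x by (simp add: vol_const_def)
  have "modified_K_energy gen deg x u \<ge> vol_const deg / x * integral {-1..1} L" if "u \<in> potentials" for u
  proof -
    obtain v1 v2 where "potential_data u v1 v2" using potentialsE[OF \<open>u \<in> potentials\<close>] .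
    then interpret potential_data u v1 v2 .
    let ?f = "\<lambda>z. q z * ext_factor (base_curv gen deg) x z - (1 + x * z) * ln (1 + q z)"
    \<comment> \<open>At the double zero the convention \<open>1 / 0 = 0\<close> makes \<open>L\<close> finite and the bound may fail, so the value there is changed.\<close>
    let ?g = "\<lambda>z. if z = vertex x then L z else ?f z"
    have "continuous_on {-1..1} ?f"
      by (intro continuous_intros cont_q cont_ext_factor) (use q_path_pos[of 1] in force)
    then have f: "?f integrable_on {-1..1}" by (rule integrable_continuous_interval)
    have g: "?g integrable_on {-1..1}" "integral {-1..1} ?f = integral {-1..1} ?g"
      by (rule integrable_spike[OF f, of "{vertex x}"], auto)
        (rule integral_spike[of "{vertex x}"], auto)
    have "integral {-1..1} L \<le> integral {-1..1} ?g"
    proof (rule integral_le[OF L g(1)])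
      fix z :: real assume z: "z \<in> {-1..1}"
      show "L z \<le> ?g z"
      proof (cases "z = vertex x")
        case False
        have "x * z \<le> x * 1" using x z by (intro mult_left_mono) auto
        then have p: "0 < 1 + x * z" "1 + x * z < 2" using one_plus_pos[OF x z] x by linarith+
        have "\<bar>z - vertex x\<bar> < 2" using vertex_bounds[OF x] z by auto
        from energy_density_lower[OF _ _ False this p, of t "1 + q z"]
        show ?thesis
          using False threshold_bounds[OF x] threshold_lt_1[OF x] q_path_pos[of 1 z] z
          by (simp add: L_def t_def ext_factor_decomp[OF x] crit)
      qed simp
    qed
    then show ?thesis
      unfolding modified_K_energy_eq[OF s x] g(2) using vol by (intro mult_left_mono)
  qed
  then show ?thesis unfolding K_energy_bounded_below_def by blast
qed

lemma continuous_on_u_c: "continuous_on {-1..1} u_c"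
proof -
  have "((\<lambda>w :: real. w * ln w) \<longlongrightarrow> 0) (at_right 0)"
  proof (rule Lim_null_comparison)
    show "((\<lambda>w :: real. 2 * sqrt w) \<longlongrightarrow> 0) (at_right 0)"
      by (auto intro!: tendsto_eq_intros)
    have "\<forall>\<^sub>F w :: real in at_right 0. w \<in> {0<..<1}" by (rule eventually_at_right_real) simp
    then show "\<forall>\<^sub>F w :: real in at_right 0. norm (w * ln w) \<le> 2 * sqrt w"
    proof eventually_elim
      case (elim w)
      have "w * (- ln w) \<le> w * (2 / sqrt w)" using ln_ge_inverse_sqrt[of w] elim by (intro mult_left_mono) auto
      also have "\<dots> = 2 * (w / sqrt w)" by simp
      also have "w / sqrt w = sqrt w" using elim by (simp add: real_div_sqrt)
      finally show ?case using elim by (simp add: abs_mult)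
    qed
  qed
  then have c0: "continuous (at 0 within {0..}) (\<lambda>w :: real. w * ln w)"
    by (simp add: continuous_within at_within_Ici_at_right)
  have xlnx: "continuous_on {0..} (\<lambda>w :: real. w * ln w)"
    unfolding continuous_on_eq_continuous_within
  proof
    fix w :: real assume "w \<in> {0..}"
    show "continuous (at w within {0..}) (\<lambda>w :: real. w * ln w)"
    proof (cases "w = 0")
      case False
      then have "isCont (\<lambda>w :: real. w * ln w) w" using \<open>w \<in> {0..}\<close> by (intro continuous_intros) auto
      then show ?thesis by (rule continuous_at_imp_continuous_at_within)
    qed (use c0 in simp)
  qed
  have "continuous_on {-1..1} (\<lambda>z :: real. 1 - z)" "continuous_on {-1..1} (\<lambda>z :: real. 1 + z)"
    by (intro continuous_intros)+
  then have "continuous_on {-1..1} (\<lambda>z :: real. (1 - z) * ln (1 - z))" "continuous_on {-1..1} (\<lambda>z :: real. (1 + z) * ln (1 + z))"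
    using continuous_on_compose2[OF xlnx, of "{-1..1}" "\<lambda>z. 1 - z"] continuous_on_compose2[OF xlnx, of "{-1..1}" "\<lambda>z. 1 + z"]
    by (force simp: image_subset_iff)+
  from continuous_on_mult_right[OF continuous_on_add[OF this], of "1 / 2"]
  show ?thesis by (simp add: u_c_def[abs_def])
qed

text \<open>The function \<open>sqrt (1 + N\<^sup>2 y\<^sup>2)\<close> approximates \<open>N \<bar>y\<bar>\<close>, and its second derivative
\<open>N\<^sup>2 / (1 + N\<^sup>2 y\<^sup>2)\<close> to the power \<open>3/2\<close> concentrates at 0 but stays below \<open>1 / y\<^sup>2\<close>.\<close>

definition hyperbola :: "real \<Rightarrow> real \<Rightarrow> real" where "hyperbola N y = sqrt (1 + N\<^sup>2 * y\<^sup>2)"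

lemma hyperbola_pos: "hyperbola N y > 0"
  by (simp add: hyperbola_def add_pos_nonneg)

lemma hyperbola_sq: "(hyperbola N y)\<^sup>2 = 1 + N\<^sup>2 * y\<^sup>2"
  by (simp add: hyperbola_def)

lemma DERIV_hyperbola: "(hyperbola N has_real_derivative N\<^sup>2 * y / hyperbola N y) (at y)"
proof -
  have "1 + N\<^sup>2 * y\<^sup>2 > 0" by (simp add: add_pos_nonneg)
  then have "((\<lambda>y. sqrt (1 + N\<^sup>2 * y\<^sup>2)) has_real_derivative N\<^sup>2 * y / hyperbola N y) (at y)"
    by (auto intro!: derivative_eq_intros simp: hyperbola_def field_simps)
  then show ?thesis by (simp add: hyperbola_def[abs_def])
qed

lemma DERIV_hyperbola': "((\<lambda>y. N\<^sup>2 * y / hyperbola N y) has_real_derivative N\<^sup>2 / hyperbola N y ^ 3) (at y)"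
proof -
  let ?h = "hyperbola N y"
  have h: "?h \<noteq> 0" using hyperbola_pos[of N y] by simp
  have "((\<lambda>y. N\<^sup>2 * y / hyperbola N y) has_real_derivative (N\<^sup>2 * ?h - N\<^sup>2 * y * (N\<^sup>2 * y / ?h)) / (?h * ?h)) (at y)"
    using h by (auto intro!: derivative_eq_intros DERIV_hyperbola)
  also have "(N\<^sup>2 * ?h - N\<^sup>2 * y * (N\<^sup>2 * y / ?h)) / (?h * ?h) = N\<^sup>2 * (?h\<^sup>2 - N\<^sup>2 * y\<^sup>2) / ?h ^ 3"
    using h by (simp add: field_simps power2_eq_square power3_eq_cube)
  also have "?h\<^sup>2 - N\<^sup>2 * y\<^sup>2 = 1" by (simp add: hyperbola_sq)
  finally show ?thesis by simp
qed

text \<open>The hyperbola centred at \<open>p\<close> minus its tangent at \<open>z = 0\<close>, as the normalisation of potentials requires.\<close>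

definition bend :: "real \<Rightarrow> real \<Rightarrow> real \<Rightarrow> real" where
  "bend N p z = hyperbola N (z - p) - hyperbola N (- p) - N\<^sup>2 * (- p) / hyperbola N (- p) * z"
definition bend' :: "real \<Rightarrow> real \<Rightarrow> real \<Rightarrow> real" where
  "bend' N p z = N\<^sup>2 * (z - p) / hyperbola N (z - p) - N\<^sup>2 * (- p) / hyperbola N (- p)"
definition bend'' :: "real \<Rightarrow> real \<Rightarrow> real \<Rightarrow> real" where
  "bend'' N p z = N\<^sup>2 / hyperbola N (z - p) ^ 3"

lemma DERIV_shift_arg: "((\<lambda>z. z - p) has_real_derivative 1) (at (z :: real) within S)"
  by (auto intro!: derivative_eq_intros)

lemma DERIV_bend: "(bend N p has_real_derivative bend' N p z) (at z)"
proof -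
  have D: "((\<lambda>z. hyperbola N (z - p)) has_real_derivative N\<^sup>2 * (z - p) / hyperbola N (z - p)) (at z)"
    using DERIV_chain2[where f = "hyperbola N" and g = "\<lambda>z. z - p", OF DERIV_hyperbola DERIV_shift_arg] by simp
  show ?thesis
    unfolding bend_def bend'_def
    by (rule DERIV_cong[OF DERIV_diff[OF DERIV_diff[OF D DERIV_const] DERIV_cmult_Id]]) simp
qed

lemma DERIV_bend': "(bend' N p has_real_derivative bend'' N p z) (at z)"
proof -
  have D: "((\<lambda>z. N\<^sup>2 * (z - p) / hyperbola N (z - p)) has_real_derivative N\<^sup>2 / hyperbola N (z - p) ^ 3) (at z)"
    using DERIV_chain2[where f = "\<lambda>y. N\<^sup>2 * y / hyperbola N y" and g = "\<lambda>z. z - p", OF DERIV_hyperbola' DERIV_shift_arg] by simp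
  show ?thesis
    unfolding bend'_def bend''_def by (rule DERIV_cong[OF DERIV_diff[OF D DERIV_const]]) simp
qed

lemma smooth_hyperbola: "smooth_on_set S (\<lambda>z. hyperbola N (z - p))"
proof -
  let ?P = "[:1 + N\<^sup>2 * p\<^sup>2, - 2 * N\<^sup>2 * p, N\<^sup>2:]"
  have P: "poly ?P z = 1 + N\<^sup>2 * (z - p)\<^sup>2" for z
    by (simp add: power2_eq_square algebra_simps)
  have "smooth_on_set S (\<lambda>z. (poly ?P z) powr (1 / 2))"
    by (rule smooth_on_set_compose[OF smooth_on_set_powr smooth_on_set_poly], rule image_subsetI)
      (simp only: P greaterThan_iff, simp add: add_pos_nonneg)
  then show ?thesis
    by (rule smooth_on_set_cong) (simp only: P hyperbola_def, simp add: powr_half_sqrt)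
qed

lemma smooth_bend'': "smooth_on_set S (bend'' N p)"
proof -
  have "smooth_on_set S (\<lambda>z. N\<^sup>2 / (hyperbola N (z - p) * (hyperbola N (z - p) * hyperbola N (z - p))))"
    by (intro smooth_on_set_divide smooth_on_set_const smooth_on_set_mult smooth_hyperbola mult_pos_pos hyperbola_pos)
  then show ?thesis by (rule smooth_on_set_cong) (simp add: bend''_def power3_eq_cube)
qed

lemma smooth_bend: "smooth_on_set S (bend N p)"
proof -
  have "smooth_on_set S (\<lambda>z. (hyperbola N (z - p) - hyperbola N (- p)) - N\<^sup>2 * (- p) / hyperbola N (- p) * z)"
    by (intro smooth_on_set_diff smooth_hyperbola smooth_on_set_const smooth_on_set_mult smooth_on_set_id)
  then show ?thesis by (simp add: bend_def[abs_def])
qed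

lemma bend''_nonneg: "bend'' N p z \<ge> 0"
  using hyperbola_pos[of N "z - p"] by (simp add: bend''_def)

lemma bend''_bound: "(z - p)\<^sup>2 * bend'' N p z \<le> 1"
proof -
  let ?h = "hyperbola N (z - p)"
  have h: "?h \<ge> 1" unfolding hyperbola_def by simp
  have "N\<^sup>2 * (z - p)\<^sup>2 \<le> ?h\<^sup>2" by (simp add: hyperbola_sq)
  also have "?h\<^sup>2 \<le> ?h ^ 3" using h by (intro power_increasing) auto
  finally show ?thesis using h by (simp add: bend''_def divide_le_eq mult.commute)
qed

text \<open>On the far side of \<open>p\<close> the hyperbola exceeds its tangent at 0 by roughly \<open>2 N \<bar>z - p\<bar>\<close>; half of that suffices.\<close>

lemma bend_lower:
  assumes N: "N > 0" and p: "p < 0" and z: "z \<le> p"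
  shows "bend N p z \<ge> N * (p - z) - 1"
proof -
  let ?h0 = "hyperbola N (- p)"
  have h0: "?h0 \<ge> 1" unfolding hyperbola_def by simp
  have "N * (p - z) = sqrt ((N * (p - z))\<^sup>2)" using N z by simp
  also have "\<dots> \<le> hyperbola N (z - p)"
    unfolding hyperbola_def by (intro real_sqrt_le_mono) (simp add: power_mult_distrib power2_commute)
  finally have "N * (p - z) \<le> hyperbola N (z - p)" .
  moreover define k where "k = N\<^sup>2 * (- p) / ?h0"
  moreover have "?h0 + k * p \<le> 1"
  proof -
    have "?h0 + k * p = (?h0\<^sup>2 - N\<^sup>2 * p\<^sup>2) / ?h0"
      using h0 by (simp add: k_def field_simps power2_eq_square)
    also have "\<dots> \<le> 1" using h0 by (simp add: hyperbola_sq)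
    finally show ?thesis .
  qed
  moreover have "k * (p - z) \<ge> 0"
    unfolding k_def using p z h0 by (intro mult_nonneg_nonneg divide_nonneg_pos) auto
  moreover have "bend N p z = hyperbola N (z - p) - (?h0 + k * p) + k * (p - z)"
    unfolding bend_def k_def[symmetric] by (simp add: algebra_simps)
  ultimately show ?thesis by linarith
qed

lemma bend_potential:
  fixes N p :: real
  defines "u \<equiv> (\<lambda>z. u_c z + bend N p z)"
  shows "u \<in> potentials" "potential_data u (bend' N p) (bend'' N p)"
proof -
  have b0: "bend N p 0 = 0" "bend' N p 0 = 0" by (simp_all add: bend_def bend'_def)
  show pd: "potential_data u (bend' N p) (bend'' N p)"
  proof
    fix z :: real assume z: "z \<in> {-1..1}"
    show "((\<lambda>z. u z - u_c z) has_real_derivative bend' N p z) (at z within {-1..1})"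
      by (simp add: u_def has_field_derivative_at_within[OF DERIV_bend])
    show "(bend' N p has_real_derivative bend'' N p z) (at z within {-1..1})"
      by (rule has_field_derivative_at_within[OF DERIV_bend'])
    have "1 - z\<^sup>2 \<ge> 0" using z by (simp add: abs_square_le_1 abs_le_iff)
    then show "1 + (1 - z\<^sup>2) * bend'' N p z > 0"
      using bend''_nonneg[of N p z] by (intro add_pos_nonneg mult_nonneg_nonneg) auto
  qed (simp_all add: smooth_bend'' u_def b0 u_c_def)
  interpret potential_data u "bend' N p" "bend'' N p" by (rule pd)
  have U1: "U 1 = u" by (rule ext) (simp add: segment_path_def)
  have "deriv (deriv u) z > 0" if "z \<in> {-1<..<1}" for z
    using deriv_deriv_U[OF that, of 1] ddu_pos[of 1 z] that unfolding U1 by simp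
  moreover have "deriv u 0 = 0" using deriv_U[of 0 1] unfolding U1 by (simp add: du_def b0)
  moreover have "continuous_on {-1..1} u"
    unfolding u_def by (intro continuous_on_add continuous_on_u_c smooth_on_set_continuous smooth_bend)
  moreover have "u 0 = 0" by (simp add: u_def b0 u_c_def)
  moreover have "smooth_on_set {-1..1} (\<lambda>z. u z - u_c z)" using smooth_bend by (simp add: u_def)
  ultimately show "u \<in> potentials" by (simp add: potentials_def)
qed

text \<open>Along the potentials \<open>u_c + bend N p\<close> with \<open>p\<close> the double zero, \<open>q \<ge> 0\<close> and \<open>q G \<le> 1\<close>, so the K-energy stays
bounded above.  Since \<open>p < 0\<close>, the normalisation at \<open>z = 0\<close> forces \<open>bend N p\<close> to grow linearly in \<open>N\<close> on
\<open>[-1, p)\<close>, so \<open>J\<close> tends to infinity.\<close>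

theorem K_energy_not_proper_critical:
  assumes s: "base_curv gen deg < 0" and x: "0 < x" "x < 1" and deg: "deg > 0"
    and crit: "ext_const (base_curv gen deg) x = threshold x"
  shows "\<not> K_energy_proper gen deg x"
proof
  assume "K_energy_proper gen deg x"
  then obtain \<rho> :: "real \<Rightarrow> real" where \<rho>: "mono \<rho>" "filterlim \<rho> at_top at_top"
    and bound: "\<And>u. u \<in> potentials \<Longrightarrow> modified_K_energy gen deg x u \<ge> \<rho> (J_functional deg x u)"
    unfolding K_energy_proper_def by blast
  define p where "p = vertex x"
  have p: "-1 < p" "p < 0" using vertex_bounds[OF x] by (simp_all add: p_def)
  have vol: "vol_const deg / x \<ge> 0" using x by (simp add: vol_const_def)
  define u where "u N z = u_c z + bend N p z" for N z
  \<comment> \<open>Any compact subinterval of \<open>(-1, p)\<close> would do.\<close>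
  define a b where "a = -1 + (1 + p) / 4" and "b = -1 + (1 + p) / 2"
  have ab: "-1 < a" "a < b" "b < p" using p by (simp_all add: a_def b_def field_simps)
  have "continuous_on {a..b} (\<lambda>z. 2 * (z * artanh z - u_c z))"
  proof -
    have "isCont artanh z" if "z \<in> {a..b}" for z
      using DERIV_isCont[OF DERIV_artanh, of z] that ab p by auto
    then show ?thesis
      by (intro continuous_intros continuous_at_imp_continuous_on continuous_on_subset[OF continuous_on_u_c])
        (use ab p in auto)
  qed
  then obtain L where L: "\<And>z. z \<in> {a..b} \<Longrightarrow> \<bar>2 * (z * artanh z - u_c z)\<bar> \<le> L"
    by (rule continuous_on_Icc_boundedE) (rule that)
  have K: "modified_K_energy gen deg x (u N) \<le> vol_const deg / x * 2" for N
  proof -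
    interpret potential_data "u N" "bend' N p" "bend'' N p"
      using bend_potential(2)[of N p] by (simp add: u_def[abs_def])
    let ?f = "\<lambda>z. q z * ext_factor (base_curv gen deg) x z - (1 + x * z) * ln (1 + q z)"
    have "continuous_on {-1..1} ?f"
      by (intro continuous_intros cont_q cont_ext_factor) (use q_path_pos[of 1] in force)
    then have f: "?f integrable_on {-1..1}" by (rule integrable_continuous_interval)
    have "integral {-1..1} ?f \<le> integral {-1..1} (\<lambda>z :: real. 1 :: real)"
    proof (rule integral_le[OF f])
      fix z :: real assume z: "z \<in> {-1..1}"
      have w: "1 - z\<^sup>2 \<ge> 0" using z by (simp add: abs_square_le_1 abs_le_iff)
      have q: "q z \<ge> 0" using w bend''_nonneg[of N p z] by (simp add: q_def)
      have "q z * ext_factor (base_curv gen deg) x z = ((1 - z\<^sup>2) * threshold x) * ((z - p)\<^sup>2 * bend'' N p z)"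
        by (simp add: q_def ext_factor_decomp[OF x, folded p_def] crit)
      also have "\<dots> \<le> 1 * 1"
      proof (rule mult_mono)
        have "(1 - z\<^sup>2) * threshold x \<le> 1 * 1"
          using w threshold_bounds[OF x] threshold_lt_1[OF x] by (intro mult_mono) auto
        then show "(1 - z\<^sup>2) * threshold x \<le> 1" by simp
      qed (use bend''_bound[of z p N] bend''_nonneg[of N p z] in auto)
      finally show "?f z \<le> 1" using q one_plus_pos[OF x z] by (smt (verit) ln_ge_zero mult_nonneg_nonneg)
    qed auto
    then have "integral {-1..1} ?f \<le> 2" by simp
    then show ?thesis unfolding modified_K_energy_eq[OF s x] using vol by (intro mult_left_mono)
  qed
  have J: "J_functional deg x (u N) \<ge> (N * (p - b) - 1 - L) * (1 - x) * (b - a) / 4"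
    if N: "N > 0" "N * (p - b) - 1 - L \<ge> 0" for N
  proof -
    interpret potential_data "u N" "bend' N p" "bend'' N p"
      using bend_potential(2)[of N p] by (simp add: u_def[abs_def])
    show ?thesis
    proof (rule J_functional_lower[OF x deg _ _ _ N(2)])
      fix z assume z: "z \<in> {a..b}"
      have "N * (p - z) \<ge> N * (p - b)" using N z by (intro mult_left_mono) auto
      then have "bend N p z \<ge> N * (p - b) - 1" using bend_lower[OF N(1) p(2), of z] z ab by auto
      moreover have "v z = bend N p z" by (simp add: v_def u_def)
      ultimately show "N * (p - b) - 1 - L \<le> v z - 2 * (z * artanh z - u_c z)"
        using L[OF z] by (auto simp: abs_le_iff)
    qed (use ab p in auto)
  qed
  obtain R where R: "\<And>r. r \<ge> R \<Longrightarrow> \<rho> r > vol_const deg / x * 2"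
    using \<rho>(2) unfolding filterlim_at_top_dense eventually_at_top_linorder by metis
  define A where "A = max 0 (R * 4 / ((1 - x) * (b - a)))"
  define N where "N = (A + 1 + \<bar>L\<bar>) / (p - b)"
  have N: "N > 0" "N * (p - b) - 1 - L \<ge> A" "A \<ge> 0" using ab by (auto simp: N_def A_def intro!: divide_pos_pos)
  have "R \<le> A * ((1 - x) * (b - a)) / 4"
  proof -
    have "R * 4 / ((1 - x) * (b - a)) \<le> A" by (simp add: A_def)
    then show ?thesis using x ab by (simp add: divide_le_eq)
  qed
  also have "\<dots> \<le> (N * (p - b) - 1 - L) * ((1 - x) * (b - a)) / 4"
    using N x ab by (intro divide_right_mono mult_right_mono) auto
  also have "\<dots> \<le> J_functional deg x (u N)" using J[of N] N by (simp add: mult.assoc)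
  finally have "\<rho> (J_functional deg x (u N)) > vol_const deg / x * 2" by (rule R)
  moreover have "u N \<in> potentials" using bend_potential(1)[of N p] by (simp add: u_def[abs_def])
  ultimately show False using bound[of "u N"] K[of N] by linarith
qed

section \<open>The three regimes\<close>

theorem corollary1p5:
  fixes gen deg :: nat
  assumes "gen > 1" and "deg > 0"
  defines "s \<equiv> base_curv gen deg"
  shows "\<exists>x\<^sub>s. 0 < x\<^sub>s \<and> x\<^sub>s < 1 \<and>
    (\<forall>x. 0 < x \<and> x < x\<^sub>s \<longrightarrow>
       (\<exists>\<Theta>\<in>profiles. admissible_extremal_on s x \<Theta> (-1) 1)) \<and>
    (K_energy_bounded_below gen deg x\<^sub>s \<and> \<not> K_energy_proper gen deg x\<^sub>s \<and>
     (\<exists>z\<^sub>s. -1 < z\<^sub>s \<and> z\<^sub>s < 1 \<and>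
        admissible_extremal_on s x\<^sub>s (extremal_profile s x\<^sub>s) (-1) z\<^sub>s \<and>
        cusp_at (extremal_profile s x\<^sub>s) (-1) z\<^sub>s z\<^sub>s \<and>
        admissible_extremal_on s x\<^sub>s (extremal_profile s x\<^sub>s) z\<^sub>s 1 \<and>
        cusp_at (extremal_profile s x\<^sub>s) z\<^sub>s 1 z\<^sub>s)) \<and>
    (\<forall>x. x\<^sub>s < x \<and> x < 1 \<longrightarrow>
       (\<exists>z\<^sub>1 z\<^sub>2. -1 < z\<^sub>1 \<and> z\<^sub>1 < z\<^sub>2 \<and> z\<^sub>2 < 1 \<and>
          (\<forall>z\<in>{-1<..<z\<^sub>1}. poly (extremal_poly s x) z > 0) \<and>
          admissible_extremal_on s x (extremal_profile s x) (-1) z\<^sub>1 \<and>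
          has_conical_singularity (extremal_profile s x) (-1) z\<^sub>1 z\<^sub>1 \<and>
          (\<forall>z\<in>{z\<^sub>2<..<1}. poly (extremal_poly s x) z > 0) \<and>
          admissible_extremal_on s x (extremal_profile s x) z\<^sub>2 1 \<and>
          has_conical_singularity (extremal_profile s x) z\<^sub>2 1 z\<^sub>2 \<and>
          (\<forall>z\<in>{z\<^sub>1<..<z\<^sub>2}. poly (extremal_poly s x) z < 0) \<and>
          \<not> admissible_extremal_on s x (extremal_profile s x) z\<^sub>1 z\<^sub>2))"
proof -
  have s: "s < 0" using assms by (simp add: s_def base_curv_def divide_neg_pos)
  then have s': "base_curv gen deg < 0" by (simp add: s_def)
  obtain x\<^sub>s where xs: "0 < x\<^sub>s" "x\<^sub>s < 1" and crit: "ext_const s x\<^sub>s = threshold x\<^sub>s"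
    and sub: "\<And>x. 0 < x \<Longrightarrow> x < x\<^sub>s \<Longrightarrow> ext_const s x < threshold x"
    and super: "\<And>x. x\<^sub>s < x \<Longrightarrow> x < 1 \<Longrightarrow> ext_const s x > threshold x"
    using critical_point[OF s] by metis
  have subcritical: "\<exists>\<Theta>\<in>profiles. admissible_extremal_on s x \<Theta> (-1) 1" if "0 < x" "x < x\<^sub>s" for x
  proof -
    have x: "0 < x" "x < 1" using that xs by auto
    note pos = subcritical_positive[OF x sub[OF that]]
    show ?thesis
    proof (rule bexI[of _ "extremal_profile s x"])
      show "admissible_extremal_on s x (extremal_profile s x) (-1) 1"
        by (rule admissible_extremal_on_part[OF s x _ _ pos]) auto
      show "extremal_profile s x \<in> profiles" by (rule extremal_profile_in_profiles[OF x pos])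
    qed
  qed
  have critical: "K_energy_bounded_below gen deg x\<^sub>s \<and> \<not> K_energy_proper gen deg x\<^sub>s \<and>
     (\<exists>z\<^sub>s. -1 < z\<^sub>s \<and> z\<^sub>s < 1 \<and>
        admissible_extremal_on s x\<^sub>s (extremal_profile s x\<^sub>s) (-1) z\<^sub>s \<and>
        cusp_at (extremal_profile s x\<^sub>s) (-1) z\<^sub>s z\<^sub>s \<and>
        admissible_extremal_on s x\<^sub>s (extremal_profile s x\<^sub>s) z\<^sub>s 1 \<and>
        cusp_at (extremal_profile s x\<^sub>s) z\<^sub>s 1 z\<^sub>s)"
  proof (intro conjI exI[of _ "vertex x\<^sub>s"] critical_splitting[OF s xs crit])
    show "K_energy_bounded_below gen deg x\<^sub>s"
      by (rule K_energy_bounded_below_critical[OF s' xs crit[unfolded s_def]])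
    show "\<not> K_energy_proper gen deg x\<^sub>s"
      by (rule K_energy_not_proper_critical[OF s' xs assms(2) crit[unfolded s_def]])
    show "-1 < vertex x\<^sub>s" "vertex x\<^sub>s < 1" using vertex_bounds[OF xs] by auto
  qed
  have supercritical: "\<exists>z\<^sub>1 z\<^sub>2. -1 < z\<^sub>1 \<and> z\<^sub>1 < z\<^sub>2 \<and> z\<^sub>2 < 1 \<and>
          (\<forall>z\<in>{-1<..<z\<^sub>1}. poly (extremal_poly s x) z > 0) \<and>
          admissible_extremal_on s x (extremal_profile s x) (-1) z\<^sub>1 \<and>
          has_conical_singularity (extremal_profile s x) (-1) z\<^sub>1 z\<^sub>1 \<and>
          (\<forall>z\<in>{z\<^sub>2<..<1}. poly (extremal_poly s x) z > 0) \<and>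
          admissible_extremal_on s x (extremal_profile s x) z\<^sub>2 1 \<and>
          has_conical_singularity (extremal_profile s x) z\<^sub>2 1 z\<^sub>2 \<and>
          (\<forall>z\<in>{z\<^sub>1<..<z\<^sub>2}. poly (extremal_poly s x) z < 0) \<and>
          \<not> admissible_extremal_on s x (extremal_profile s x) z\<^sub>1 z\<^sub>2"
    if "x\<^sub>s < x" "x < 1" for x
  proof -
    have x: "0 < x" "x < 1" using that xs by auto
    have "ext_const s x > threshold x" by (rule super[OF that])
    note split = supercritical_splitting[OF s x this]
    obtain z1 z2 where z: "-1 < z1" "z1 < z2" "z2 < 1"
      and left: "\<And>z. z \<in> {-1<..<z1} \<Longrightarrow> poly (ext_poly s x) z > 0"
      and middle: "\<And>z. z \<in> {z1<..<z2} \<Longrightarrow> poly (ext_poly s x) z < 0"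
      and right: "\<And>z. z \<in> {z2<..<1} \<Longrightarrow> poly (ext_poly s x) z > 0"
      and cones: "has_conical_singularity (extremal_profile s x) (-1) z1 z1"
        "has_conical_singularity (extremal_profile s x) z2 1 z2"
      by (rule split) (rule that)
    have negative: "\<not> admissible_extremal_on s x (extremal_profile s x) z1 z2"
    proof
      let ?y = "(z1 + z2) / 2"
      assume "admissible_extremal_on s x (extremal_profile s x) z1 z2"
      moreover have y: "?y \<in> {z1<..<z2}" using z by simp
      ultimately have "extremal_profile s x ?y > 0" unfolding admissible_extremal_on_def by blast
      moreover have "extremal_profile s x ?y < 0"
        using middle[OF y] one_plus_pos[OF x, of ?y] z
        unfolding extremal_profile_def extremal_poly_eq[OF x] by (intro divide_neg_pos) auto
      ultimately show False by simp
    qed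
    have outer: "admissible_extremal_on s x (extremal_profile s x) (-1) z1"
      "admissible_extremal_on s x (extremal_profile s x) z2 1"
      by (rule admissible_extremal_on_part[OF s x _ _ left]; use z in simp)
        (rule admissible_extremal_on_part[OF s x _ _ right]; use z in simp)
    show ?thesis
      by (rule exI[of _ z1], rule exI[of _ z2])
        (use z left middle right cones negative outer in \<open>auto simp: extremal_poly_eq[OF x]\<close>)
  qed
  show ?thesis
    using xs subcritical critical supercritical by (intro exI[of _ x\<^sub>s]) blast
qed

end
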